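(* Let $F$ be an irreducible finite-dimensional $\mathfrak g_0$-module with highest weight $\mu$ (with respect to $(h_x,h_y,t,C)$), extended to $\mathfrak g_{\ge 0}$ by letting $\mathfrak g_{>0}$ act trivially. A vector $\vec m\in \mathrm{Ind}(F)$ is a nontrivial highest weight singular vector of degree $1$ if and only if $\vec m$ is, up to a (nonzero) scalar, one of the following vectors: (a) $\mu=\left(m,n,-\frac{m+n}{2},\frac{m-n}{2}\right)$ with $m,n\in\mathbb Z_{\ge 0}$, and $\vec m=w_{11}\otimes x_1^m y_1^n$; (b) $\mu=\left(m,n,1+\frac{m-n}{2},-1-\frac{m+n}{2}\right)$ with $m\in\mathbb Z_{>0}$, $n\in\mathbb Z_{\ge 0}$, and $\vec m=w_{21}\otimes x_1^m y_1^n-w_{11}\otimes x_1^{m-1}x_2y_1^n$; (c) $\mu=\left(m,n,2+\frac{m+n}{2},\frac{n-m}{2}\right)$ with $m,n\in\mathbb Z_{>0}$, and $\vec m=w_{22}\otimes x_1^m y_1^n-w_{12}\otimes x_1^{m-1}x_2y_1^n-w_{21}\otimes x_1^m y_1^{n-1}y_2+w_{11}\otimes x_1^{m-1}x_2y_1^{n-1}y_2$; (d) $\mu=\left(m,n,1+\frac{n-m}{2},1+\frac{m+n}{2}\right)$ with $m\in\mathbb Z_{\ge 0}$, $n\in\mathbb Z_{>0}$, and $\vec m=w_{12}\otimes x_1^m y_1^n-w_{11}\otimes x_1^m y_1^{n-1}y_2$.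
   Context: Everything is over $\mathbb C$. Let $\Lambda(4)$ be the Grassmann superalgebra in the odd variables $\xi_1,\xi_2,\xi_3,\xi_4$, let $t$ be an even variable, $\partial_i=\partial/\partial\xi_i$ (left derivative), $p$ the parity. $K(1,4)_+$ is the space $\mathbb C[t]\otimes\Lambda(4)$ with Lie superbracket $$[f,g]=\Big(2f-\sum_{i}\xi_i\partial_i f\Big)\partial_t g-\partial_t f\Big(2g-\sum_i\xi_i\partial_i g\Big)+(-1)^{p(f)}\sum_{i}\partial_i f\,\partial_i g .$$ Write $\xi_{i_1\cdots i_r}=\xi_{i_1}\cdots\xi_{i_r}$. Let $\mathfrak g=K(1,4)_+\oplus\mathbb C C$ be the central extension (with $C$ even and central) with bracket $[a,b]_{\mathfrak g}=[a,b]+\psi(a,b)C$, where $\psi$ is the bilinear form with $\psi(a,b)=-(-1)^{p(a)p(b)}\psi(b,a)$ determined by $\psi(1,\xi_{1234})=-2$, $\psi(\xi_i,\partial_i\xi_{1234})=-1$ for $i=1,\dots,4$, all other values on pairs of basis monomials $t^m\xi_{i_1\cdots i_r}$ ($i_1<\dots<i_r$) being zero up to skew-symmetry. ($\mathfrak g$ is the annihilation superalgebra of the conformal superalgebra $K'_4$.) $\mathfrak g$ is $\mathbb Z$-graded by $\deg(t^m\xi_{i_1\cdots i_r})=2m+r-2$, $\deg C=0$; $\mathfrak g_{>0}$, $\mathfrak g_{\ge0}$, $\mathfrak g_{<0}$ denote the sums of the corresponding components. So $\mathfrak g_{-2}=\langle 1\rangle$, $\mathfrak g_{-1}=\langle\xi_1,\dots,\xi_4\rangle$,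 $\mathfrak g_0=\langle C,t,\xi_{ij}\rangle\cong\mathfrak{so}(4)\oplus\mathbb Ct\oplus\mathbb CC$. In $\mathfrak g_0$ put $h_x=-i\xi_{12}+i\xi_{34}$, $h_y=-i\xi_{12}-i\xi_{34}$, $e_x=\frac12(-\xi_{13}-\xi_{24}-i\xi_{14}+i\xi_{23})$, $f_x=\frac12(\xi_{13}+\xi_{24}-i\xi_{14}+i\xi_{23})$, $e_y=\frac12(-\xi_{13}+\xi_{24}+i\xi_{14}+i\xi_{23})$, $f_y=\frac12(\xi_{13}-\xi_{24}+i\xi_{14}+i\xi_{23})$; $\{e_x,h_x,f_x\}$ and $\{e_y,h_y,f_y\}$ are two commuting $\mathfrak{sl}_2$-triples. Weights are written $\mu=(m,n,\mu_t,\mu_C)$ with respect to $h_x,h_y,t,C$. The irreducible $\mathfrak g_0$-module of highest weight $(m,n,\mu_t,\mu_C)$ is realized as the space of polynomials in $x_1,x_2,y_1,y_2$ homogeneous of degree $m$ in $x_1,x_2$ and of degree $n$ in $y_1,y_2$, with $e_x=x_1\partial_{x_2}$, $f_x=x_2\partial_{x_1}$, $h_x=x_1\partial_{x_1}-x_2\partial_{x_2}$, $e_y=y_1\partial_{y_2}$, $f_y=y_2\partial_{y_1}$, $h_y=y_1\partial_{y_1}-y_2\partial_{y_2}$, and $t,C$ acting by the scalars $\mu_t,\mu_C$. $\mathrm{Ind}(F)=U(\mathfrak g)\otimes_{U(\mathfrak g_{\ge0})}F\cong U(\mathfrak g_{<0})\otimes F$ as a vector space, graded by $\mathbb Z_{\ge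 0}$ via minus the degree of $U(\mathfrak g_{<0})$. Let $\eta_i$ be the image of $\xi_i$ in $U(\mathfrak g_{<0})$ and $w_{11}=\eta_2+i\eta_1$, $w_{22}=\eta_2-i\eta_1$, $w_{12}=-\eta_4+i\eta_3$, $w_{21}=\eta_4+i\eta_3$. A singular vector is a vector annihilated by $\mathfrak g_{>0}$; it is nontrivial if it is nonzero of positive degree; it is a highest weight singular vector if moreover it is annihilated by $e_x$ and $e_y$. *)

theory Defs
  imports Complex_Main
    "HOL-Library.Poly_Mapping"
    "HOL-Library.Function_Algebras"
    "HOL-Library.Product_Plus"
    "HOL-Computational_Algebra.Polynomial"
begin

section \<open>The Lie superalgebra \<open>\<gg>\<close>\<close>

datatype idx = I1 | I2 | I3 | I4

instance idx :: finite
proof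
  have "(UNIV :: idx set) = {I1, I2, I3, I4}"
    using idx.exhaust by auto
  then show "finite (UNIV :: idx set)" by (metis finite.emptyI finite.insertI)
qed

primrec pos :: "idx \<Rightarrow> nat" where
  "pos I1 = 1" | "pos I2 = 2" | "pos I3 = 3" | "pos I4 = 4"

text \<open>
  An element \<open>f\<close> of \<open>\<complex>[t] \<otimes> \<Lambda>(4)\<close> is given by its coefficients: \<open>f S\<close> is the polynomial in \<open>t\<close>
  that multiplies the product of the \<open>\<xi>\<^sub>i\<close>, \<open>i \<in> S\<close>, taken in increasing order.
  Addition is pointwise. The pointwise product of functions is never used; the product of
  \<open>\<complex>[t] \<otimes> \<Lambda>(4)\<close> is \<open>kmult\<close>.
\<close>

type_synonym k14 = "idx set \<Rightarrow> complex poly"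

definition kscale :: "complex \<Rightarrow> k14 \<Rightarrow> k14" where
  "kscale c f = (\<lambda>S. smult c (f S))"

definition kmon :: "nat \<Rightarrow> idx set \<Rightarrow> k14" where
  "kmon m S = (\<lambda>T. if T = S then monom 1 m else 0)"

definition reorder_sign :: "idx set \<Rightarrow> idx set \<Rightarrow> complex" where
  "reorder_sign A B = (-1) ^ card {(i, j). i \<in> A \<and> j \<in> B \<and> pos j < pos i}"

definition kmult :: "k14 \<Rightarrow> k14 \<Rightarrow> k14" where
  "kmult f g = (\<lambda>S. \<Sum>A\<in>Pow S. smult (reorder_sign A (S - A)) (f A * g (S - A)))"

abbreviation xi :: "idx \<Rightarrow> k14" where
  "xi i \<equiv> kmon 0 {i}"

abbreviation xi2 :: "idx \<Rightarrow> idx \<Rightarrow> k14" where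
  "xi2 i j \<equiv> kmult (xi i) (xi j)"

abbreviation xi_top :: k14 where
  "xi_top \<equiv> kmult (xi I1) (kmult (xi I2) (kmult (xi I3) (xi I4)))"

definition d_t :: "k14 \<Rightarrow> k14" where
  "d_t f = (\<lambda>S. pderiv (f S))"

definition d_xi :: "idx \<Rightarrow> k14 \<Rightarrow> k14" where
  "d_xi i f =
     (\<lambda>S. if i \<in> S then 0 else smult ((-1) ^ card {j \<in> S. pos j < pos i}) (f (insert i S)))"

definition euler :: "k14 \<Rightarrow> k14" where
  "euler f = (\<Sum>i\<in>UNIV. kmult (xi i) (d_xi i f))"

text \<open>The linear map \<open>f \<mapsto> (-1)\<^sup>p\<^sup>(\<^sup>f\<^sup>) f\<close> (for homogeneous \<open>f\<close>).\<close>

definition parity_op :: "k14 \<Rightarrow> k14" where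
  "parity_op f = (\<lambda>S. smult ((-1) ^ card S) (f S))"

definition kbr :: "k14 \<Rightarrow> k14 \<Rightarrow> k14" where
  "kbr f g = kmult (kscale 2 f - euler f) (d_t g) - kmult (d_t f) (kscale 2 g - euler g)
     + (\<Sum>i\<in>UNIV. kmult (d_xi i (parity_op f)) (d_xi i g))"

text \<open>
  The form \<open>\<psi>\<close> only sees the coefficients at \<open>t\<^sup>0\<close>. Since \<open>\<partial>\<^sub>i \<xi>\<^sub>1\<^sub>2\<^sub>3\<^sub>4\<close> is \<open>\<plusminus>1\<close> times the basis
  monomial with index set \<open>- {i}\<close>, the number \<open>cod i f\<close> below is the coefficient of \<open>f\<close>
  at \<open>\<partial>\<^sub>i \<xi>\<^sub>1\<^sub>2\<^sub>3\<^sub>4\<close>. Skew-symmetry gives \<open>\<psi>(\<xi>\<^sub>1\<^sub>2\<^sub>3\<^sub>4, 1) = 2\<close> and, both arguments being odd,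
  \<open>\<psi>(\<partial>\<^sub>i \<xi>\<^sub>1\<^sub>2\<^sub>3\<^sub>4, \<xi>\<^sub>i) = -1\<close>.
\<close>

definition co :: "idx set \<Rightarrow> k14 \<Rightarrow> complex" where
  "co S f = coeff (f S) 0"

definition cod :: "idx \<Rightarrow> k14 \<Rightarrow> complex" where
  "cod i f = co (- {i}) (d_xi i xi_top) * co (- {i}) f"

definition psi :: "k14 \<Rightarrow> k14 \<Rightarrow> complex" where
  "psi f g = - 2 * co {} f * co UNIV g + 2 * co UNIV f * co {} g
     - (\<Sum>i\<in>UNIV. co {i} f * cod i g + cod i f * co {i} g)"

text \<open>\<open>(f, z)\<close> stands for \<open>f + z C\<close>.\<close>

type_synonym gvec = "k14 \<times> complex"

definition gscale :: "complex \<Rightarrow> gvec \<Rightarrow> gvec" where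
  "gscale c a = (kscale c (fst a), c * snd a)"

definition gbr :: "gvec \<Rightarrow> gvec \<Rightarrow> gvec" where
  "gbr a b = (kbr (fst a) (fst b), psi (fst a) (fst b))"

abbreviation emb :: "k14 \<Rightarrow> gvec" where
  "emb f \<equiv> (f, 0)"

definition gpar :: "nat \<Rightarrow> gvec set" where
  "gpar p = {a. (\<forall>S. fst a S \<noteq> 0 \<longrightarrow> card S mod 2 = p) \<and> (snd a \<noteq> 0 \<longrightarrow> p = 0)}"

text \<open>The set of degrees in which \<open>a\<close> has a nonzero component.\<close>

definition gdegs :: "gvec \<Rightarrow> int set" where
  "gdegs a = {2 * int m + int (card S) - 2 | m S. coeff (fst a S) m \<noteq> 0}
     \<union> (if snd a \<noteq> 0 then {0} else {})"

text \<open>The sum of the homogeneous components \<open>\<gg>\<^sub>d\<close> with \<open>d \<in> D\<close>.\<close>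

definition gsum :: "int set \<Rightarrow> gvec set" where
  "gsum D = {a. gdegs a \<subseteq> D}"

definition g_h_x :: gvec where
  "g_h_x = emb (kscale (-\<i>) (xi2 I1 I2) + kscale \<i> (xi2 I3 I4))"

definition g_h_y :: gvec where
  "g_h_y = emb (kscale (-\<i>) (xi2 I1 I2) - kscale \<i> (xi2 I3 I4))"

definition g_e_x :: gvec where
  "g_e_x = emb (kscale (1/2)
     (- xi2 I1 I3 - xi2 I2 I4 - kscale \<i> (xi2 I1 I4) + kscale \<i> (xi2 I2 I3)))"

definition g_f_x :: gvec where
  "g_f_x = emb (kscale (1/2)
     (xi2 I1 I3 + xi2 I2 I4 - kscale \<i> (xi2 I1 I4) + kscale \<i> (xi2 I2 I3)))"

definition g_e_y :: gvec where
  "g_e_y = emb (kscale (1/2)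
     (- xi2 I1 I3 + xi2 I2 I4 + kscale \<i> (xi2 I1 I4) + kscale \<i> (xi2 I2 I3)))"

definition g_f_y :: gvec where
  "g_f_y = emb (kscale (1/2)
     (xi2 I1 I3 - xi2 I2 I4 + kscale \<i> (xi2 I1 I4) + kscale \<i> (xi2 I2 I3)))"

definition g_t :: gvec where
  "g_t = emb (kmon 1 {})"

definition g_C :: gvec where
  "g_C = (0, 1)"


section \<open>The universal enveloping algebra\<close>

text \<open>
  With words under concatenation as (additively written) monoid, \<open>gvec list \<Rightarrow>\<^sub>0 complex\<close> with
  the convolution product of \<open>Poly_Mapping\<close> is the free associative algebra on the set \<open>\<gg>\<close>.
\<close>

instantiation list :: (type) monoid_add
begin

definition zero_list :: "'a list" where "zero_list = []"

definition plus_list :: "'a list \<Rightarrow> 'a list \<Rightarrow> 'a list" where "plus_list = (@)"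

instance by standard (simp_all add: zero_list_def plus_list_def)

end

type_synonym falg = "gvec list \<Rightarrow>\<^sub>0 complex"

abbreviation fgen :: "gvec \<Rightarrow> falg" where
  "fgen a \<equiv> Poly_Mapping.single [a] 1"

abbreviation fconst :: "complex \<Rightarrow> falg" where
  "fconst c \<equiv> Poly_Mapping.single [] c"

definition urels :: "falg set" where
  "urels = {fgen (a + b) - fgen a - fgen b | a b. True}
     \<union> {fgen (gscale c a) - fconst c * fgen a | c a. True}
     \<union> {fgen a * fgen b - fconst ((-1) ^ (p * q)) * (fgen b * fgen a) - fgen (gbr a b)
         | a b p q. p \<in> {0, 1} \<and> q \<in> {0, 1} \<and> a \<in> gpar p \<and> b \<in> gpar q}"

text \<open>The two-sided ideal generated by \<open>urels\<close>.\<close>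

inductive_set uideal :: "falg set" where
  zero: "0 \<in> uideal"
| step: "x \<in> uideal \<Longrightarrow> r \<in> urels \<Longrightarrow> x + p * r * q \<in> uideal"

lemma uideal_add: "x \<in> uideal \<Longrightarrow> y \<in> uideal \<Longrightarrow> y + x \<in> uideal"
  by (induction rule: uideal.induct) (auto simp: add.assoc[symmetric] intro: uideal.step)

lemma uideal_mult_left: "x \<in> uideal \<Longrightarrow> z * x \<in> uideal"
proof (induction rule: uideal.induct)
  case (step x r p q)
  then show ?case using uideal.step[of "z * x" r "z * p" q]
    by (simp add: distrib_left mult.assoc)
qed (simp add: uideal.zero)

lemma uideal_mult_right: "x \<in> uideal \<Longrightarrow> x * z \<in> uideal"
proof (induction rule: uideal.induct)
  case (step x r p q)
  then show ?case using uideal.step[of "x * z" r p "q * z"]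
    by (simp add: distrib_right mult.assoc)
qed (simp add: uideal.zero)

lemma uideal_minus: "x \<in> uideal \<Longrightarrow> - x \<in> uideal"
  using uideal_mult_left[of x "- 1"] by simp

lemma uideal_diff: "x \<in> uideal \<Longrightarrow> y \<in> uideal \<Longrightarrow> x - y \<in> uideal"
  using uideal_add[of "- y" x] uideal_minus[of y] by simp

definition urel :: "falg \<Rightarrow> falg \<Rightarrow> bool" where
  "urel x y \<longleftrightarrow> x - y \<in> uideal"

lemma equivp_urel: "equivp urel"
proof (rule equivpI)
  show "reflp urel" by (simp add: reflp_def urel_def uideal.zero)
  show "symp urel"
  proof (rule sympI)
    fix x y assume "urel x y"
    then show "urel y x" using uideal_minus[of "x - y"] by (simp add: urel_def)
  qed
  show "transp urel"
  proof (rule transpI)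
    fix x y z assume "urel x y" "urel y z"
    then show "urel x z" using uideal_add[of "y - z" "x - y"] by (simp add: urel_def)
  qed
qed

text \<open>\<open>U(\<gg>)\<close>: the tensor algebra modulo the supercommutator relations.\<close>

quotient_type ug = falg / urel
  by (rule equivp_urel)

lemma lookup_times_Nil:
  fixes x y :: falg
  shows "Poly_Mapping.lookup (x * y) [] = Poly_Mapping.lookup x [] * Poly_Mapping.lookup y []"
proof -
  have *: "Sum_any (\<lambda>q. Poly_Mapping.lookup y q when [] = l + q) =
      (Poly_Mapping.lookup y [] when l = [])" for l
    by (cases "l = []") (simp_all add: plus_list_def)
  show ?thesis
    unfolding lookup_mult * by (simp add: mult_when)
qed

lemma uideal_lookup_Nil: "x \<in> uideal \<Longrightarrow> Poly_Mapping.lookup x [] = 0"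
  by (induction rule: uideal.induct)
    (auto simp: lookup_add lookup_times_Nil lookup_minus lookup_single urels_def)

instantiation ug :: ring_1
begin

lift_definition zero_ug :: ug is 0 .
lift_definition one_ug :: ug is 1 .
lift_definition plus_ug :: "ug \<Rightarrow> ug \<Rightarrow> ug" is "(+)"
proof -
  fix a b c d :: falg
  assume "urel a b" "urel c d"
  then show "urel (a + c) (b + d)"
    using uideal_add[of "c - d" "a - b"] by (simp add: urel_def add_diff_add)
qed
lift_definition uminus_ug :: "ug \<Rightarrow> ug" is uminus
proof -
  fix a b :: falg
  assume "urel a b"
  then show "urel (- a) (- b)"
    using uideal_minus[of "a - b"] by (simp add: urel_def)
qed
lift_definition minus_ug :: "ug \<Rightarrow> ug \<Rightarrow> ug" is "(-)"
proof -
  fix a b c d :: falg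
  assume "urel a b" "urel c d"
  then have "(a - b) - (c - d) \<in> uideal" unfolding urel_def by (rule uideal_diff)
  then show "urel (a - c) (b - d)" by (simp add: urel_def algebra_simps)
qed
lift_definition times_ug :: "ug \<Rightarrow> ug \<Rightarrow> ug" is "(*)"
proof -
  fix a b c d :: falg
  assume "urel a b" "urel c d"
  then have "a * (c - d) + (a - b) * d \<in> uideal"
    unfolding urel_def by (intro uideal_add uideal_mult_left uideal_mult_right)
  then show "urel (a * c) (b * d)" unfolding urel_def by (simp add: algebra_simps)
qed

instance
proof
  show "(0 :: ug) \<noteq> 1"
  proof (transfer, rule notI)
    assume "urel 0 1"
    then have "Poly_Mapping.lookup (0 - 1 :: falg) [] = 0"
      unfolding urel_def by (rule uideal_lookup_Nil)
    then show False by (simp add: lookup_minus lookup_one zero_list_def)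
  qed
next
  fix a b c :: ug
  show "a * b * c = a * (b * c)"
    by transfer (simp add: urel_def mult.assoc uideal.zero)
  show "1 * a = a" by transfer (simp add: urel_def uideal.zero)
  show "a * 1 = a" by transfer (simp add: urel_def uideal.zero)
  show "a + b + c = a + (b + c)" by transfer (simp add: urel_def add.assoc uideal.zero)
  show "a + b = b + a" by transfer (simp add: urel_def add.commute uideal.zero)
  show "0 + a = a" by transfer (simp add: urel_def uideal.zero)
  show "- a + a = 0" by transfer (simp add: urel_def uideal.zero)
  show "a - b = a + - b" by transfer (simp add: urel_def uideal.zero)
  show "(a + b) * c = a * c + b * c" by transfer (simp add: urel_def distrib_right uideal.zero)
  show "a * (b + c) = a * b + a * c" by transfer (simp add: urel_def distrib_left uideal.zero)
qed

end


definition uconst :: "complex \<Rightarrow> ug" where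
  "uconst c = abs_ug (fconst c)"

definition iota :: "gvec \<Rightarrow> ug" where
  "iota a = abs_ug (fgen a)"

text \<open>
  Products in \<open>U(\<gg>)\<close> of homogeneous elements of negative degree with total degree \<open>- d\<close>; they
  span the component of degree \<open>- d\<close> of \<open>U(\<gg>\<^sub><\<^sub>0)\<close>.
\<close>

definition neg_words :: "nat \<Rightarrow> ug set" where
  "neg_words d = {prod_list (map iota as) | as js.
     list_all2 (\<lambda>a j. j < 0 \<and> a \<in> gsum {j}) as js \<and> sum_list js = - int d}"

definition eta :: "idx \<Rightarrow> ug" where
  "eta i = iota (emb (xi i))"

definition w11 :: ug where "w11 = eta I2 + uconst \<i> * eta I1"
definition w22 :: ug where "w22 = eta I2 - uconst \<i> * eta I1"
definition w12 :: ug where "w12 = - eta I4 + uconst \<i> * eta I3"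
definition w21 :: ug where "w21 = eta I4 + uconst \<i> * eta I3"


section \<open>\<open>\<gg>\<^sub>0\<close>-modules\<close>

text \<open>
  A \<open>\<gg>\<^sub>0\<close>-module is a complex vector space (a type with scalar multiplication \<open>sc\<close>) with
  an action \<open>\<rho>\<close> of which only the restriction to \<open>\<gg>\<^sub>0\<close> matters. As \<open>\<gg>\<^sub>0\<close> is purely even, its
  bracket acts by ordinary commutators.
\<close>

definition g0_module :: "(complex \<Rightarrow> 'v::ab_group_add \<Rightarrow> 'v) \<Rightarrow> (gvec \<Rightarrow> 'v \<Rightarrow> 'v) \<Rightarrow> bool" where
  "g0_module sc \<rho> \<longleftrightarrow> vector_space sc \<and>
     (\<forall>a\<in>gsum {0}. Vector_Spaces.linear sc sc (\<rho> a)) \<and>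
     (\<forall>a\<in>gsum {0}. \<forall>b\<in>gsum {0}. \<forall>v. \<rho> (a + b) v = \<rho> a v + \<rho> b v) \<and>
     (\<forall>c. \<forall>a\<in>gsum {0}. \<forall>v. \<rho> (gscale c a) v = sc c (\<rho> a v)) \<and>
     (\<forall>a\<in>gsum {0}. \<forall>b\<in>gsum {0}. \<forall>v. \<rho> (gbr a b) v = \<rho> a (\<rho> b v) - \<rho> b (\<rho> a v))"

definition finite_dim :: "(complex \<Rightarrow> 'v::ab_group_add \<Rightarrow> 'v) \<Rightarrow> bool" where
  "finite_dim sc \<longleftrightarrow> (\<exists>B. finite B \<and> module.span sc B = UNIV)"

definition irreducible_g0_module ::
    "(complex \<Rightarrow> 'v::ab_group_add \<Rightarrow> 'v) \<Rightarrow> (gvec \<Rightarrow> 'v \<Rightarrow> 'v) \<Rightarrow> bool" where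
  "irreducible_g0_module sc \<rho> \<longleftrightarrow> g0_module sc \<rho> \<and> (\<exists>v::'v. v \<noteq> 0) \<and>
     (\<forall>W. module.subspace sc W \<and> (\<forall>a\<in>gsum {0}. \<rho> a ` W \<subseteq> W) \<longrightarrow> W = {0} \<or> W = UNIV)"

definition has_highest_weight ::
    "(complex \<Rightarrow> 'v::ab_group_add \<Rightarrow> 'v) \<Rightarrow> (gvec \<Rightarrow> 'v \<Rightarrow> 'v) \<Rightarrow>
      complex \<times> complex \<times> complex \<times> complex \<Rightarrow> bool" where
  "has_highest_weight sc \<rho> = (\<lambda>(\<mu>x, \<mu>y, \<mu>t, \<mu>C). \<exists>v. v \<noteq> 0 \<and> \<rho> g_e_x v = 0 \<and> \<rho> g_e_y v = 0 \<and>
     \<rho> g_h_x v = sc \<mu>x v \<and> \<rho> g_h_y v = sc \<mu>y v \<and> \<rho> g_t v = sc \<mu>t v \<and> \<rho> g_C v = sc \<mu>C v)"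

text \<open>
  Polynomials in \<open>x\<^sub>1, x\<^sub>2, y\<^sub>1, y\<^sub>2\<close>: finitely supported functions from exponent vectors to
  coefficients, with the convolution product of \<open>Poly_Mapping\<close>.
\<close>

datatype pvar = X1 | X2 | Y1 | Y2

type_synonym xypoly = "(pvar \<Rightarrow>\<^sub>0 nat) \<Rightarrow>\<^sub>0 complex"

definition pv :: "pvar \<Rightarrow> xypoly" where
  "pv x = Poly_Mapping.single (Poly_Mapping.single x 1) 1"

definition pd :: "pvar \<Rightarrow> xypoly \<Rightarrow> xypoly" where
  "pd x p = (\<Sum>k\<in>Poly_Mapping.keys p. Poly_Mapping.single (k - Poly_Mapping.single x 1)
     (of_nat (Poly_Mapping.lookup k x) * Poly_Mapping.lookup p k))"

definition bihom :: "nat \<Rightarrow> nat \<Rightarrow> xypoly set" where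
  "bihom m n = {p. \<forall>k\<in>Poly_Mapping.keys p.
     Poly_Mapping.lookup k X1 + Poly_Mapping.lookup k X2 = m \<and>
     Poly_Mapping.lookup k Y1 + Poly_Mapping.lookup k Y2 = n}"

definition fscale :: "complex \<Rightarrow> ('a \<Rightarrow>\<^sub>0 complex) \<Rightarrow> ('a \<Rightarrow>\<^sub>0 complex)" where
  "fscale c = Poly_Mapping.map ((*) c)"

text \<open>
  \<open>\<Phi>\<close> is an isomorphism from the polynomial model of highest weight \<open>(m, n, \<mu>t, \<mu>C)\<close> onto the
  module.
\<close>

definition realization ::
    "(complex \<Rightarrow> 'v::ab_group_add \<Rightarrow> 'v) \<Rightarrow> (gvec \<Rightarrow> 'v \<Rightarrow> 'v) \<Rightarrow>
      nat \<Rightarrow> nat \<Rightarrow> complex \<Rightarrow> complex \<Rightarrow> (xypoly \<Rightarrow> 'v) \<Rightarrow> bool" where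
  "realization sc \<rho> m n \<mu>t \<mu>C \<Phi> \<longleftrightarrow>
     bij_betw \<Phi> (bihom m n) UNIV \<and>
     (\<forall>p\<in>bihom m n. \<forall>q\<in>bihom m n. \<Phi> (p + q) = \<Phi> p + \<Phi> q) \<and>
     (\<forall>c. \<forall>p\<in>bihom m n. \<Phi> (fscale c p) = sc c (\<Phi> p)) \<and>
     (\<forall>p\<in>bihom m n.
        \<rho> g_e_x (\<Phi> p) = \<Phi> (pv X1 * pd X2 p) \<and>
        \<rho> g_f_x (\<Phi> p) = \<Phi> (pv X2 * pd X1 p) \<and>
        \<rho> g_h_x (\<Phi> p) = \<Phi> (pv X1 * pd X1 p - pv X2 * pd X2 p) \<and>
        \<rho> g_e_y (\<Phi> p) = \<Phi> (pv Y1 * pd Y2 p) \<and>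
        \<rho> g_f_y (\<Phi> p) = \<Phi> (pv Y2 * pd Y1 p) \<and>
        \<rho> g_h_y (\<Phi> p) = \<Phi> (pv Y1 * pd Y1 p - pv Y2 * pd Y2 p) \<and>
        \<rho> g_t (\<Phi> p) = \<Phi> (fscale \<mu>t p) \<and>
        \<rho> g_C (\<Phi> p) = \<Phi> (fscale \<mu>C p))"


section \<open>The induced module\<close>

text \<open>
  \<open>Ind(F) = U(\<gg>) \<otimes> F\<close>, the tensor product over \<open>U(\<gg>\<^sub>\<ge>\<^sub>0)\<close>, is the quotient of the free vector
  space on \<open>U(\<gg>) \<times> F\<close> by the usual relations. As \<open>U(\<gg>\<^sub>\<ge>\<^sub>0)\<close> is generated by \<open>\<gg>\<^sub>\<ge>\<^sub>0 = \<gg>\<^sub>0 \<oplus> \<gg>\<^sub>>\<^sub>0\<close>,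
  balancedness \<open>u a \<otimes> v = u \<otimes> a v\<close> need only be imposed for \<open>a \<in> \<gg>\<^sub>0\<close>, which acts by \<open>\<rho>\<close>, and
  \<open>a \<in> \<gg>\<^sub>>\<^sub>0\<close>, which acts by zero.
\<close>

type_synonym 'v tfree = "(ug \<times> 'v) \<Rightarrow>\<^sub>0 complex"

abbreviation tens :: "ug \<Rightarrow> 'v \<Rightarrow> 'v tfree" (infix "\<otimes>" 73) where
  "u \<otimes> v \<equiv> Poly_Mapping.single (u, v) 1"

definition tensor_rels ::
    "(complex \<Rightarrow> 'v::ab_group_add \<Rightarrow> 'v) \<Rightarrow> (gvec \<Rightarrow> 'v \<Rightarrow> 'v) \<Rightarrow> 'v tfree set" where
  "tensor_rels sc \<rho> =
       {(u + u') \<otimes> v - u \<otimes> v - u' \<otimes> v | u u' v. True}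
     \<union> {u \<otimes> (v + v') - u \<otimes> v - u \<otimes> v' | u v v'. True}
     \<union> {(uconst c * u) \<otimes> v - fscale c (u \<otimes> v) | c u v. True}
     \<union> {u \<otimes> sc c v - fscale c (u \<otimes> v) | c u v. True}
     \<union> {(u * iota a) \<otimes> v - u \<otimes> \<rho> a v | u a v. a \<in> gsum {0}}
     \<union> {(u * iota a) \<otimes> v | u a v. a \<in> gsum {0<..}}"

text \<open>The class in \<open>Ind(F)\<close> of \<open>p\<close>, as a coset; zero in \<open>Ind(F)\<close> is \<open>icls sc \<rho> 0\<close>.\<close>

definition icls ::
    "(complex \<Rightarrow> 'v::ab_group_add \<Rightarrow> 'v) \<Rightarrow> (gvec \<Rightarrow> 'v \<Rightarrow> 'v) \<Rightarrow> 'v tfree \<Rightarrow> 'v tfree set" where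
  "icls sc \<rho> p = {q. q - p \<in> module.span fscale (tensor_rels sc \<rho>)}"

definition Ind ::
    "(complex \<Rightarrow> 'v::ab_group_add \<Rightarrow> 'v) \<Rightarrow> (gvec \<Rightarrow> 'v \<Rightarrow> 'v) \<Rightarrow> 'v tfree set set" where
  "Ind sc \<rho> = range (icls sc \<rho>)"

text \<open>The action of \<open>U(\<gg>)\<close>: linear extension of \<open>u \<cdot> (u' \<otimes> v) = u u' \<otimes> v\<close>.\<close>

definition lact :: "ug \<Rightarrow> 'v tfree \<Rightarrow> 'v tfree" where
  "lact u p = (\<Sum>k\<in>Poly_Mapping.keys p.
     Poly_Mapping.single (u * fst k, snd k) (Poly_Mapping.lookup p k))"

definition ind_act ::
    "(complex \<Rightarrow> 'v::ab_group_add \<Rightarrow> 'v) \<Rightarrow> (gvec \<Rightarrow> 'v \<Rightarrow> 'v) \<Rightarrow> ug \<Rightarrow> 'v tfree set \<Rightarrow> 'v tfree set"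
  where
  "ind_act sc \<rho> u M = (\<Union>p\<in>M. icls sc \<rho> (lact u p))"

definition Ind_deg ::
    "(complex \<Rightarrow> 'v::ab_group_add \<Rightarrow> 'v) \<Rightarrow> (gvec \<Rightarrow> 'v \<Rightarrow> 'v) \<Rightarrow> nat \<Rightarrow> 'v tfree set set" where
  "Ind_deg sc \<rho> d = icls sc \<rho> ` module.span fscale {u \<otimes> v | u v. u \<in> neg_words d}"

definition singular ::
    "(complex \<Rightarrow> 'v::ab_group_add \<Rightarrow> 'v) \<Rightarrow> (gvec \<Rightarrow> 'v \<Rightarrow> 'v) \<Rightarrow> 'v tfree set \<Rightarrow> bool" where
  "singular sc \<rho> M \<longleftrightarrow> M \<in> Ind sc \<rho> \<and>
     (\<forall>a\<in>gsum {0<..}. ind_act sc \<rho> (iota a) M = icls sc \<rho> 0)"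

definition nontrivial ::
    "(complex \<Rightarrow> 'v::ab_group_add \<Rightarrow> 'v) \<Rightarrow> (gvec \<Rightarrow> 'v \<Rightarrow> 'v) \<Rightarrow> 'v tfree set \<Rightarrow> bool" where
  "nontrivial sc \<rho> M \<longleftrightarrow> M \<noteq> icls sc \<rho> 0 \<and> (\<exists>d>0. M \<in> Ind_deg sc \<rho> d)"

definition highest_weight_singular ::
    "(complex \<Rightarrow> 'v::ab_group_add \<Rightarrow> 'v) \<Rightarrow> (gvec \<Rightarrow> 'v \<Rightarrow> 'v) \<Rightarrow> 'v tfree set \<Rightarrow> bool" where
  "highest_weight_singular sc \<rho> M \<longleftrightarrow> singular sc \<rho> M \<and>
     ind_act sc \<rho> (iota g_e_x) M = icls sc \<rho> 0 \<and> ind_act sc \<rho> (iota g_e_y) M = icls sc \<rho> 0"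

end

theory Submission
  imports Defs
begin

text \<open>
  The generators \<open>\<eta>\<^sub>i\<close> act by left multiplication on the tensor algebra of \<open>\<langle>\<xi>\<^sub>1, \<dots>, \<xi>\<^sub>4\<rangle>\<close>
  with coefficients in \<open>F\<close>; moving elements of \<open>\<gg>\<^sub>\<ge>\<^sub>0\<close> to the right past the generators
  defines operators which represent \<open>\<gg>\<close> modulo the Clifford relations. These relations start in
  degree two, so the vectors \<open>\<eta>\<^sub>i \<otimes> v\<close> are independent in \<open>Ind(F)\<close> without appeal to the
  Poincare-Birkhoff-Witt theorem. A degree one vector killed by \<open>e\<^sub>x\<close> and \<open>e\<^sub>y\<close> is determined by its
  coefficient \<open>A\<close> at \<open>w\<^sub>1\<^sub>1\<close>, with \<open>e\<^sub>x\<^sup>2 A = e\<^sub>y\<^sup>2 A = 0\<close>, and singularity becomes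
  \<open>(\<mu>\<^sub>t - \<mu>\<^sub>C + h\<^sub>x - 2 f\<^sub>x e\<^sub>x) A = 0\<close> and \<open>(\<mu>\<^sub>t + \<mu>\<^sub>C + h\<^sub>y - 2 f\<^sub>y e\<^sub>y) A = 0\<close>. Both operators are
  diagonal on monomials, which leaves two possibilities for \<open>x\<close> and two for \<open>y\<close>.
\<close>

section \<open>The bracket on monomials\<close>

text \<open>That a vector of the quotient \<open>Ind sc \<rho>\<close> is nonzero can be read off
  from a linear map out of it; this is the purpose of \<open>T\<close>. Its values only matter
  modulo \<open>R\<close>, which is stable under all operators \<open>Pi a\<close>, so every
  identity between operators may be proved up to \<open>R\<close>. The check of the supercommutator
  relations strips one generator off a word at a time. The Jacobi identity therefore enters as the
  statement that right bracketing with xi_i is a superderivation; its central component is the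
  cocycle condition for \<open>psi\<close>. The obstacle is signs: the relations of U(\<gg>) concern
  homogeneous elements, while coordinates mix parities. Writing \<open>gpo a\<close> for (-1)^p(a) a
  makes the identities linear in arbitrary arguments, so that monomials suffice. The combinations
  \<mu>t - \<mu>C and \<mu>t + \<mu>C arise because so(4) splits into two copies of sl_2, and in
  matching coordinates of the degree one part of \<gg> each equation involves the operators of one
  copy, with C contributed by the cubic elements through \<open>psi\<close>. The polynomial model of
  F is part of the claim and is built from a highest weight vector, finite dimension and
  irreducibility.\<close>

abbreviation (input) "lookup \<equiv> Poly_Mapping.lookup"
abbreviation (input) "single \<equiv> Poly_Mapping.single"
abbreviation (input) "keys \<equiv> Poly_Mapping.keys"

text \<open>With a whole polynomial in t as coefficient, the bracket of two such elements is again
  one or zero, so bilinear identities need no case distinction on powers of t.\<close>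

definition kp :: "complex poly \<Rightarrow> idx set \<Rightarrow> k14" where
  "kp p S = (\<lambda>T. if T = S then p else 0)"

definition gpo :: "gvec \<Rightarrow> gvec" where
  "gpo a = (parity_op (fst a), snd a)"

lemma kmon_eq_kp: "kmon m S = kp (monom 1 m) S"
  by (simp add: kmon_def kp_def)

lemma xi_eq_kp: "xi i = kp 1 {i}"
  by (simp add: kmon_eq_kp monom_0 one_pCons)

lemma kp_0 [simp]: "kp 0 S = 0"
  by (auto simp: kp_def fun_eq_iff)

lemma kp_add: "kp (p + q) S = kp p S + kp q S"
  by (auto simp: kp_def fun_eq_iff)

lemma kp_minus: "kp (- p) S = - kp p S"
  by (auto simp: kp_def fun_eq_iff)

lemma kp_diff: "kp (p - q) S = kp p S - kp q S"
  by (auto simp: kp_def fun_eq_iff)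

lemma kscale_kp: "kscale c (kp p S) = kp (smult c p) S"
  by (auto simp: kp_def kscale_def fun_eq_iff)

lemma sum_fun_apply: "(\<Sum>i\<in>A. f i) x = (\<Sum>i\<in>A. f i x)"
  by (induction A rule: infinite_finite_induct) auto

lemma k14_decomp: "f = (\<Sum>S\<in>UNIV. kp (f S) S)"
  by (rule ext) (simp add: sum_fun_apply kp_def)

lemma k14_induct [case_names kp add]:
  assumes kp: "\<And>p S. P (kp p S)" and add: "\<And>f g. P f \<Longrightarrow> P g \<Longrightarrow> P (f + g)"
  shows "P f"
proof -
  have "P (\<Sum>S\<in>A. kp (f S) S)" if "finite A" for A
    using that
  proof induction
    case empty
    then show ?case using kp[of 0 "{}"] by (simp add: zero_fun_def)
  next
    case (insert x F)
    then show ?case using add[OF kp[of "f x" x] insert(3)] by (simp only: sum.insert[OF insert(1,2)])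
  qed
  from this[of UNIV] show ?thesis using k14_decomp[of f] by simp
qed

definition sg :: "idx \<Rightarrow> idx \<Rightarrow> complex" where
  "sg i j = (if pos j < pos i then - 1 else 1)"

text \<open>As a product over pairs the sign is visibly multiplicative in each argument; the sign
  computations below rest on this.\<close>

lemma reorder_sign_prod: "reorder_sign A B = (\<Prod>i\<in>A. \<Prod>j\<in>B. sg i j)"
proof -
  have "(\<Prod>i\<in>A. \<Prod>j\<in>B. sg i j) = (\<Prod>x\<in>A\<times>B. if pos (snd x) < pos (fst x) then - 1 else 1)"
    by (simp add: prod.cartesian_product sg_def case_prod_beta)
  also have "\<dots> = (\<Prod>x\<in>{x\<in>A\<times>B. pos (snd x) < pos (fst x)}. - 1)"
    by (subst prod.inter_filter) auto
  also have "{x\<in>A\<times>B. pos (snd x) < pos (fst x)} = {(i, j). i \<in> A \<and> j \<in> B \<and> pos j < pos i}"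
    by auto
  finally show ?thesis by (simp add: reorder_sign_def)
qed

abbreviation rs :: "idx set \<Rightarrow> idx set \<Rightarrow> complex" where "rs \<equiv> reorder_sign"

lemma rs_empty [simp]: "rs {} A = 1" "rs A {} = 1"
  by (simp_all add: reorder_sign_prod)

lemma rs_insert_left: "i \<notin> S \<Longrightarrow> rs (insert i S) T = rs {i} T * rs S T"
  by (simp add: reorder_sign_prod)

lemma rs_insert_right: "i \<notin> T \<Longrightarrow> rs S (insert i T) = rs S {i} * rs S T"
  by (simp add: reorder_sign_prod prod.distrib)

lemma rs_Un_left: "A \<inter> B = {} \<Longrightarrow> rs (A \<union> B) C = rs A C * rs B C"
  by (simp add: reorder_sign_prod prod.union_disjoint)

lemma rs_self [simp]: "rs {i} {i} = 1"
  by (simp add: reorder_sign_prod sg_def)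

lemma pos_inj: "pos i = pos j \<longleftrightarrow> i = j"
  by (cases i; cases j) auto

lemma sg_swap: "i \<noteq> j \<Longrightarrow> sg i j = - sg j i"
  using pos_inj[of i j] by (auto simp: sg_def)

text \<open>Each of the \<open>card S\<close> pairs changes sign on exchange, since \<open>i\<close>
  differs from every member of \<open>S\<close>.\<close>

lemma rs_swap_single: "i \<notin> S \<Longrightarrow> rs {i} S = (-1) ^ card S * rs S {i}"
proof -
  assume "i \<notin> S"
  then have "rs {i} S = (\<Prod>j\<in>S. (-1) * sg j i)"
    unfolding reorder_sign_prod
    by (auto intro!: prod.cong sg_swap)
  also have "\<dots> = (-1) ^ card S * rs S {i}"
    by (simp add: reorder_sign_prod prod_uminus)
  finally show ?thesis .
qed

lemma rs_square [simp]: "rs S T * rs S T = 1"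
  by (simp add: reorder_sign_def flip: power_add)

lemma rs_square' [simp]: "rs S T * (rs S T * x) = x"
  by (metis rs_square mult.assoc mult_1)

lemma d_xi_sign: "(-1) ^ card {j \<in> S. pos j < pos i} = rs {i} S"
proof -
  have "rs {i} S = (\<Prod>j\<in>S. if pos j < pos i then - 1 else 1)"
    by (simp add: reorder_sign_prod sg_def)
  also have "\<dots> = (\<Prod>j\<in>{j \<in> S. pos j < pos i}. - 1)"
    by (subst prod.inter_filter) auto
  finally show ?thesis by simp
qed

lemma kmult_kp: "kmult (kp p S) (kp q T) =
   (if S \<inter> T = {} then kp (smult (rs S T) (p * q)) (S \<union> T) else 0)"
proof (rule ext)
  fix U
  have "kmult (kp p S) (kp q T) U =
     (\<Sum>A\<in>Pow U. if A = S then smult (rs S (U - S)) (p * kp q T (U - S)) else 0)"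
    unfolding kmult_def by (rule sum.cong) (auto simp: kp_def)
  also have "\<dots> = (if S \<subseteq> U then smult (rs S (U - S)) (p * kp q T (U - S)) else 0)"
    by simp
  also have "\<dots> = (if S \<inter> T = {} then kp (smult (rs S T) (p * q)) (S \<union> T) else 0) U"
  proof (cases "S \<subseteq> U \<and> U - S = T")
    case True
    then have "S \<inter> T = {}" "U = S \<union> T" by auto
    then show ?thesis using True by (simp add: kp_def)
  next
    case False
    then show ?thesis by (auto simp: kp_def)
  qed
  finally show "kmult (kp p S) (kp q T) U = \<dots>" .
qed

lemma d_t_kp: "d_t (kp p S) = kp (pderiv p) S"
  by (auto simp: d_t_def kp_def fun_eq_iff)

lemma d_xi_kp: "d_xi i (kp p S) = (if i \<in> S then kp (smult (rs {i} S) p) (S - {i}) else 0)"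
proof (rule ext)
  fix U
  show "d_xi i (kp p S) U = (if i \<in> S then kp (smult (rs {i} S) p) (S - {i}) else 0) U"
  proof (cases "i \<in> U")
    case True
    then show ?thesis by (auto simp: d_xi_def kp_def)
  next
    case False
    then have "rs {i} (insert i U) = rs {i} U" by (simp add: rs_insert_right[of i U])
    with False show ?thesis
      unfolding d_xi_def d_xi_sign by (auto simp: kp_def insert_absorb)
  qed
qed

lemma parity_op_kp: "parity_op (kp p S) = kp (smult ((-1) ^ card S) p) S"
  by (auto simp: parity_op_def kp_def fun_eq_iff)

lemma euler_kp: "euler (kp p S) = kp (smult (of_nat (card S)) p) S"
proof -
  have "kmult (xi i) (d_xi i (kp p S)) = (if i \<in> S then kp p S else 0)" for i
  proof (cases "i \<in> S")
    case True
    then have "insert i (S - {i}) = S" by auto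
    moreover have "rs {i} (S - {i}) = rs {i} S"
      using rs_insert_right[of i "S - {i}" "{i}"] True by (simp add: insert_absorb)
    ultimately show ?thesis using True
      by (simp add: xi_eq_kp d_xi_kp kmult_kp smult_smult)
  next
    case False
    then show ?thesis by (simp add: d_xi_kp kmult_def fun_eq_iff)
  qed
  then have "euler (kp p S) = (\<Sum>i\<in>UNIV. if i \<in> S then kp p S else 0)"
    by (simp add: euler_def)
  also have "\<dots> = (\<Sum>i\<in>S. kp p S)"
    by (simp add: sum.If_cases)
  also have "\<dots> = kp (smult (of_nat (card S)) p) S"
    by (rule ext) (simp add: sum_fun_apply kp_def of_nat_poly)
  finally show ?thesis .
qed

lemma smult_sum_right: "smult c (\<Sum>i\<in>A. p i) = (\<Sum>i\<in>A. smult c (p i))"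
  by (induction A rule: infinite_finite_induct) (auto simp: smult_add_right)

lemma kmult_add_left: "kmult (f + g) h = kmult f h + kmult g h"
  by (rule ext) (simp add: kmult_def distrib_right smult_add_right sum.distrib)

lemma kmult_add_right: "kmult f (g + h) = kmult f g + kmult f h"
  by (rule ext) (simp add: kmult_def distrib_left smult_add_right sum.distrib)

lemma kmult_0 [simp]: "kmult 0 f = 0" "kmult f 0 = 0"
  by (simp_all add: kmult_def fun_eq_iff)

lemma kmult_scale_left: "kmult (kscale c f) g = kscale c (kmult f g)"
  by (rule ext) (simp add: kmult_def kscale_def smult_sum_right mult.commute)

lemma kmult_scale_right: "kmult f (kscale c g) = kscale c (kmult f g)"
  by (rule ext) (simp add: kmult_def kscale_def smult_sum_right mult.commute)

lemma kscale_add: "kscale c (f + g) = kscale c f + kscale c g"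
  by (rule ext) (simp add: kscale_def smult_add_right)

lemma kscale_diff: "kscale c (f - g) = kscale c f - kscale c g"
  by (rule ext) (simp add: kscale_def smult_diff_right)

lemma kscale_sum: "kscale c (\<Sum>i\<in>A. f i) = (\<Sum>i\<in>A. kscale c (f i))"
  by (rule ext) (simp add: kscale_def sum_fun_apply smult_sum_right)

lemma kscale_kscale: "kscale c (kscale d f) = kscale (c * d) f"
  by (rule ext) (simp add: kscale_def)

lemma d_t_linear: "d_t (f + g) = d_t f + d_t g" "d_t (kscale c f) = kscale c (d_t f)"
  by (simp_all add: d_t_def kscale_def fun_eq_iff pderiv_add pderiv_smult)

lemma d_xi_linear: "d_xi i (f + g) = d_xi i f + d_xi i g" "d_xi i (kscale c f) = kscale c (d_xi i f)"
  by (simp_all add: d_xi_def kscale_def fun_eq_iff smult_add_right mult.commute)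

lemma parity_op_linear: "parity_op (f + g) = parity_op f + parity_op g"
    "parity_op (kscale c f) = kscale c (parity_op f)"
  by (simp_all add: parity_op_def kscale_def fun_eq_iff smult_add_right mult.commute)

lemma euler_linear: "euler (f + g) = euler f + euler g" "euler (kscale c f) = kscale c (euler f)"
  by (simp_all add: euler_def d_xi_linear kmult_add_right sum.distrib kmult_scale_right kscale_sum)

lemma kbr_add_left: "kbr (f + g) h = kbr f h + kbr g h"
proof -
  have "kscale 2 (f + g) - euler (f + g) = (kscale 2 f - euler f) + (kscale 2 g - euler g)"
    by (simp only: kscale_add euler_linear add_diff_add)
  then show ?thesis
    unfolding kbr_def
    by (simp only: kmult_add_left kmult_add_right d_t_linear d_xi_linear parity_op_linear
        sum.distrib add_diff_add ac_simps)
qed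

lemma kbr_add_right: "kbr h (f + g) = kbr h f + kbr h g"
proof -
  have "kscale 2 (f + g) - euler (f + g) = (kscale 2 f - euler f) + (kscale 2 g - euler g)"
    by (simp only: kscale_add euler_linear add_diff_add)
  then show ?thesis
    unfolding kbr_def
    by (simp only: kmult_add_left kmult_add_right d_t_linear d_xi_linear parity_op_linear
        sum.distrib add_diff_add ac_simps)
qed

lemma kbr_0 [simp]: "kbr 0 h = 0" "kbr h 0 = 0"
  using kbr_add_left[of 0 0 h] kbr_add_right[of h 0 0] by simp_all

lemma kbr_scale_left: "kbr (kscale c f) h = kscale c (kbr f h)"
proof -
  have "kscale 2 (kscale c f) - euler (kscale c f) = kscale c (kscale 2 f - euler f)"
    by (simp add: kscale_kscale euler_linear kscale_diff mult.commute)
  then show ?thesis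
    unfolding kbr_def
    by (simp only: kmult_scale_left kmult_scale_right d_t_linear
      d_xi_linear parity_op_linear
      flip: kscale_diff kscale_sum kscale_add)
qed

lemma kbr_scale_right: "kbr h (kscale c f) = kscale c (kbr h f)"
proof -
  have "kscale 2 (kscale c f) - euler (kscale c f) = kscale c (kscale 2 f - euler f)"
    by (simp add: kscale_kscale euler_linear kscale_diff mult.commute)
  then show ?thesis
    unfolding kbr_def
    by (simp only: kmult_scale_left kmult_scale_right d_t_linear
      d_xi_linear parity_op_linear
      flip: kscale_diff kscale_sum kscale_add)
qed

text \<open>After \<open>i\<close> has been removed from both factors, their product is nonzero only
  if nothing else is shared, so at most one summand survives. Its sign combines
  \<open>(-1) ^ card S\<close> with the transport of xi_i through the rest of
  \<open>S\<close>.\<close>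

lemma kbr_sum_kp:
  "(\<Sum>i\<in>UNIV. kmult (d_xi i (parity_op (kp p S))) (d_xi i (kp q T))) =
   (\<Sum>i\<in>UNIV. if S \<inter> T = {i} then kp (- smult (rs S T) (p * q)) ((S - {i}) \<union> (T - {i})) else 0)"
proof (rule sum.cong)
  fix i
  show "kmult (d_xi i (parity_op (kp p S))) (d_xi i (kp q T)) =
    (if S \<inter> T = {i} then kp (- smult (rs S T) (p * q)) ((S - {i}) \<union> (T - {i})) else 0)"
  proof (cases "i \<in> S \<and> i \<in> T")
    case True
    define S0 T0 where "S0 = S - {i}" and "T0 = T - {i}"
    have S: "S = insert i S0" "i \<notin> S0" and T: "T = insert i T0" "i \<notin> T0"
      using True by (auto simp: S0_def T0_def)
    have eq: "S \<inter> T = {i} \<longleftrightarrow> S0 \<inter> T0 = {}" using S T by auto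
    have 1: "rs {i} S = (-1) ^ card S0 * rs S0 {i}" "rs {i} T = rs {i} T0"
      using S T
      by (simp_all add: rs_insert_right[of i S0] rs_insert_right[of i T0] rs_swap_single[of i S0])
    have 2: "(-1) ^ card S = - ((-1) ^ card S0 :: complex)" using S by simp
    have 3: "rs S T = rs {i} T0 * (rs S0 {i} * rs S0 T0)"
      using S T
      by (simp add: rs_insert_left[of i S0] rs_insert_right[of i T0] mult_ac)
    have 4: "(-1) ^ card S0 * ((-1) ^ card S0 * x) = (x::complex)" for x
      by (simp flip: mult.assoc power_add)
    show ?thesis using True
      unfolding parity_op_kp d_xi_kp kmult_kp eq S0_def[symmetric] T0_def[symmetric]
      by (simp add: 1 2 3 4 kmult_kp mult_ac)
  next
    case False
    then show ?thesis by (auto simp: parity_op_kp d_xi_kp)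
  qed
qed simp

text \<open>Three cases exhaust the bracket of two monomials: without a common index only the terms
  with a t-derivative survive, with exactly one only the term with odd derivatives, with two or more
  nothing.\<close>

lemma kbr_kp_disjoint:
  assumes "S \<inter> T = {}"
  shows "kbr (kp p S) (kp q T) = kp (smult (rs S T)
     (smult (2 - of_nat (card S)) (p * pderiv q) - smult (2 - of_nat (card T)) (pderiv p * q))) (S \<union> T)"
  unfolding kbr_def kbr_sum_kp using assms
  by (simp add: euler_kp d_t_kp kmult_kp kscale_kp smult_diff_right mult.commute
      flip: kp_diff smult_diff_left)

lemma kbr_kp_single:
  assumes "S \<inter> T = {i}"
  shows "kbr (kp p S) (kp q T) = kp (- smult (rs S T) (p * q)) ((S - {i}) \<union> (T - {i}))"
  unfolding kbr_def kbr_sum_kp using assms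
  by (simp add: euler_kp d_t_kp kmult_kp kscale_kp flip: kp_diff smult_diff_left)

lemma kbr_kp_zero:
  assumes "i \<in> S" "i \<in> T" "j \<in> S" "j \<in> T" "i \<noteq> j"
  shows "kbr (kp p S) (kp q T) = 0"
proof -
  have "S \<inter> T \<noteq> {}" "S \<inter> T \<noteq> {k}" for k
    using assms by (metis IntI empty_iff, metis IntI singletonD)
  then show ?thesis
  unfolding kbr_def kbr_sum_kp
  by (simp add: euler_kp d_t_kp kmult_kp kscale_kp flip: kp_diff smult_diff_left)
qed

lemma co_kp: "co U (kp p S) = (if U = S then coeff p 0 else 0)"
  by (simp add: co_def kp_def)

lemma co_linear: "co U (f + g) = co U f + co U g" "co U (kscale c f) = c * co U f" "co U 0 = 0"
  by (simp_all add: co_def kscale_def)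

lemma UNIV_idx: "(UNIV :: idx set) = {I1, I2, I3, I4}"
  using idx.exhaust by auto

lemma xi_top_eq: "xi_top = kp 1 UNIV"
  by (simp add: xi_eq_kp kmult_kp reorder_sign_prod sg_def UNIV_idx insert_commute
      flip: one_pCons)

lemma cod_eq: "cod i f = rs {i} (- {i}) * co (- {i}) f"
proof -
  have "UNIV = insert i (- {i})" by auto
  then have "rs {i} UNIV = rs {i} {i} * rs {i} (- {i})"
    by (metis ComplD rs_insert_right singletonI)
  then have "co (- {i}) (d_xi i xi_top) = rs {i} (- {i})"
    by (simp add: xi_top_eq d_xi_kp co_kp Compl_eq_Diff_UNIV)
  then show ?thesis by (simp add: cod_def)
qed

lemma psi_linear:
  "psi (f + g) h = psi f h + psi g h" "psi h (f + g) = psi h f + psi h g"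
  "psi (kscale c f) h = c * psi f h" "psi h (kscale c f) = c * psi h f"
  "psi 0 h = 0" "psi h 0 = 0"
  by (simp_all add: psi_def cod_eq co_linear algebra_simps sum.distrib sum_distrib_left)

lemma card_Compl_idx: "card (- S) + card (S :: idx set) = 4"
proof -
  have "card (- S \<union> S) = card (- S) + card S" by (rule card_Un_disjoint) auto
  then show ?thesis by (simp add: Compl_partition2 UNIV_idx)
qed

lemma card_idx_cases:
  obtains "S = {}" | i where "S = {i}" | "card (S :: idx set) = 2" | i where "S = - {i}" | "S = UNIV"
proof -
  have c: "card (- S) + card S = 4" by (rule card_Compl_idx)
  then consider "card S = 0" | "card S = 1" | "card S = 2" | "card (- S) = 1" | "card (- S) = 0"
    by linarith
  then show ?thesis
  proof cases
    case 2
    then show ?thesis using that(2) by (metis card_1_singletonE)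
  next
    case 4
    then show ?thesis using that(4) by (metis card_1_singletonE double_complement)
  qed (use that in \<open>auto elim: card_1_singletonE simp: Compl_empty_eq\<close>)
qed

text \<open>The prescribed values -2 and -1 and those forced by skew-symmetry all fit the factor
  \<open>card S - 2\<close>, while \<open>rs S T\<close> absorbs the sign of the odd derivative of
  xi_1234. The factor vanishes on pairs, so brackets within so(4) have no central term.\<close>

lemma psi_kp:
  "psi (kp p S) (kp q T) =
    (if T = - S then (of_nat (card S) - 2) * rs S T * coeff p 0 * coeff q 0 else 0)"
proof -
  have c3: "card (- {i}) = 3" for i :: idx using card_Compl_idx[of "{i}"] by simp
  have c4: "card (UNIV :: idx set) = 4" using card_Compl_idx[of UNIV] by simp
  have U: "(- {i} :: idx set) \<noteq> {}" "(- {i} :: idx set) \<noteq> UNIV" "(- {i} :: idx set) \<noteq> {j}"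
    "{i} \<noteq> (UNIV :: idx set)" for i j
    by (rule notI, drule arg_cong[of _ _ card], simp add: c3 c4)+
  note U' = U[symmetric]
  show ?thesis
  proof (cases S rule: card_idx_cases)
    case 1
    then show ?thesis by (auto simp: psi_def cod_eq co_kp U U')
  next
    case (2 i)
    have "co {j} (kp p S) * cod j (kp q T) + cod j (kp p S) * co {j} (kp q T)
        = (if j = i then coeff p 0 * cod i (kp q T) else 0)" for j
      using 2 by (simp add: cod_eq co_kp U U')
    then show ?thesis using 2 by (auto simp: psi_def co_kp U U' cod_eq)
  next
    case 3
    have ns: "S \<noteq> {}" "S \<noteq> UNIV" "S \<noteq> {i}" "S \<noteq> - {i}" for i
      by (rule notI, use 3 c3[of i] c4 in simp)+
    then show ?thesis using 3 by (simp add: psi_def cod_eq co_kp ns ns[symmetric])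
  next
    case (4 i)
    then have "rs {i} (- {i}) = - rs (- {i}) {i}"
      using rs_swap_single[of i "- {i}"] c3[of i] by simp
    moreover have "co {j} (kp p S) * cod j (kp q T) + cod j (kp p S) * co {j} (kp q T)
        = (if j = i then rs {i} (- {i}) * coeff p 0 * co {i} (kp q T) else 0)" for j
      using 4 by (simp add: cod_eq co_kp U U')
    ultimately show ?thesis using 4 c3[of i] by (auto simp: psi_def co_kp U U')
  next
    case 5
    then show ?thesis by (auto simp: psi_def cod_eq co_kp U U' c4)
  qed
qed

text \<open>No numerical coefficient occurs: \<open>2 - card {i} = 1\<close>, and the coefficient of
  xi_i is constant in t.\<close>

lemma kbr_kp_xi:
  "kbr (kp p S) (xi i) = (if i \<in> S then kp (- smult (rs S {i}) p) (S - {i})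
     else kp (- smult (rs S {i}) (pderiv p)) (insert i S))"
  by (cases "i \<in> S")
    (simp_all add: xi_eq_kp kbr_kp_single[of _ _ i] kbr_kp_disjoint)

section \<open>Bracketing with a generator\<close>

text \<open>Comparing coefficients turns leftover identities between scaled polynomials into complex
  arithmetic.\<close>

lemma kp_eqI: "(\<And>n. coeff p n = coeff q n) \<Longrightarrow> kp p S = kp q S"
  by (metis poly_eqI)

text \<open>Bracketing with xi_i only inserts or removes \<open>i\<close>, so the identity is
  checked over the parts \<open>S0\<close>, \<open>T0\<close> of the index sets without
  \<open>i\<close>, with four positions of \<open>i\<close> each time. If \<open>S0\<close> and
  \<open>T0\<close> share two indices, every term is zero.\<close>

lemma kbr_right_derivation_kp:
  "kbr (kbr (kp p S) (kp q T)) (xi i) =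
     kbr (kp p S) (kbr (kp q T) (xi i)) + kbr (kbr (kp p S) (xi i)) (parity_op (kp q T))" (is "?P S T")
proof -
  define S0 T0 where "S0 = S - {i}" and "T0 = T - {i}"
  have S0: "i \<notin> S0" and T0: "i \<notin> T0" by (auto simp: S0_def T0_def)
  have S: "S = S0 \<or> S = insert i S0" and T: "T = T0 \<or> T = insert i T0"
    by (auto simp: S0_def T0_def)
  have r: "rs {i} U = (-1) ^ card U * rs U {i}" if "i \<notin> U" for U
    by (rule rs_swap_single[OF that])
  note rules = rs_insert_left[OF S0] rs_insert_right[OF T0] rs_insert_left[OF T0] r[OF S0] r[OF T0]
  have Sets: "S0 - {i} = S0" "T0 - {i} = T0" using S0 T0 by auto
  have m1: "(-1) ^ n * ((-1) ^ n * x) = (x::complex)" for n x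
    by (simp flip: mult.assoc power_add)
  note pd = pderiv_mult pderiv_smult pderiv_diff pderiv_minus smult_diff_right smult_add_right algebra_simps
  have cs: "S0 \<inter> T0 = {} \<or> (\<exists>j. S0 \<inter> T0 = {j}) \<or>
    (\<exists>j k. j \<in> S0 \<and> k \<in> S0 \<and> j \<in> T0 \<and> k \<in> T0 \<and> j \<noteq> k)"
    by (metis Int_iff insertI1 is_singletonI' is_singleton_the_elem)
  consider (dis) "S0 \<inter> T0 = {}" | (sing) j where "S0 \<inter> T0 = {j}"
    | (two) j k where "j \<in> S0" "k \<in> S0" "j \<in> T0" "k \<in> T0" "j \<noteq> k"
    using cs by blast
  then show ?thesis
  proof cases
    case two
    then have "j \<in> S" "k \<in> S" "j \<in> T" "k \<in> T" "j \<noteq> i" "k \<noteq> i" by (auto simp: S0_def T0_def)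
    then show ?thesis using two(5)
      by (simp add: kbr_kp_xi kbr_kp_zero[of j _ _ k] parity_op_kp)
  next
    case dis
    then have r1: "rs (S0 \<union> T0) U = rs S0 U * rs T0 U" for U by (rule rs_Un_left)
    have r2: "rs (insert i (S0 \<union> T0)) U = rs {i} U * (rs S0 U * rs T0 U)" for U
      using S0 T0 by (simp add: rs_insert_left[of i "S0 \<union> T0"] r1)
    note D = dis dis[unfolded Int_commute[of S0]] S0 T0
    have s: "insert i S0 \<inter> T0 = {}" "S0 \<inter> insert i T0 = {}" "insert i S0 \<inter> insert i T0 = {i}"
      using D by auto
    have c: "card (S0 \<union> T0) = card S0 + card T0" using dis by (simp add: card_Un_disjoint)
    have *: "?P S0 T0" "?P (insert i S0) T0" "?P S0 (insert i T0)" "?P (insert i S0) (insert i T0)"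
      by (simp add: kbr_kp_disjoint kbr_kp_single[OF s(3)] kbr_kp_xi parity_op_kp D s c rules r1 r2 pd Sets m1 flip: kp_add,
            (intro kp_eqI, simp only: coeff_add coeff_diff coeff_minus coeff_smult, simp add: algebra_simps)?)+
    show ?thesis using * S T by auto
  next
    case sing
    then have j: "j \<in> S0" "j \<in> T0" "j \<noteq> i" using S0 by auto
    define S1 T1 where "S1 = S0 - {j}" and "T1 = T0 - {j}"
    have ST: "S0 = insert j S1" "T0 = insert j T1" "j \<notin> S1" "j \<notin> T1" "i \<notin> S1" "i \<notin> T1"
      using j S0 T0 by (auto simp: S1_def T1_def)
    have d: "S1 \<inter> T1 = {}" using sing ST by auto
    then have r1: "rs (S1 \<union> T1) U = rs S1 U * rs T1 U" for U by (rule rs_Un_left)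
    have r2: "rs (insert i (S1 \<union> T1)) U = rs {i} U * (rs S1 U * rs T1 U)" for U
      using ST by (simp add: rs_insert_left[of i "S1 \<union> T1"] r1)
    have D: "S0 \<inter> T0 = {j}" "insert i S0 \<inter> T0 = {j}" "S0 \<inter> insert i T0 = {j}"
      "S0 - {j} = S1" "T0 - {j} = T1" "insert i S0 - {j} = insert i S1" "insert i T0 - {j} = insert i T1"
      using sing j S0 T0 ST by auto
    have Z: "kbr (kp a (insert i S0)) (kp b (insert i T0)) = 0" for a b
      using j by (intro kbr_kp_zero[of i _ _ j]) auto
    have rr: "rs S0 U = rs {j} U * rs S1 U" "rs U T0 = rs U {j} * rs U T1"
       "rs T0 U = rs {j} U * rs T1 U" for U
      using ST by (simp_all add: rs_insert_left[of j S1] rs_insert_left[of j T1] rs_insert_right[of j T1])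
    have c: "card S0 = Suc (card S1)" "card T0 = Suc (card T1)" "card (S1 \<union> T1) = card S1 + card T1"
      using d ST by (simp_all add: card_Un_disjoint)
    have ri: "rs {i} S1 = (-1) ^ card S1 * rs S1 {i}" "rs {i} T1 = (-1) ^ card T1 * rs T1 {i}"
      using ST by (auto intro: r)
    have ij: "rs {i} {j} = - rs {j} {i}" using r[of "{j}"] j by simp
    note R = rules(1,2,3) r1 r2 rr c ri ij kbr_0[unfolded zero_fun_def]
    note K = kbr_kp_single[OF D(1)] kbr_kp_single[OF D(2)] kbr_kp_single[OF D(3)]
    have *: "?P S0 T0" "?P (insert i S0) T0" "?P S0 (insert i T0)" "?P (insert i S0) (insert i T0)"
      by (simp add: K Z kbr_kp_xi parity_op_kp S0 T0 ST(3-6) D(4-7) R pd Sets m1 flip: kp_add,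
            (intro kp_eqI, simp only: coeff_add coeff_diff coeff_minus coeff_smult, simp add: algebra_simps)?)+
    show ?thesis using * S T by auto
  qed
qed

text \<open>A nonzero value of \<open>psi\<close> needs complementary index sets. If some index
  other than \<open>i\<close> is missing from both sets or lies in both, all terms vanish; otherwise
  \<open>S0\<close> and \<open>T0\<close> partition the complement of \<open>i\<close>, and the
  coefficients are compared directly.\<close>

lemma psi_right_derivation_kp:
  "psi (kbr (kp p S) (kp q T)) (xi i) =
     psi (kp p S) (kbr (kp q T) (xi i)) + psi (kbr (kp p S) (xi i)) (parity_op (kp q T))" (is "?P S T")
proof -
  define S0 T0 where "S0 = S - {i}" and "T0 = T - {i}"
  have S0: "i \<notin> S0" and T0: "i \<notin> T0" by (auto simp: S0_def T0_def)
  have S: "S = S0 \<or> S = insert i S0" and T: "T = T0 \<or> T = insert i T0"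
    by (auto simp: S0_def T0_def)
  have r: "rs {i} U = (-1) ^ card U * rs U {i}" if "i \<notin> U" for U
    by (rule rs_swap_single[OF that])
  note rules = rs_insert_left[OF S0] rs_insert_right[OF T0] rs_insert_left[OF T0] r[OF S0] r[OF T0]
  have m1: "(-1) ^ n * ((-1) ^ n * x) = (x::complex)" for n x
    by (simp flip: mult.assoc power_add)
  have Sets: "S0 - {i} = S0" "T0 - {i} = T0" using S0 T0 by auto
  \<comment> \<open>The index \<open>j\<close> is absent from the bracket, either from the start or
    because it cancelled, so the complement of the resulting index set is not
    \<open>{i}\<close>.\<close>
  have K: "psi (kbr (kp a A) (kp b B)) (xi i) = 0"
    if "j \<noteq> i" "j \<notin> A \<union> B \<or> j \<in> A \<and> j \<in> B" for a b A B j
  proof -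
    consider "A \<inter> B = {}" | k where "A \<inter> B = {k}"
      | j k where "j \<in> A" "k \<in> A" "j \<in> B" "k \<in> B" "j \<noteq> k"
      by (metis Int_iff insertI1 is_singletonI' is_singleton_the_elem)
    then show ?thesis
    proof cases
      case 1
      then have "- (A \<union> B) \<noteq> {i}" using that by auto
      then show ?thesis using 1 by (auto simp: kbr_kp_disjoint xi_eq_kp psi_kp)
    next
      case (2 k)
      then have "- ((A - {k}) \<union> (B - {k})) \<noteq> {i}" using that by auto
      then show ?thesis using 2 by (auto simp: kbr_kp_single xi_eq_kp psi_kp)
    next
      case 3
      then show ?thesis by (simp add: kbr_kp_zero psi_linear)
    qed
  qed
  consider j where "j \<noteq> i" "j \<notin> S \<union> T \<or> j \<in> S \<and> j \<in> T" | "T0 = - {i} - S0"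
    by (auto simp: S0_def T0_def)
  then show ?thesis
  proof cases
    case j: (1 j)
    then have "T - {i} \<noteq> - S" "insert i T \<noteq> - S" "T \<noteq> - (S - {i})" "T \<noteq> - insert i S"
      by auto
    then show ?thesis using K[OF j] by (simp add: kbr_kp_xi psi_kp parity_op_kp)
  next
    case T0_eq: 2
    then have dis: "S0 \<inter> T0 = {}" "insert i S0 \<inter> T0 = {}" "S0 \<inter> insert i T0 = {}"
      "insert i S0 \<inter> insert i T0 = {i}" using S0 by auto
    \<comment> \<open>This relation reconciles the factors \<open>card - 2\<close> that
      \<open>psi_kp\<close> attaches to the terms with the factors \<open>2 - card\<close> of the
      bracket.\<close>
    have "card S0 + card T0 = 3"
    proof -
      have "card (S0 \<union> T0) = card S0 + card T0" using dis by (simp add: card_Un_disjoint)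
      moreover have "S0 \<union> T0 = - {i}" using T0_eq S0 by auto
      ultimately show ?thesis using card_Compl_idx[of "{i}"] by simp
    qed
    moreover from this have c3: "card (S0 \<union> T0) = 3"
      using dis by (simp add: card_Un_disjoint)
    ultimately have c: "of_nat (card T0) = (3 - of_nat (card S0) :: complex)"
      by (metis add_diff_cancel_left' of_nat_add of_nat_numeral)
    have e: "({i} = - S0 \<inter> - T0) = True" "({i} = - (S0 \<union> T0)) = True" "(T0 = - insert i S0) = True" "(insert i T0 = - S0) = True"
      "(T0 = - S0) = False" "(insert i T0 = - insert i S0) = False"
      "({i} = - insert i (S0 \<union> T0)) = False"
      using T0_eq S0 by auto
    have r1: "rs (S0 \<union> T0) U = rs S0 U * rs T0 U" for U by (rule rs_Un_left[OF dis(1)])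
    note rls = kbr_kp_disjoint[OF dis(1)] kbr_kp_disjoint[OF dis(2)] kbr_kp_disjoint[OF dis(3)]
       kbr_kp_single[OF dis(4)] kbr_kp_xi parity_op_kp S0 T0 Sets rules r1 m1
    have *: "?P S0 T0" "?P (insert i S0) T0" "?P S0 (insert i T0)" "?P (insert i S0) (insert i T0)"
      by ((simp add: rls, (simp add: xi_eq_kp psi_kp c c3 e S0 T0 rules m1 r1 algebra_simps
            coeff_pderiv coeff_mult_0 del: Compl_Un)?)+)
    show ?thesis using * S T by auto
  qed
qed

section \<open>The bracket of \<gg> and its parity automorphism\<close>

abbreviation xg :: "idx \<Rightarrow> gvec" where "xg i \<equiv> emb (xi i)"

text \<open>The unit of the Grassmann algebra, which spans the component of degree -2; by
  \<open>gbr_xi_xi\<close> it is minus the bracket of each xi_i with itself.\<close>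

definition theta :: gvec where "theta = emb (kp 1 {})"

lemma gbr_add_left: "gbr (a + b) c = gbr a c + gbr b c"
  by (simp add: gbr_def kbr_add_left psi_linear)

lemma gbr_add_right: "gbr c (a + b) = gbr c a + gbr c b"
  by (simp add: gbr_def kbr_add_right psi_linear)

lemma gbr_0 [simp]: "gbr 0 a = 0" "gbr a 0 = 0"
  using gbr_add_left[of 0 0 a] gbr_add_right[of a 0 0] by simp_all

lemma gbr_minus: "gbr (- a) b = - gbr a b" "gbr a (- b) = - gbr a b"
  using gbr_add_left[of a "- a" b] gbr_add_right[of a b "- b"]
  by (simp_all add: eq_neg_iff_add_eq_0 add.commute)

lemma gbr_scale_left: "gbr (gscale k a) b = gscale k (gbr a b)"
  by (simp add: gbr_def gscale_def kbr_scale_left psi_linear)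

lemma gbr_scale_right: "gbr b (gscale k a) = gscale k (gbr b a)"
  by (simp add: gbr_def gscale_def kbr_scale_right psi_linear)

lemma gpo_add: "gpo (a + b) = gpo a + gpo b"
  by (simp add: gpo_def parity_op_linear)

lemma gpo_scale: "gpo (gscale k a) = gscale k (gpo a)"
  by (simp add: gpo_def gscale_def parity_op_linear)

lemma m1_cancel: "(-1) ^ n * ((-1) ^ n * x) = (x::complex)"
  by (simp flip: mult.assoc power_add)

lemma gpo_gpo [simp]: "gpo (gpo a) = a"
  by (cases a) (simp add: gpo_def parity_op_def smult_smult flip: power_add)

lemma gpar_gpo: "b \<in> gpar q \<Longrightarrow> gpo b = gscale ((-1) ^ q) b"
proof -
  assume b: "b \<in> gpar q"
  have "smult ((-1) ^ card S) (fst b S) = smult ((-1) ^ q) (fst b S)" for S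
  proof (cases "fst b S = 0")
    case False
    then have "card S mod 2 = q" using b by (simp add: gpar_def)
    then have "even (card S) \<longleftrightarrow> even q" by (auto simp: even_iff_mod_2_eq_zero)
    then show ?thesis by (metis minus_one_power_iff)
  qed simp
  moreover have "snd b \<noteq> 0 \<Longrightarrow> q = 0" using b by (simp add: gpar_def)
  ultimately show ?thesis
    by (cases "snd b = 0") (auto simp: gpo_def gscale_def parity_op_def kscale_def prod_eq_iff)
qed

text \<open>Since \<open>gpo\<close> replaces the sign, both sides are additive in \<open>a\<close>
  and in \<open>b\<close>, and the two monomial identities for \<open>kbr\<close> and
  \<open>psi\<close> combine without any homogeneity assumption.\<close>

lemma gbr_right_derivation:
  "gbr (gbr a b) (xg i) = gbr a (gbr b (xg i)) + gbr (gbr a (xg i)) (gpo b)"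
proof -
  have "kbr (kbr f g) (xi i) = kbr f (kbr g (xi i)) + kbr (kbr f (xi i)) (parity_op g) \<and>
    psi (kbr f g) (xi i) = psi f (kbr g (xi i)) + psi (kbr f (xi i)) (parity_op g)" for f g
  proof (induction f rule: k14_induct)
    case (kp p S)
    show ?case
    proof (induction g rule: k14_induct)
      case (add f g)
      then show ?case
        by (simp only: kbr_add_left kbr_add_right psi_linear parity_op_linear ac_simps)
    qed (simp only: kbr_right_derivation_kp psi_right_derivation_kp)
  next
    case (add f g)
    then show ?case by (simp only: kbr_add_left psi_linear ac_simps)
  qed
  then show ?thesis by (simp add: gbr_def gpo_def)
qed

text \<open>Super skew-symmetry against a generator, with the sign carried by \<open>gpo\<close>;
  \<open>defect_reduce\<close> uses it to exchange a first argument xi_i with the second.\<close>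

lemma gbr_xi_left: "gbr (xg i) b = - gbr (gpo b) (xg i)"
proof -
  have "kbr (xi i) f = - kbr (parity_op f) (xi i) \<and> psi (xi i) f = - psi (parity_op f) (xi i)" for f
  proof (induction f rule: k14_induct)
    case (kp p S)
    show ?case
    proof (cases "i \<in> S")
      case True
      define S0 where "S0 = S - {i}"
      then have S: "S = insert i S0" "i \<notin> S0" using True by auto
      then have r: "rs (insert i S0) {i} = rs S0 {i}" "rs {i} (insert i S0) = (-1) ^ card S0 * rs S0 {i}"
        by (simp_all add: rs_insert_left[of i S0] rs_insert_right[of i S0] rs_swap_single)
      have "{i} \<inter> insert i S0 = {i}" "insert i S0 - {i} = S0" "insert i S0 \<noteq> - {i}" "{i} \<noteq> - insert i S0"
        using S by auto
      then show ?thesis unfolding S(1) using S(2)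
        by (simp add: kbr_kp_xi parity_op_kp kbr_kp_single[of "{i}" _ i] r m1_cancel flip: kp_minus)
          (simp add: xi_eq_kp psi_kp kbr_kp_single[of "{i}" _ i] r m1_cancel mult.commute flip: kp_minus)
    next
      case False
      have c: "card S = 3" if "S = - {i}" using card_Compl_idx[of "{i}"] that by simp
      have "kbr (xi i) (kp p S) = - kbr (parity_op (kp p S)) (xi i)"
        using False
        by (simp add: kbr_kp_xi parity_op_kp) 
          (simp add: xi_eq_kp kbr_kp_disjoint m1_cancel rs_swap_single pderiv_smult mult.commute
              flip: kp_minus)
      moreover have "psi (xi i) (kp p S) = - psi (parity_op (kp p S)) (xi i)"
        using False c by (auto simp: parity_op_kp xi_eq_kp psi_kp m1_cancel rs_swap_single)
      ultimately show ?thesis by simp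
    qed
  next
    case (add f g)
    then show ?case
      by (simp only: kbr_add_left kbr_add_right psi_linear parity_op_linear minus_add_distrib)
  qed
  then show ?thesis by (simp add: gbr_def gpo_def)
qed

lemma gbr_theta_left: "gbr theta b = - gbr b theta"
proof -
  have "kbr (kp 1 {}) f = - kbr f (kp 1 {}) \<and> psi (kp 1 {}) f = - psi f (kp 1 {})" for f
  proof (induction f rule: k14_induct)
    case (kp p S)
    have "card (UNIV :: idx set) = 4" using card_Compl_idx[of UNIV] by simp
    then show ?case
      by (auto simp: kbr_kp_disjoint psi_kp simp flip: kp_minus)
  next
    case (add f g)
    then show ?case by (simp only: kbr_add_left kbr_add_right psi_linear minus_add_distrib)
  qed
  then show ?thesis by (simp add: gbr_def theta_def)
qed

lemma gbr_xi_xi: "gbr (xg i) (xg j) = (if i = j then - theta else 0)"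
proof -
  have "card (- {i}) = 3" using card_Compl_idx[of "{i}"] by simp
  then have "{j} \<noteq> - {i}"
    by (intro notI, drule_tac arg_cong[of _ _ card], simp)
  then have "psi (xi i) (xi j) = 0" by (simp add: xi_eq_kp psi_kp)
  moreover have "kbr (xi i) (xi j) = (if i = j then - kp 1 {} else 0)"
    using kbr_kp_xi[of 1 "{i}" j] unfolding xi_eq_kp[of i]
    by (simp add: one_pCons flip: kp_minus)
  ultimately show ?thesis
    by (simp add: gbr_def theta_def prod_eq_iff)
qed

text \<open>The derivation rule with second argument xi_j: right brackets satisfy relations parallel
  to those of the generators, which is why \<open>Pi\<close> preserves the Clifford
  relations.\<close>

lemma gbr_gbr_xi_xi:
  "gbr (gbr a (xg i)) (xg j) + gbr (gbr a (xg j)) (xg i) = (if i = j then - gbr a theta else 0)"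
proof -
  have g: "gpo (xg j) = - xg j" by (simp add: gpo_def xi_eq_kp parity_op_kp one_pCons flip: kp_minus)
  show ?thesis
    using gbr_right_derivation[of a "xg j" i]
    by (simp only: g gbr_minus gbr_xi_xi) (auto simp: gbr_minus)
qed

section \<open>Projections onto the nonnegative part and the zero part of the grading\<close>

definition pplus :: "gvec \<Rightarrow> gvec" where
  "pplus a = ((\<lambda>S. if card S \<le> 1 then fst a S - [:coeff (fst a S) 0:] else fst a S), snd a)"

text \<open>With r indices and t^m the degree is 2m + r - 2: it is zero only for r = 2, m = 0 and r
  = 0, m = 1. It is negative only for m = 0 and r \<le> 1, the coefficients that
  \<open>pplus\<close> deletes.\<close>

definition pzero :: "gvec \<Rightarrow> gvec" where
  "pzero a = ((\<lambda>S. if card S = 2 then [:coeff (fst a S) 0:]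
     else if S = {} then monom (coeff (fst a S) 1) 1 else 0), snd a)"

lemma pplus_add: "pplus (a + b) = pplus a + pplus b"
  by (auto simp: pplus_def fun_eq_iff prod_eq_iff)

lemma pplus_scale: "pplus (gscale c a) = gscale c (pplus a)"
  by (auto simp: pplus_def gscale_def kscale_def fun_eq_iff prod_eq_iff smult_diff_right)

lemma pzero_add: "pzero (a + b) = pzero a + pzero b"
  by (auto simp: pzero_def fun_eq_iff prod_eq_iff add_monom)

lemma pzero_scale: "pzero (gscale c a) = gscale c (pzero a)"
  by (auto simp: pzero_def gscale_def kscale_def fun_eq_iff prod_eq_iff smult_monom)

lemma gpo_pplus: "gpo (pplus a) = pplus (gpo a)"
  by (auto simp: pplus_def gpo_def parity_op_def fun_eq_iff smult_diff_right)

lemma pzero_gpo: "pzero (gpo a) = pzero a"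
  by (auto simp: pzero_def gpo_def parity_op_def fun_eq_iff)

lemma pplus_pplus [simp]: "pplus (pplus a) = pplus a"
  by (auto simp: pplus_def)

lemma pzero_pplus [simp]: "pzero (pplus a) = pzero a"
  by (auto simp: pzero_def pplus_def fun_eq_iff)

lemma pplus_decomp:
  "a = pplus a + gscale (co {} (fst a)) theta + (\<Sum>i\<in>UNIV. gscale (co {i} (fst a)) (xg i))"
proof -
  have fs: "fst (\<Sum>i\<in>A. h i) = (\<Sum>i\<in>A. fst (h i))" "snd (\<Sum>i\<in>A. h i) = (\<Sum>i\<in>A. snd (h i))"
    for h :: "idx \<Rightarrow> gvec" and A
    by (induction A rule: infinite_finite_induct) auto
  have "fst a S = (if card S \<le> 1 then fst a S - [:coeff (fst a S) 0:] else fst a S)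
     + smult (co {} (fst a)) (kp 1 {} S) + (\<Sum>i\<in>UNIV. smult (co {i} (fst a)) (kp 1 {i} S))" for S
  proof (cases "\<exists>i. S = {i}")
    case True
    then obtain j where S: "S = {j}" by blast
    have "(\<Sum>i\<in>UNIV. smult (co {i} (fst a)) (kp 1 {i} S))
        = (\<Sum>i\<in>UNIV. if i = j then [:co {j} (fst a):] else 0)"
      using S by (intro sum.cong) (auto simp: kp_def)
    then show ?thesis using S by (simp add: kp_def co_def)
  next
    case False
    then have "kp 1 {i} S = 0" for i by (auto simp: kp_def)
    moreover have "card S \<le> 1 \<Longrightarrow> S = {}"
      using False by (metis One_nat_def card_1_singletonE card_eq_0_iff finite le_SucE le_zero_eq)
    ultimately show ?thesis by (auto simp: kp_def co_def)
  qed
  then show ?thesis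
    by (simp add: prod_eq_iff fun_eq_iff pplus_def gscale_def kscale_def theta_def fs sum_fun_apply
        xi_eq_kp)
qed

lemma pplus_xi [simp]: "pplus (xg i) = 0" and pplus_theta [simp]: "pplus theta = 0"
  by (auto simp: pplus_def theta_def xi_eq_kp kp_def fun_eq_iff zero_prod_def)

lemma pzero_gsum: "pzero a \<in> gsum {0}"
  by (auto simp: pzero_def gsum_def gdegs_def coeff_pCons split: if_splits nat.splits
      dest!: gr0_implies_Suc)

text \<open>Statements about the grading need a single power of t as coefficient, unlike the
  identities treated with \<open>k14_induct\<close>.\<close>

lemma k14_mon_induct [case_names kp add]:
  assumes kp: "\<And>c m S. P (kp (monom c m) S)" and add: "\<And>f g. P f \<Longrightarrow> P g \<Longrightarrow> P (f + g)"
  shows "P f"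
proof (induction f rule: k14_induct)
  case (kp p S)
  have "P (kp (\<Sum>i\<in>A. monom (coeff p i) i) S)" if "finite A" for A
    using that
  proof induction
    case empty
    then show ?case using assms(1)[of 0 0 S] by (simp add: zero_fun_def)
  next
    case (insert x F)
    then show ?case using add[OF assms(1)[of "coeff p x" x S] insert(3)]
      by (simp only: sum.insert[OF insert(1,2)] kp_add)
  qed
  from this[of "{..degree p}"] show ?case by (simp add: poly_as_sum_of_monoms)
qed (rule add)

text \<open>The bracket of two monomials is a scaled monomial, with degrees and parities adding up.
  The alternative \<open>d = 0\<close> covers vanishing brackets, for which \<open>k\<close> and
  \<open>U\<close> carry no information.\<close>

lemma kbr_mon:
  obtains d k U where "kbr (kp (monom c m) S) (kp (monom c' n) T) = kp (monom d k) U"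
    "d = 0 \<or> 2 * k + card U + 2 = (2 * m + card S) + (2 * n + card T)"
    "d = 0 \<or> even (card U) = even (card S + card T)"
proof -
  consider "S \<inter> T = {}" | i where "S \<inter> T = {i}"
    | i j where "i \<in> S" "j \<in> S" "i \<in> T" "j \<in> T" "i \<noteq> j"
    by (metis Int_iff insertI1 is_singletonI' is_singleton_the_elem)
  then show ?thesis
  proof cases
    case 1
    \<comment> \<open>For \<open>m = n = 0\<close> the exponent \<open>m + n - 1\<close> is
      truncated to 0; this is harmless because the coefficient then vanishes.\<close>
    let ?d = "rs S T * ((2 - of_nat (card S)) * (c * (of_nat n * c')) - (2 - of_nat (card T)) * (of_nat m * c * c'))"
    have m: "m + (n - 1) = m + n - 1" if "n \<noteq> 0" using that by simp
    have "kbr (kp (monom c m) S) (kp (monom c' n) T) = kp (monom ?d (m + n - 1)) (S \<union> T)"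
    proof (cases "m = 0 \<or> n = 0")
      case True
      then show ?thesis using 1
        by (auto simp: kbr_kp_disjoint pderiv_monom mult_monom smult_monom diff_monom
           simp flip: minus_monom)
    next
      case False
      then show ?thesis using 1
        by (simp add: kbr_kp_disjoint pderiv_monom mult_monom smult_monom diff_monom)
    qed
    moreover have "?d = 0 \<or> 2 * (m + n - 1) + card (S \<union> T) + 2 = (2 * m + card S) + (2 * n + card T)"
      using 1 by (cases "m + n = 0") (auto simp: card_Un_disjoint)
    moreover have "even (card (S \<union> T)) = even (card S + card T)"
      using 1 by (simp add: card_Un_disjoint)
    ultimately show ?thesis using that by blast
  next
    case (2 i)
    then have i: "i \<in> S" "i \<in> T" by auto
    have "card ((S - {i}) \<union> (T - {i})) + 2 = card S + card T"
    proof -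
      have "(S - {i}) \<inter> (T - {i}) = {}" using 2 by auto
      moreover have "card S > 0" "card T > 0" using i by (auto simp: card_gt_0_iff)
      ultimately show ?thesis using i by (simp add: card_Un_disjoint)
    qed
    moreover from this have "even (card ((S - {i}) \<union> (T - {i}))) = even (card S + card T)"
      by (metis even_add even_numeral)
    moreover have "kbr (kp (monom c m) S) (kp (monom c' n) T)
      = kp (monom (- rs S T * (c * c')) (m + n)) ((S - {i}) \<union> (T - {i}))"
      using 2 by (simp add: kbr_kp_single mult_monom smult_monom minus_monom)
    ultimately show ?thesis using that[of "- rs S T * (c * c')" "m + n"] by simp
  next
    case 3
    then show ?thesis using that[of 0 0 "{}"] by (simp add: kbr_kp_zero)
  qed
qed

text \<open>The bracket of monomials adds parities, and \<open>psi\<close> pairs complementary sets,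
  whose sizes have the even sum 4.\<close>

lemma gpo_gbr: "gpo (gbr a b) = gbr (gpo a) (gpo b)"
proof -
  have "parity_op (kbr f g) = kbr (parity_op f) (parity_op g) \<and>
    psi (parity_op f) (parity_op g) = psi f g" for f g
  proof (induction f rule: k14_mon_induct)
    case kp1: (kp c m S)
    show ?case
    proof (induction g rule: k14_mon_induct)
      case (kp c' n T)
      obtain d k U where *: "kbr (kp (monom c m) S) (kp (monom c' n) T) = kp (monom d k) U"
        "d = 0 \<or> even (card U) = even (card S + card T)"
        by (rule kbr_mon)
      have **: "(-1) ^ card U * d = (-1) ^ card S * ((-1) ^ card T * d)"
        using *(2) by (auto simp: minus_one_power_iff)
      have sc: "parity_op (kp p V) = kscale ((-1) ^ card V) (kp p V)" for p V
        by (simp add: parity_op_kp kscale_kp)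
      let ?A = "kp (monom c m) S" and ?B = "kp (monom c' n) T"
      have "psi ?A ?B = (-1) ^ card S * ((-1) ^ card T * psi ?A ?B)"
        using card_Compl_idx[of S]
        by (auto simp: psi_kp minus_one_power_iff) presburger+
      then have "psi (parity_op ?A) (parity_op ?B) = psi ?A ?B"
        by (simp only: sc psi_linear mult.left_commute)
      moreover have "parity_op (kbr ?A ?B) = kbr (parity_op ?A) (parity_op ?B)"
      proof -
        have "kbr (parity_op ?A) (parity_op ?B)
            = kscale ((-1) ^ card S) (kscale ((-1) ^ card T) (kbr ?A ?B))"
          unfolding sc kbr_scale_left unfolding kbr_scale_right ..
        then show ?thesis by (simp only: sc *(1) kscale_kp smult_monom **)
      qed
      ultimately show ?case by simp
    next
      case (add f g)
      then show ?case by (simp only: kbr_add_right psi_linear parity_op_linear simp_thms)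
    qed
  next
    case (add f g)
    then show ?case by (simp only: kbr_add_left psi_linear parity_op_linear simp_thms)
  qed
  then show ?thesis by (simp add: gbr_def gpo_def)
qed

lemma pplus_mon: "pplus (emb (kp (monom c m) S)) = emb (if 2 * m + card S \<ge> 2 then kp (monom c m) S else 0)"
proof -
  have "fst (pplus (emb (kp (monom c m) S))) T = (if 2 * m + card S \<ge> 2 then kp (monom c m) S else 0) T" for T
    by (cases "T = S"; cases m) (simp_all add: pplus_def kp_def monom_0)
  then show ?thesis by (intro prod_eqI ext) (simp_all add: pplus_def)
qed

lemma pzero_mon: "pzero (emb (kp (monom c m) S)) = emb (if 2 * m + card S = 2 then kp (monom c m) S else 0)"
proof -
  have "2 * m + card S = 2 \<longleftrightarrow> card S = 2 \<and> m = 0 \<or> S = {} \<and> m = 1"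
    unfolding card_0_eq[OF finite[of S], symmetric] by presburger
  then show ?thesis
    by (auto simp: pzero_def kp_def fun_eq_iff monom_0)
qed

lemma pplus_emb_0: "pplus (emb 0) = emb 0" "pzero (emb 0) = emb 0"
  by (auto simp: pplus_def pzero_def fun_eq_iff)

text \<open>The nonnegative part is a subalgebra, and its projection to degree zero is a
  homomorphism. This makes F, with the positive part acting by zero, a module over
  \<open>\<gg>\<^sub>\<ge>\<^sub>0\<close>.\<close>

lemma pplus_pzero_gbr:
  "pplus (gbr (pplus a) (pplus b)) = gbr (pplus a) (pplus b)" (is "?P a b")
  "pzero (gbr (pplus a) (pplus b)) = gbr (pzero a) (pzero b)" (is "?Q a b")
proof -
  have *: "?P (emb f) (emb g) \<and> ?Q (emb f) (emb g)" for f g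
  proof (induction f rule: k14_mon_induct)
    case kp1: (kp c m S)
    show ?case
    proof (induction g rule: k14_mon_induct)
      case (kp c' n T)
      obtain d k U where *: "kbr (kp (monom c m) S) (kp (monom c' n) T) = kp (monom d k) U"
        "d = 0 \<or> 2 * k + card U + 2 = (2 * m + card S) + (2 * n + card T)"
        by (rule kbr_mon)
      \<comment> \<open>A nonzero value needs constant coefficients and complementary sets; in
        nonnegative degree both sets then have two elements, where the factor
        \<open>card S - 2\<close> is zero.\<close>
      have psi: "psi (kp (monom c m) S) (kp (monom c' n) T) = 0"
        if "2 * m + card S \<ge> 2" "2 * n + card T \<ge> 2"
      proof -
        have "T = - S \<Longrightarrow> m = 0 \<Longrightarrow> n = 0 \<Longrightarrow> card S = 2"
          using that card_Compl_idx[of S] by auto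
        then show ?thesis by (cases m; cases n) (auto simp: psi_kp)
      qed
      show ?case
        using *(2) psi
        by (simp add: pplus_mon pzero_mon gbr_def *(1) psi_linear pplus_emb_0) auto
    next
      case (add f g)
      have "emb (f + g) = emb f + emb g" by simp
      then show ?case using add by (simp only: gbr_add_right pplus_add pzero_add simp_thms)
    qed
  next
    case (add f g)
    have "emb (f + g) = emb f + emb g" by simp
    then show ?case using add by (simp only: gbr_add_left pplus_add pzero_add simp_thms)
  qed
  have "gbr (pplus a) (pplus b) = gbr (pplus (emb (fst a))) (pplus (emb (fst b)))"
    "gbr (pzero a) (pzero b) = gbr (pzero (emb (fst a))) (pzero (emb (fst b)))"
    unfolding gbr_def pplus_def pzero_def fst_conv by (rule refl)+
  then show "?P a b" "?Q a b" using *[of "fst a" "fst b"] by simp_all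
qed

section \<open>Operators on the tensor algebra\<close>

text \<open>Additive extension along the support. The coefficients may lie in any abelian group, so
  the same operator serves words with coefficients in F and formal complex combinations.\<close>

definition lext :: "('a \<Rightarrow> 'b::ab_group_add \<Rightarrow> 'c::ab_group_add) \<Rightarrow> ('a \<Rightarrow>\<^sub>0 'b) \<Rightarrow> 'c" where
  "lext g f = (\<Sum>w\<in>keys f. g w (lookup f w))"

lemma lext_superset:
  assumes "\<And>w. g w 0 = 0" "finite A" "keys f \<subseteq> A"
  shows "lext g f = (\<Sum>w\<in>A. g w (lookup f w))"
  unfolding lext_def using assms
  by (intro sum.mono_neutral_left) (auto simp: in_keys_iff)

lemma lext_add:
  assumes "\<And>w x y. g w (x + y) = g w x + g w y"
  shows "lext g (p + q) = lext g p + lext g q"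
proof -
  have 0: "g w 0 = 0" for w using assms[of w 0 0] by simp
  let ?A = "keys p \<union> keys q"
  have "lext g (p + q) = (\<Sum>w\<in>?A. g w (lookup (p + q) w))"
    "lext g p = (\<Sum>w\<in>?A. g w (lookup p w))"
    "lext g q = (\<Sum>w\<in>?A. g w (lookup q w))"
    using keys_add[of p q] by (intro lext_superset; auto simp: 0)+
  then show ?thesis by (simp add: lookup_add assms sum.distrib)
qed

lemma lext_single: "g w 0 = 0 \<Longrightarrow> lext g (single w v) = g w v"
  by (cases "v = 0") (simp_all add: lext_def)

lemma pm_induct [case_names single add]:
  assumes "\<And>k v. P (single k v)" "\<And>f g. P f \<Longrightarrow> P g \<Longrightarrow> P (f + g)"
  shows "P (f :: 'a \<Rightarrow>\<^sub>0 'b::ab_group_add)"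
proof (induction f rule: update_induct)
  case const
  show ?case using assms(1)[of undefined 0] by simp
next
  case (update f a b)
  have "Poly_Mapping.update a b f = f + single a b"
    using update(1) by (intro poly_mapping_eqI)
      (auto simp: lookup_update lookup_add lookup_single in_keys_iff when_def)
  then show ?case using assms update by simp
qed

lemma additive_eqI:
  fixes F G :: "('a \<Rightarrow>\<^sub>0 'b::ab_group_add) \<Rightarrow> 'c::ab_group_add"
  assumes "\<And>f g. F (f + g) = F f + F g" "\<And>f g. G (f + g) = G f + G g"
    and "\<And>k v. F (single k v) = G (single k v)"
  shows "F f = G f"
  by (induction f rule: pm_induct) (simp_all add: assms)

lemma additive_diff:
  fixes F :: "'a::ab_group_add \<Rightarrow> 'b::ab_group_add"
  assumes "\<And>f g. F (f + g) = F f + F g"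
  shows "F (f - g) = F f - F g" "F 0 = 0" "F (- f) = - F f"
proof -
  show "F (f - g) = F f - F g" using assms[of "f - g" g] by (simp add: eq_diff_eq)
  show 0: "F 0 = 0" using assms[of 0 0] by simp
  show "F (- f) = - F f" using assms[of f "- f"] 0 by (simp add: eq_neg_iff_add_eq_0 add.commute)
qed

text \<open>The cases mirror the definition of \<open>Pi\<close>, which treats the nonnegative part
  by recursion over the word but lets theta and the generators act by left multiplication.\<close>

lemma gvec_induct [case_names plus theta xi add scale]:
  assumes "\<And>a. P (pplus a)" "P theta" "\<And>i. P (xg i)"
    "\<And>a b. P a \<Longrightarrow> P b \<Longrightarrow> P (a + b)" "\<And>c a. P a \<Longrightarrow> P (gscale c a)"
  shows "P a"
proof -
  have "P (gscale (co {} (fst a)) theta)" using assms by blast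
  moreover have "P (\<Sum>i\<in>A. gscale (co {i} (fst a)) (xg i))" if "finite A" for A
    using that
  proof induction
    case empty
    show ?case using assms(5)[OF assms(2), of 0]
      by (simp add: gscale_def kscale_def zero_prod_def zero_fun_def)
  next
    case (insert x F)
    show ?case unfolding sum.insert[OF insert(1,2)]
      by (rule assms(4)[OF assms(5)[OF assms(3)] insert(3)])
  qed
  ultimately have "P (pplus a + gscale (co {} (fst a)) theta + (\<Sum>i\<in>UNIV. gscale (co {i} (fst a)) (xg i)))"
    by (intro assms) auto
  then show ?thesis using pplus_decomp[of a] by simp
qed

locale g0_mod =
  fixes sc :: "complex \<Rightarrow> 'v::ab_group_add \<Rightarrow> 'v" and \<rho> :: "gvec \<Rightarrow> 'v \<Rightarrow> 'v"
  assumes mod: "g0_module sc \<rho>"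
begin

lemma vs: "vector_space sc" using mod by (simp add: g0_module_def)

sublocale vector_space sc by (rule vs)

lemma rho_linear: "a \<in> gsum {0} \<Longrightarrow> \<rho> a (v + w) = \<rho> a v + \<rho> a w"
    "a \<in> gsum {0} \<Longrightarrow> \<rho> a (sc c v) = sc c (\<rho> a v)"
  using mod unfolding g0_module_def
  by (auto dest!: bspec[of _ _ a] simp: linear_iff_module_hom module_hom_iff)

lemma rho_add: "a \<in> gsum {0} \<Longrightarrow> b \<in> gsum {0} \<Longrightarrow> \<rho> (a + b) v = \<rho> a v + \<rho> b v"
  and rho_scale: "a \<in> gsum {0} \<Longrightarrow> \<rho> (gscale c a) v = sc c (\<rho> a v)"
  and rho_br: "a \<in> gsum {0} \<Longrightarrow> b \<in> gsum {0} \<Longrightarrow> \<rho> (gbr a b) v = \<rho> a (\<rho> b v) - \<rho> b (\<rho> a v)"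
  using mod unfolding g0_module_def by auto

definition ns :: "complex \<Rightarrow> (idx list \<Rightarrow>\<^sub>0 'v) \<Rightarrow> (idx list \<Rightarrow>\<^sub>0 'v)" where
  "ns c = Poly_Mapping.map (sc c)"

lemma lookup_ns [simp]: "lookup (ns c f) w = sc c (lookup f w)"
  by (simp add: ns_def Poly_Mapping.map.rep_eq when_def)

lemma ns_simps: "ns c (f + g) = ns c f + ns c g" "ns c (f - g) = ns c f - ns c g"
  "ns c (- f) = - ns c f" "ns c 0 = 0" "ns (c + d) f = ns c f + ns d f"
  "ns c (ns d f) = ns (c * d) f" "ns 1 f = f" "ns 0 f = 0" "ns (- c) f = - ns c f"
  "ns (c - d) f = ns c f - ns d f"
  by (rule poly_mapping_eqI; simp add: lookup_add lookup_minus scale_right_distrib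
      scale_left_distrib scale_right_diff_distrib scale_left_diff_distrib)+

lemma ns_single: "ns c (single w v) = single w (sc c v)"
  by (rule poly_mapping_eqI) (simp add: lookup_single when_def)

definition Lx :: "idx \<Rightarrow> (idx list \<Rightarrow>\<^sub>0 'v) \<Rightarrow> (idx list \<Rightarrow>\<^sub>0 'v)" where
  "Lx i = lext (\<lambda>w v. single (i # w) v)"

lemma Lx_add: "Lx i (f + g) = Lx i f + Lx i g"
  unfolding Lx_def by (rule lext_add) (simp add: single_add)

lemmas Lx_simps = Lx_add additive_diff[of "Lx i" for i, OF Lx_add]

lemma Lx_single: "Lx i (single w v) = single (i # w) v"
  unfolding Lx_def by (rule lext_single) simp

lemma Lx_ns: "Lx i (ns c f) = ns c (Lx i f)"
  by (rule additive_eqI[where F = "\<lambda>f. Lx i (ns c f)" and G = "\<lambda>f. ns c (Lx i f)"])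
    (simp_all add: Lx_simps ns_simps ns_single Lx_single)

text \<open>The action of the component in \<open>\<gg>\<^sub><\<^sub>0\<close>; since \<open>[\<xi>\<^sub>1, \<xi>\<^sub>1] = - theta\<close>, \<open>theta\<close> acts as \<open>- 2 \<xi>\<^sub>1\<^sup>2\<close>.\<close>

definition ac :: "gvec \<Rightarrow> (idx list \<Rightarrow>\<^sub>0 'v) \<Rightarrow> (idx list \<Rightarrow>\<^sub>0 'v)" where
  "ac a f = (\<Sum>i\<in>UNIV. ns (co {i} (fst a)) (Lx i f)) + ns (- 2 * co {} (fst a)) (Lx I1 (Lx I1 f))"

lemma co_pair: "co S (fst (a + b)) = co S (fst a) + co S (fst b)" "co S (fst (gscale c a)) = c * co S (fst a)"
  "co S (fst a + fst b) = co S (fst a) + co S (fst b)"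
  by (simp_all add: co_def gscale_def kscale_def)

lemma ns_sum: "ns c (\<Sum>i\<in>A. h i) = (\<Sum>i\<in>A. ns c (h i))"
  by (induction A rule: infinite_finite_induct) (simp_all add: ns_simps)

lemma ac_simps: "ac (a + b) f = ac a f + ac b f" "ac (gscale c a) f = ns c (ac a f)"
  "ac a (f + g) = ac a f + ac a g" "ac a (ns c f) = ns c (ac a f)"
  by (simp_all add: ac_def co_pair ns_simps Lx_simps Lx_ns ns_sum sum.distrib distrib_left
      mult.commute mult.left_commute)

lemma co_pplus: "card S \<le> 1 \<Longrightarrow> co S (fst (pplus a)) = 0"
  by (simp add: co_def pplus_def)

lemma ac_pplus: "ac (pplus a) f = 0"
  by (simp add: ac_def co_pplus ns_simps)

lemma co_theta: "co S (fst theta) = (if S = {} then 1 else 0)"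
  and co_xg: "co S (xi i) = (if S = {i} then 1 else 0)"
  by (simp_all add: co_kp theta_def xi_eq_kp)

lemma ac_theta: "ac theta f = ns (- 2) (Lx I1 (Lx I1 f))"
  by (simp add: ac_def co_theta ns_simps)

lemma ac_xg: "ac (xg j) f = Lx j f"
proof -
  have "(\<Sum>i\<in>UNIV. ns (co {i} (fst (xg j))) (Lx i f)) = (\<Sum>i\<in>UNIV. if i = j then Lx j f else 0)"
    by (intro sum.cong) (auto simp: co_xg ns_simps)
  then show ?thesis by (simp add: ac_def co_xg ns_simps)
qed

text \<open>This is \<open>a\<close> applied to the word \<open>w\<close> with coefficient
  \<open>v\<close>. The negative part of \<open>a\<close> multiplies from the left through
  \<open>ac\<close>; the rest is moved past the first letter by
  \<open>a xi_i = [a, xi_i] + xi_i gpo(a)\<close>. The new bracket may have a negative part again,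
  which the next call handles; recursion over \<open>w\<close> terminates regardless. On the empty
  word only the degree zero component acts on F.\<close>

primrec pim :: "idx list \<Rightarrow> gvec \<Rightarrow> 'v \<Rightarrow> (idx list \<Rightarrow>\<^sub>0 'v)" where
  "pim [] = (\<lambda>a v. ac a (single [] v) + single [] (\<rho> (pzero a) v))"
| "pim (i # w) = (\<lambda>a v. ac a (single (i # w) v) + pim w (gbr (pplus a) (xg i)) v
     + Lx i (pim w (gpo (pplus a)) v))"

lemma pim_add_v: "pim w a (u + v) = pim w a u + pim w a v"
  by (induction w arbitrary: a)
    (simp_all add: single_add ac_simps rho_linear pzero_gsum Lx_simps)

lemma pim_scale_v: "pim w a (sc c v) = ns c (pim w a v)"
  by (induction w arbitrary: a)
    (simp_all add: ac_simps rho_linear pzero_gsum Lx_ns ns_simps flip: ns_single)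

lemma pim_add_a: "pim w (a + b) v = pim w a v + pim w b v"
  by (induction w arbitrary: a b)
    (simp_all only: pim.simps ac_simps rho_add pzero_gsum pzero_add pplus_add gbr_add_left gpo_add Lx_simps
      single_add add_ac)

lemma pim_scale_a: "pim w (gscale c a) v = ns c (pim w a v)"
  by (induction w arbitrary: a)
    (simp_all add: pzero_scale pplus_scale gbr_scale_left gpo_scale ac_simps rho_scale pzero_gsum
      Lx_ns ns_simps flip: ns_single)

definition Pi :: "gvec \<Rightarrow> (idx list \<Rightarrow>\<^sub>0 'v) \<Rightarrow> (idx list \<Rightarrow>\<^sub>0 'v)" where
  "Pi a = lext (\<lambda>w v. pim w a v)"

lemma Pi_single: "Pi a (single w v) = pim w a v"
  unfolding Pi_def using pim_add_v[of w a 0 0] by (intro lext_single) simp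

lemma Pi_add: "Pi a (f + g) = Pi a f + Pi a g"
  unfolding Pi_def by (rule lext_add) (rule pim_add_v)

lemmas Pi_simps = Pi_add additive_diff[of "Pi a" for a, OF Pi_add]

lemma Pi_ns: "Pi a (ns c f) = ns c (Pi a f)"
  by (rule additive_eqI[where F = "\<lambda>f. Pi a (ns c f)" and G = "\<lambda>f. ns c (Pi a f)"])
    (simp_all add: Pi_simps ns_simps ns_single Pi_single pim_scale_v)

lemma Pi_add_left: "Pi (a + b) f = Pi a f + Pi b f"
  by (rule additive_eqI) (simp_all add: Pi_simps Pi_single pim_add_a)

lemmas Pi_left_simps = Pi_add_left additive_diff[of "\<lambda>a. Pi a f" for f, OF Pi_add_left]

lemma Pi_scale_left: "Pi (gscale c a) f = ns c (Pi a f)"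
  by (rule additive_eqI) (simp_all add: Pi_simps Pi_single pim_scale_a ns_simps)

lemma Pi_Lx: "Pi a (Lx i f) = ac a (Lx i f) + Pi (gbr (pplus a) (xg i)) f + Lx i (Pi (gpo (pplus a)) f)"
  by (rule additive_eqI) (simp_all add: Pi_simps Pi_single Lx_single Lx_simps ac_simps)

lemma gpo_0 [simp]: "gpo 0 = 0"
  using gpo_add[of 0 0] by simp

lemma pim_0 [simp]: "pim w 0 v = 0"
  using pim_add_a[of w 0 0] by simp

lemma Pi_xg: "Pi (xg j) f = Lx j f"
proof (rule additive_eqI[where F = "Pi (xg j)" and G = "Lx j"])
  fix w v
  have "pzero (xg j) = 0"
    using pzero_pplus[of "xg j"] by (metis add_cancel_right_right pplus_xi pzero_add add_0)
  then have "\<rho> (pzero (xg j)) v = 0" using rho_add[of 0 0] pzero_gsum[of "xg j"] by simp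
  then show "Pi (xg j) (single w v) = Lx j (single w v)"
    by (cases w) (simp_all add: Pi_single ac_xg Lx_simps)
qed (simp_all add: Pi_simps Lx_simps)

lemma Pi_theta: "Pi theta f = ns (- 2) (Lx I1 (Lx I1 f))"
proof (rule additive_eqI[where F = "Pi theta" and G = "\<lambda>f. ns (- 2) (Lx I1 (Lx I1 f))"])
  fix w v
  have "pzero theta = 0"
    using pzero_pplus[of "theta"] by (metis add_cancel_right_right pplus_theta pzero_add add_0)
  then have "\<rho> (pzero theta) v = 0" using rho_add[of 0 0] pzero_gsum[of theta] by simp
  then show "Pi theta (single w v) = ns (- 2) (Lx I1 (Lx I1 (single w v)))"
    by (cases w) (simp_all add: Pi_single ac_theta Lx_simps)
qed (simp_all add: Pi_simps Lx_simps ns_simps)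

end

lemma gscale_simps: "gscale 1 a = a" "gscale (- c) a = - gscale c a" "gscale c (a + b) = gscale c a + gscale c b"
   "gscale c (gscale d a) = gscale (c * d) a" "gscale c (- a) = - gscale c a"
   "gscale c (a - b) = gscale c a - gscale c b" "gscale c 0 = 0" "gscale 0 a = 0"
  by (auto simp: gscale_def kscale_def prod_eq_iff fun_eq_iff smult_add_right smult_diff_right algebra_simps)

lemma gscale_add_left: "gscale (c + d) a = gscale c a + gscale d a"
  by (simp add: gscale_def kscale_def prod_eq_iff fun_eq_iff smult_add_left distrib_right)

lemma gpo_xg: "gpo (xg j) = gscale (- 1) (xg j)"
  by (simp add: gpo_def gscale_def xi_eq_kp parity_op_kp kscale_kp)

lemma gpo_theta: "gpo theta = theta"
  by (simp add: gpo_def theta_def parity_op_kp one_pCons)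

lemma gbr_theta_eq: "gbr a theta = gscale (- 2) (gbr (gbr a (xg k)) (xg k))"
proof -
  have "gbr a theta = - (gbr (gbr a (xg k)) (xg k) + gbr (gbr a (xg k)) (xg k))"
    using gbr_gbr_xi_xi[of a k k] by simp
  also have "\<dots> = gscale (- 1) (gbr (gbr a (xg k)) (xg k)) + gscale (- 1) (gbr (gbr a (xg k)) (xg k))"
    by (simp only: gscale_simps minus_add_distrib)
  also have "\<dots> = gscale (- 1 + - 1) (gbr (gbr a (xg k)) (xg k))"
    by (simp only: gscale_add_left)
  finally show ?thesis by simp
qed

section \<open>The Clifford relations and their stability\<close>

context g0_mod
begin

text \<open>The Clifford relations live in degree at least two, see \<open>R_lookup\<close>; this is what makes
  degree at most one of the quotient visible.\<close>

definition clif :: "idx \<Rightarrow> idx \<Rightarrow> (idx list \<Rightarrow>\<^sub>0 'v) \<Rightarrow> (idx list \<Rightarrow>\<^sub>0 'v)" where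
  "clif i j f = Lx i (Lx j f) + Lx j (Lx i f) - (if i = j then ns 2 (Lx I1 (Lx I1 f)) else 0)"

text \<open>As \<open>f\<close> is arbitrary in \<open>clif i j f\<close>, closure under left
  multiplication and linear combinations gives all that the two-sided ideal of the relations
  produces. All squares are identified with that of xi_1, which stands for minus one half of
  theta.\<close>

inductive_set R :: "(idx list \<Rightarrow>\<^sub>0 'v) set" where
  clif: "clif i j f \<in> R"
| Lx: "r \<in> R \<Longrightarrow> Lx i r \<in> R"
| ns: "r \<in> R \<Longrightarrow> ns c r \<in> R"
| add: "r \<in> R \<Longrightarrow> s \<in> R \<Longrightarrow> r + s \<in> R"

lemma R_0: "0 \<in> R"
  using R.ns[OF R.clif[of I1 I1 0], of 0] by (simp add: ns_simps)

lemma R_minus: "r \<in> R \<Longrightarrow> - r \<in> R"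
  using R.ns[of r "- 1"] by (simp add: ns_simps)

lemma R_diff: "r \<in> R \<Longrightarrow> s \<in> R \<Longrightarrow> r - s \<in> R"
  using R.add[of r "- s"] R_minus by simp

lemma lookup_Lx: "lookup (Lx i f) w = (case w of [] \<Rightarrow> 0 | j # u \<Rightarrow> if j = i then lookup f u else 0)"
  by (induction f rule: pm_induct)
    (auto simp: Lx_simps lookup_add Lx_single lookup_single when_def split: list.splits)

lemma R_lookup: "r \<in> R \<Longrightarrow> length w \<le> 1 \<Longrightarrow> lookup r w = 0"
proof (induction arbitrary: w rule: R.induct)
  case (clif i j f)
  then show ?case
    by (cases w) (auto simp: clif_def lookup_add lookup_minus lookup_Lx)
next
  case (Lx r i)
  then show ?case by (auto simp: lookup_Lx split: list.splits)
qed (auto simp: lookup_add)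

definition eqv :: "(idx list \<Rightarrow>\<^sub>0 'v) \<Rightarrow> (idx list \<Rightarrow>\<^sub>0 'v) \<Rightarrow> bool" (infix "\<approx>" 50) where
  "f \<approx> g \<longleftrightarrow> f - g \<in> R"

lemma eqv_refl [simp]: "f \<approx> f" by (simp add: eqv_def R_0)

lemma eqv_sym: "f \<approx> g \<Longrightarrow> g \<approx> f" using R_minus[of "f - g"] by (simp add: eqv_def)

lemma eqv_trans [trans]: "f \<approx> g \<Longrightarrow> g \<approx> h \<Longrightarrow> f \<approx> h"
  using R.add[of "f - g" "g - h"] by (simp add: eqv_def)

lemma eqv_add: "f \<approx> g \<Longrightarrow> f' \<approx> g' \<Longrightarrow> f + f' \<approx> g + g'"
  using R.add[of "f - g" "f' - g'"] by (simp add: eqv_def algebra_simps)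

lemma eqv_diff: "f \<approx> g \<Longrightarrow> f' \<approx> g' \<Longrightarrow> f - f' \<approx> g - g'"
  using R_diff[of "f - g" "f' - g'"] by (simp add: eqv_def algebra_simps)

lemma eqv_ns: "f \<approx> g \<Longrightarrow> ns c f \<approx> ns c g"
  using R.ns[of "f - g" c] by (simp add: eqv_def ns_simps)

lemma eqv_Lx: "f \<approx> g \<Longrightarrow> Lx i f \<approx> Lx i g"
  using R.Lx[of "f - g" i] by (simp add: eqv_def Lx_simps)

lemma eqv_0: "f \<approx> 0 \<longleftrightarrow> f \<in> R" by (simp add: eqv_def)

lemma clif_eqv: "Lx i (Lx j f) + Lx j (Lx i f) \<approx> (if i = j then ns 2 (Lx I1 (Lx I1 f)) else 0)"
  using R.clif[of i j f] by (simp add: eqv_def clif_def)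

text \<open>The commutator of xi_1 xi_1 with xi_i is the difference of two Clifford relations, one
  multiplied by xi_1 from the left and one from the right.\<close>

lemma Lx_theta: "Lx I1 (Lx I1 (Lx i f)) \<approx> Lx i (Lx I1 (Lx I1 f))"
proof -
  let ?d = "if i = I1 then ns 2 (Lx I1 (Lx I1 f)) else 0" and ?d' = "if i = I1 then ns 2 (Lx I1 (Lx I1 (Lx I1 f))) else 0"
  have 1: "Lx I1 (Lx I1 (Lx i f)) + Lx I1 (Lx i (Lx I1 f)) \<approx> Lx I1 ?d"
    using eqv_Lx[OF clif_eqv[of I1 i f], of I1] by (auto simp: Lx_simps split: if_splits)
  have 2: "Lx i (Lx I1 (Lx I1 f)) + Lx I1 (Lx i (Lx I1 f)) \<approx> ?d'"
    using clif_eqv[of i I1 "Lx I1 f"] by simp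
  have "Lx I1 ?d = ?d'" by (simp add: Lx_ns Lx_simps)
  then show ?thesis using eqv_diff[OF 1 2] by (simp add: eqv_def)
qed

text \<open>For the nonnegative part this is the recursion defining \<open>Pi\<close>, and holds
  exactly. Modulo \<open>R\<close> it extends to all of \<gg>: for xi_j it is a Clifford relation,
  for theta the centrality shown in \<open>Lx_theta\<close>.\<close>

lemma Pi_Lx_eqv: "Pi a (Lx i f) \<approx> Pi (gbr a (xg i)) f + Lx i (Pi (gpo a) f)"
proof (induction a rule: gvec_induct)
  case (plus a)
  show ?case by (simp add: Pi_Lx[of "pplus a"] ac_pplus)
next
  case theta
  have "card (- {} :: idx set) = 4" using card_Compl_idx[of "{}"] by simp
  then have "(- {} :: idx set) \<noteq> {i}" by (intro notI, drule_tac arg_cong[of _ _ card], simp)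
  then have "gbr theta (xg i) = 0"
    by (simp add: gbr_def theta_def kbr_kp_xi prod_eq_iff) (simp add: xi_eq_kp psi_kp)
  then show ?case using eqv_ns[OF Lx_theta[of i f], of "-2"]
    by (simp add: gpo_theta Pi_theta Lx_ns Pi_left_simps)
next
  case (xi j)
  have "Lx j (Lx i f) \<approx> (if i = j then ns 2 (Lx I1 (Lx I1 f)) else 0) - Lx i (Lx j f)"
    using eqv_diff[OF clif_eqv[of j i f] eqv_refl[of "Lx i (Lx j f)"]] by (auto split: if_splits)
  then show ?case
    by (auto simp: Pi_xg gbr_xi_xi gpo_xg Pi_left_simps Pi_scale_left Pi_theta Lx_simps ns_simps split: if_splits)
next
  case (add a b)
  then show ?case using eqv_add[OF add]
    by (simp add: Pi_left_simps gbr_add_left gpo_add Lx_simps add_ac)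
next
  case (scale c a)
  then show ?case using eqv_ns[OF scale, of c]
    by (simp add: Pi_scale_left gbr_scale_left gpo_scale Lx_ns ns_simps)
qed

lemma Pi_Lx_Lx_eqv: "Pi a (Lx i (Lx j f)) \<approx>
   Pi (gbr (gbr a (xg i)) (xg j)) f - Lx j (Pi (gbr (gpo a) (xg i)) f) + Lx i (Pi (gbr (gpo a) (xg j)) f)
   + Lx i (Lx j (Pi a f))"
proof -
  have "Pi a (Lx i (Lx j f)) \<approx> Pi (gbr a (xg i)) (Lx j f) + Lx i (Pi (gpo a) (Lx j f))"
    by (rule Pi_Lx_eqv)
  also have "\<dots> \<approx> (Pi (gbr (gbr a (xg i)) (xg j)) f + Lx j (Pi (gpo (gbr a (xg i))) f))
       + Lx i (Pi (gbr (gpo a) (xg j)) f + Lx j (Pi (gpo (gpo a)) f))"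
    by (intro eqv_add eqv_Lx Pi_Lx_eqv)
  also have "\<dots> = Pi (gbr (gbr a (xg i)) (xg j)) f - Lx j (Pi (gbr (gpo a) (xg i)) f) + Lx i (Pi (gbr (gpo a) (xg j)) f)
   + Lx i (Lx j (Pi a f))"
    by (simp add: gpo_gbr gpo_xg gbr_scale_right Pi_scale_left ns_simps Lx_simps algebra_simps)
  finally show ?thesis .
qed

text \<open>Symmetrising \<open>Pi_Lx_Lx_eqv\<close> in \<open>i\<close> and \<open>j\<close>
  cancels the mixed terms. The iterated brackets are evaluated by \<open>gbr_gbr_xi_xi\<close>, the
  outer generators by a Clifford relation, and \<open>gbr_theta_eq\<close> recombines the two into
  the action on xi_1 xi_1.\<close>

lemma Pi_clif: "Pi a (clif i j f) \<in> R"
proof -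
  have "Pi a (Lx i (Lx j f)) + Pi a (Lx j (Lx i f)) \<approx>
     Pi (gbr (gbr a (xg i)) (xg j) + gbr (gbr a (xg j)) (xg i)) f + (Lx i (Lx j (Pi a f)) + Lx j (Lx i (Pi a f)))"
    using eqv_add[OF Pi_Lx_Lx_eqv[of a i j f] Pi_Lx_Lx_eqv[of a j i f]]
    by (simp add: Pi_left_simps algebra_simps)
  also have "\<dots> \<approx> Pi (if i = j then - gbr a theta else 0) f +
      (if i = j then ns 2 (Lx I1 (Lx I1 (Pi a f))) else 0)"
    unfolding gbr_gbr_xi_xi by (intro eqv_add eqv_refl clif_eqv)
  also have "\<dots> \<approx> (if i = j then ns 2 (Pi a (Lx I1 (Lx I1 f))) else 0)"
    using eqv_sym[OF eqv_ns[OF Pi_Lx_Lx_eqv[of a I1 I1 f], of 2]]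
    by (auto simp: gbr_theta_eq[of a I1] Pi_left_simps Pi_scale_left ns_simps)
  finally show ?thesis
    by (simp add: clif_def eqv_def Pi_simps Pi_ns split: if_splits)
qed

lemma Pi_R: "r \<in> R \<Longrightarrow> Pi a r \<in> R"
proof (induction arbitrary: a rule: R.induct)
  case (clif i j f)
  then show ?case by (rule Pi_clif)
next
  case (Lx r i)
  then have "Pi (gbr a (xg i)) r + Lx i (Pi (gpo a) r) \<in> R" by (intro R.add R.Lx)
  then show ?case using Pi_Lx_eqv[of a i r] eqv_0 eqv_trans by blast
qed (simp_all add: Pi_ns Pi_simps R.ns R.add)

lemma eqv_Pi: "f \<approx> g \<Longrightarrow> Pi a f \<approx> Pi a g"
  using Pi_R[of "f - g" a] by (simp add: eqv_def Pi_simps)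

text \<open>\<open>has_par q b\<close> is parity as an eigenvalue of \<open>gpo\<close>; unlike membership in \<open>gpar q\<close> it is
  meaningful for every \<open>q\<close>, so no case distinction is needed when brackets shift \<open>q\<close>.\<close>

definition has_par :: "nat \<Rightarrow> gvec \<Rightarrow> bool" where
  "has_par q b \<longleftrightarrow> gpo b = gscale ((-1) ^ q) b"

lemma has_par_br: "has_par q b \<Longrightarrow> has_par (Suc q) (gbr b (xg i))"
  by (simp only: has_par_def gpo_gbr gpo_xg gbr_scale_left gbr_scale_right gscale_simps(4)) simp

lemma gpo_pow: "(gpo ^^ q) (gpo a) = gpo ((gpo ^^ q) a)"
  by (simp add: funpow_swap1)

text \<open>The failure of the supercommutator relation for \<open>b\<close> of parity
  \<open>q\<close>. The sign (-1)^(p(a) q) is encoded as a power of \<open>gpo\<close> applied to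
  \<open>a\<close>, which keeps the expression linear in \<open>a\<close>.\<close>

definition defect :: "nat \<Rightarrow> gvec \<Rightarrow> gvec \<Rightarrow> (idx list \<Rightarrow>\<^sub>0 'v) \<Rightarrow> (idx list \<Rightarrow>\<^sub>0 'v)" where
  "defect q a b f = Pi a (Pi b f) - Pi b (Pi ((gpo ^^ q) a) f) - Pi (gbr a b) f"

lemma gpow_linear: "(gpo ^^ q) (a + b) = (gpo ^^ q) a + (gpo ^^ q) b"
   "(gpo ^^ q) (gscale c a) = gscale c ((gpo ^^ q) a)"
  by (induction q) (simp_all add: gpo_add gpo_scale)

lemma defect_linear: "defect q (a + a') b f = defect q a b f + defect q a' b f"
  "defect q a (b + b') f = defect q a b f + defect q a b' f"
  "defect q (gscale c a) b f = ns c (defect q a b f)"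
  "defect q a (gscale c b) f = ns c (defect q a b f)"
  "defect q a b (f + f') = defect q a b f + defect q a b f'"
  by (simp_all add: defect_def gpow_linear Pi_left_simps Pi_simps gbr_add_left gbr_add_right
      gbr_scale_left gbr_scale_right Pi_scale_left Pi_ns ns_simps algebra_simps)

lemma gpow_parity: "(gpo ^^ q) a = (if even q then a else gpo a)"
  by (induction q) auto

lemma defect_xg: "odd q \<Longrightarrow> defect q a (xg i) f \<in> R"
  using Pi_Lx_eqv[of a i f] by (simp add: defect_def gpow_parity Pi_xg eqv_def algebra_simps)

lemma defect_theta: "even q \<Longrightarrow> defect q a theta f \<in> R"
proof -
  assume "even q"
  have "Pi a (Lx I1 (Lx I1 f)) - Lx I1 (Lx I1 (Pi a f)) - Pi (gbr (gbr a (xg I1)) (xg I1)) f \<in> R"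
    using Pi_Lx_Lx_eqv[of a I1 I1 f] by (simp add: eqv_def algebra_simps)
  from R.ns[OF this, of "-2"] \<open>even q\<close> show ?thesis
    by (simp add: defect_def gpow_parity Pi_theta gbr_theta_eq[of a I1] Pi_scale_left ns_simps Pi_ns Pi_simps)
qed

lemma gpow_has_par: "has_par p a \<Longrightarrow> (gpo ^^ q) a = gscale ((-1) ^ (p * q)) a"
  by (auto simp: gpow_parity has_par_def gscale_simps minus_one_power_iff)

text \<open>Exchanging homogeneous arguments multiplies the defect by minus the sign (-1)^(pq), so
  membership in \<open>R\<close> passes from one order to the other.\<close>

lemma defect_swap:
  assumes "has_par p a" "has_par q b" "gbr a b = gscale (- ((-1) ^ (p * q))) (gbr b a)"
    and "defect p b a f \<in> R"
  shows "defect q a b f \<in> R"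
proof -
  define s :: complex where "s = (-1) ^ (p * q)"
  have s: "s * s = 1" by (simp add: s_def flip: power_add)
  have "(gpo ^^ q) a = gscale s a" "(gpo ^^ p) b = gscale s b" "gbr a b = gscale (- s) (gbr b a)"
    using assms(1-3) gpow_has_par[of p a q] gpow_has_par[of q b p] by (simp_all add: s_def mult.commute[of q p])
  then have 1: "defect q a b f = Pi a (Pi b f) - ns s (Pi b (Pi a f)) - ns (- s) (Pi (gbr b a) f)"
    "defect p b a f = Pi b (Pi a f) - ns s (Pi a (Pi b f)) - Pi (gbr b a) f"
    by (simp_all only: defect_def Pi_scale_left Pi_ns)
  have "defect q a b f = ns (- s) (defect p b a f)"
    unfolding 1 by (simp add: ns_simps s)
  then show ?thesis using R.ns[OF assms(4)] by simp
qed

lemma has_par_xg: "has_par 1 (xg i)" and has_par_theta: "has_par 0 theta"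
  by (simp_all add: has_par_def gpo_xg gpo_theta gscale_simps(1))

lemma has_par_co:
  assumes "has_par q b"
  shows "even q \<Longrightarrow> co {i} (fst b) = 0" "odd q \<Longrightarrow> co {} (fst b) = 0"
proof -
  have *: "co S (fst (gpo b)) = (-1) ^ card S * co S (fst b)" for S
    by (simp add: co_def gpo_def parity_op_def)
  have **: "co S (fst (gscale ((-1) ^ q) b)) = (-1) ^ q * co S (fst b)" for S
    by (simp add: co_pair)
  show "even q \<Longrightarrow> co {i} (fst b) = 0" "odd q \<Longrightarrow> co {} (fst b) = 0"
    using *[of "{i}"] **[of "{i}"] *[of "{}"] **[of "{}"] assms
    by (simp_all add: has_par_def neg_eq_iff_add_eq_0 eq_neg_iff_add_eq_0)
qed

lemma R_sum: "(\<And>i. i \<in> A \<Longrightarrow> h i \<in> R) \<Longrightarrow> (\<Sum>i\<in>A. h i) \<in> R"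
  by (induction A rule: infinite_finite_induct) (auto intro: R.add R_0)

lemma defect_sum: "defect q a (\<Sum>i\<in>A. h i) f = (\<Sum>i\<in>A. defect q a (h i) f)"
  by (induction A rule: infinite_finite_induct)
    (simp_all add: defect_linear, simp_all add: defect_def Pi_left_simps Pi_simps gscale_simps)

text \<open>The components in \<open>\<gg>\<^sub><\<^sub>0\<close> are covered by \<open>Pi_Lx_eqv\<close>, so only \<open>\<gg>\<^sub>\<ge>\<^sub>0\<close> has to be checked.\<close>

lemma defect_reduce:
  assumes "\<And>a. defect q (pplus a) (pplus b) f \<in> R" and b: "has_par q b"
  shows "defect q a b f \<in> R"
proof (induction a rule: gvec_induct)
  case (plus a)
  have "defect q (pplus a) (gscale (co {} (fst b)) theta) f \<in> R"
    using has_par_co(2)[OF b] defect_theta[of q "pplus a" f]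
    by (cases "even q") (auto simp: defect_linear ns_simps R_0 intro: R.ns)
  moreover have "defect q (pplus a) (gscale (co {i} (fst b)) (xg i)) f \<in> R" for i
    using has_par_co(1)[OF b, of i] defect_xg[of q "pplus a" i f]
    by (cases "even q") (auto simp: defect_linear ns_simps R_0 intro: R.ns)
  ultimately have "defect q (pplus a)
      (pplus b + gscale (co {} (fst b)) theta + (\<Sum>i\<in>UNIV. gscale (co {i} (fst b)) (xg i))) f \<in> R"
    unfolding defect_linear(2) defect_sum by (intro R.add R_sum assms)
  then show ?case using pplus_decomp[of b] by simp
next
  case theta
  show ?case
    using gbr_theta_left[of b] b defect_theta[of 0 b f]
    by (intro defect_swap[OF has_par_theta]) (auto simp: gscale_simps)
next
  case (xi i)
  have "gbr (xg i) b = gscale (- ((-1) ^ (1 * q))) (gbr b (xg i))"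
    using b by (simp only: gbr_xi_left has_par_def gbr_scale_left gscale_simps mult_1)
  then show ?case
    using b defect_xg[of 1 b i f] by (intro defect_swap[OF has_par_xg]) auto
next
  case (add a a')
  then show ?case by (simp add: defect_linear R.add)
next
  case (scale c a)
  then show ?case by (simp add: defect_linear R.ns)
qed

lemma gpow_gbr: "(gpo ^^ q) (gbr a (xg i)) = gscale ((-1) ^ q) (gbr ((gpo ^^ q) a) (xg i))"
  by (auto simp: gpow_parity gpo_gbr gpo_xg gbr_scale_right gscale_simps(1))

lemma gpow_pplus: "(gpo ^^ q) (pplus a) = pplus ((gpo ^^ q) a)"
  by (simp add: gpow_parity gpo_pplus)

lemma Pi_pplus_Nil: "Pi (pplus a) (single [] v) = single [] (\<rho> (pzero a) v)"
  by (simp add: Pi_single ac_pplus)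

text \<open>On the empty word nonnegative elements act through their degree zero components, so the
  relation becomes the module property of \<open>\<rho>\<close> by way of
  \<open>pplus_pzero_gbr\<close>.\<close>

lemma defect_Nil: "has_par q b \<Longrightarrow> defect q a b (single [] v) \<in> R"
proof (rule defect_reduce)
  fix a
  have "pzero ((gpo ^^ q) a) = pzero a" by (simp add: gpow_parity pzero_gpo)
  moreover have "Pi (gbr (pplus a) (pplus b)) (single [] v)
      = single [] (\<rho> (gbr (pzero a) (pzero b)) v)"
    using Pi_pplus_Nil[of "gbr (pplus a) (pplus b)" v] by (simp only: pplus_pzero_gbr)
  ultimately show "defect q (pplus a) (pplus b) (single [] v) \<in> R"
    by (simp add: defect_def Pi_pplus_Nil gpow_pplus rho_br pzero_gsum single_diff R_0)
qed

lemma Pi_Pi_Lx: "Pi a (Pi b (Lx i f)) \<approx>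
   Pi a (Pi (gbr b (xg i)) f) + Pi (gbr a (xg i)) (Pi (gpo b) f) + Lx i (Pi (gpo a) (Pi (gpo b) f))"
proof -
  have "Pi a (Pi b (Lx i f)) \<approx> Pi a (Pi (gbr b (xg i)) f + Lx i (Pi (gpo b) f))"
    by (intro eqv_Pi Pi_Lx_eqv)
  also have "\<dots> = Pi a (Pi (gbr b (xg i)) f) + Pi a (Lx i (Pi (gpo b) f))"
    by (simp add: Pi_simps)
  also have "\<dots> \<approx> Pi a (Pi (gbr b (xg i)) f) +
      (Pi (gbr a (xg i)) (Pi (gpo b) f) + Lx i (Pi (gpo a) (Pi (gpo b) f)))"
    by (intro eqv_add eqv_refl Pi_Lx_eqv)
  finally show ?thesis by (simp add: add.assoc)
qed

text \<open>Both compositions are moved past xi_i, and the bracket of [a, b] with xi_i is split by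
  the derivation rule. The remainders regroup into defects on the shorter word \<open>f\<close>, the
  first with the parity of its second argument raised by one; this is the induction step of
  \<open>defect_R\<close>.\<close>

lemma defect_Lx:
  assumes "has_par q b"
  shows "defect q a b (Lx i f) \<approx> defect (Suc q) a (gbr b (xg i)) f
    + ns ((-1) ^ q) (defect q (gbr a (xg i)) b f) + Lx i (defect q (gpo a) (gpo b) f)"
proof -
  define s :: complex where "s = (-1) ^ q"
  have s: "s * s = 1" by (simp add: s_def flip: power_add)
  let ?c = "(gpo ^^ q) a"
  have "defect q a b (Lx i f) \<approx>
     (Pi a (Pi (gbr b (xg i)) f) + Pi (gbr a (xg i)) (Pi (gpo b) f) + Lx i (Pi (gpo a) (Pi (gpo b) f)))
    - (Pi b (Pi (gbr ?c (xg i)) f) + Pi (gbr b (xg i)) (Pi (gpo ?c) f) + Lx i (Pi (gpo b) (Pi (gpo ?c) f)))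
    - (Pi (gbr (gbr a b) (xg i)) f + Lx i (Pi (gpo (gbr a b)) f))"
    unfolding defect_def by (intro eqv_diff Pi_Pi_Lx Pi_Lx_eqv)
  moreover have "gpo b = gscale s b" using assms by (simp add: has_par_def s_def)
  moreover have "Pi (gbr (gbr a b) (xg i)) f
      = Pi (gbr a (gbr b (xg i))) f + Pi (gbr (gbr a (xg i)) (gpo b)) f"
    by (simp add: gbr_right_derivation Pi_left_simps)
  ultimately show ?thesis
    unfolding defect_def gpow_gbr funpow.simps o_apply gpo_pow s_def[symmetric]
    by (simp add: gpo_gbr Pi_scale_left gbr_scale_right Pi_ns ns_simps s Lx_simps Lx_ns algebra_simps)
qed

lemma defect_R: "has_par q b \<Longrightarrow> defect q a b f \<in> R"
proof (induction f arbitrary: q a b rule: pm_induct)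
  case (single w v)
  then show ?case
  proof (induction w arbitrary: q a b)
    case Nil
    then show ?case by (rule defect_Nil)
  next
    case (Cons i w)
    have hp: "has_par q (gpo b)"
      using Cons.prems by (simp add: has_par_def gpo_scale)
    have "defect (Suc q) a (gbr b (xg i)) (single w v)
      + ns ((-1) ^ q) (defect q (gbr a (xg i)) b (single w v))
      + Lx i (defect q (gpo a) (gpo b) (single w v)) \<in> R"
      by (intro R.add R.ns R.Lx Cons.IH has_par_br Cons.prems hp)
    then show ?case
      using defect_Lx[OF Cons.prems, of a i "single w v"] eqv_0 eqv_trans
      unfolding Lx_single by blast
  qed
next
  case (add f g)
  then show ?case by (simp add: defect_linear R.add)
qed

end

section \<open>The enveloping algebra and the induced module\<close>

lemma lookup_fscale [simp]: "lookup (fscale c p) k = c * lookup p k"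
  by (simp add: fscale_def Poly_Mapping.map.rep_eq when_def)

lemma fscale_vector_space: "vector_space (fscale :: complex \<Rightarrow> ('a \<Rightarrow>\<^sub>0 complex) \<Rightarrow> _)"
  by standard (rule poly_mapping_eqI; simp add: lookup_add algebra_simps)+

interpretation fs: vector_space "fscale :: complex \<Rightarrow> ('a \<Rightarrow>\<^sub>0 complex) \<Rightarrow> _"
  by (rule fscale_vector_space)

lemma fscale_single: "fscale c (single k d) = single k (c * d)"
  by (rule poly_mapping_eqI) (simp add: lookup_single when_def)

lemma gsum_pos_pzero: "a \<in> gsum {0<..} \<Longrightarrow> pzero a = 0"
proof -
  assume "a \<in> gsum {0<..}"
  then have *: "coeff (fst a S) m \<noteq> 0 \<Longrightarrow> 2 * int m + int (card S) - 2 > 0" "snd a = 0" for S m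
    by (force simp: gsum_def gdegs_def split: if_splits)+
  have "card S = 2 \<Longrightarrow> coeff (fst a S) 0 = 0" "coeff (fst a {}) 1 = 0" for S
    using *(1)[of S 0] *(1)[of "{}" 1] by auto
  then show ?thesis using *(2) by (auto simp: pzero_def zero_prod_def fun_eq_iff)
qed

lemma gsum_nonneg_co: "a \<in> gsum {0..} \<Longrightarrow> card S \<le> 1 \<Longrightarrow> co S (fst a) = 0"
  unfolding gsum_def gdegs_def co_def by (auto simp: subset_iff) force

lemma gsum_0_pzero: "a \<in> gsum {0} \<Longrightarrow> pzero a = a"
proof -
  assume a: "a \<in> gsum {0}"
  then have *: "coeff (fst a S) m \<noteq> 0 \<Longrightarrow> 2 * int m + int (card S) - 2 = 0" for S m
    by (force simp: gsum_def gdegs_def split: if_splits)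
  have "(if card S = 2 then [:coeff (fst a S) 0:] else if S = {} then monom (coeff (fst a S) 1) 1 else 0) = fst a S" for S
  proof (rule poly_eqI)
    fix m
    have "coeff (fst a S) m = 0 \<or> card S = 2 \<and> m = 0 \<or> S = {} \<and> m = 1"
    proof (cases "coeff (fst a S) m = 0")
      case False
      from *[OF this] have "card S = 2 \<and> m = 0 \<or> card S = 0 \<and> m = 1" by presburger
      then show ?thesis by simp
    qed simp
    then show "coeff (if card S = 2 then [:coeff (fst a S) 0:] else if S = {} then monom (coeff (fst a S) 1) 1 else 0) m
        = coeff (fst a S) m"
      by (auto simp: coeff_pCons split: nat.splits)
  qed
  then show ?thesis by (auto simp: pzero_def prod_eq_iff fun_eq_iff)
qed

lemma gsum_mono: "A \<subseteq> B \<Longrightarrow> gsum A \<subseteq> gsum B"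
  by (auto simp: gsum_def)

lemma gsum_pos_nonneg: "a \<in> gsum {0<..} \<Longrightarrow> a \<in> gsum {0..}"
  by (rule subsetD[OF gsum_mono]) auto

section \<open>The map from tensors to words modulo \<open>R\<close>\<close>

context g0_mod
begin

definition W :: "falg \<Rightarrow> (idx list \<Rightarrow>\<^sub>0 'v) \<Rightarrow> (idx list \<Rightarrow>\<^sub>0 'v)" where
  "W x f = lext (\<lambda>as c. ns c (foldr Pi as f)) x"

lemma W_single: "W (single as c) f = ns c (foldr Pi as f)"
  unfolding W_def by (rule lext_single) (simp add: ns_simps)

lemma W_add: "W (x + y) f = W x f + W y f"
  unfolding W_def by (rule lext_add) (simp add: ns_simps)

lemmas W_simps = W_add additive_diff[of "\<lambda>x. W x f" for f, OF W_add]

lemma foldr_Pi: "foldr Pi as (f + g) = foldr Pi as f + foldr Pi as g"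
  "foldr Pi as (ns c f) = ns c (foldr Pi as f)" "f \<in> R \<Longrightarrow> foldr Pi as f \<in> R"
  by (induction as) (simp_all add: Pi_simps Pi_ns Pi_R)

lemma W_add_right: "W x (f + g) = W x f + W x g"
  by (rule additive_eqI) (simp_all add: W_simps W_single foldr_Pi ns_simps)

lemma W_ns: "W x (ns c f) = ns c (W x f)"
  by (rule additive_eqI[of "\<lambda>x. W x (ns c f)" "\<lambda>x. ns c (W x f)"])
    (simp_all add: W_simps W_single foldr_Pi ns_simps mult.commute)

lemma W_R: "f \<in> R \<Longrightarrow> W x f \<in> R"
  by (induction x rule: pm_induct) (simp_all add: W_single W_add R.ns R.add foldr_Pi)

lemma W_mult: "W (x * y) f = W x (W y f)"
proof (induction x rule: pm_induct)
  case (single as c)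
  show ?case
    by (rule additive_eqI[of "\<lambda>y. W (single as c * y) f" "\<lambda>y. W (single as c) (W y f)"])
      (simp_all add: distrib_left W_simps W_add_right mult_single W_single foldr_Pi ns_simps plus_list_def)
next
  case (add x y)
  then show ?case by (simp add: distrib_right W_simps)
qed

lemma W_urels: "r \<in> urels \<Longrightarrow> W r f \<in> R"
proof -
  assume "r \<in> urels"
  then consider a b where "r = fgen (a + b) - fgen a - fgen b"
    | c a where "r = fgen (gscale c a) - fconst c * fgen a"
    | a b p q where "r = fgen a * fgen b - fconst ((-1) ^ (p * q)) * (fgen b * fgen a) - fgen (gbr a b)"
        "a \<in> gpar p" "b \<in> gpar q"
    unfolding urels_def by blast
  then show ?thesis
  proof cases
    case 1
    then show ?thesis by (simp add: W_simps W_single ns_simps Pi_left_simps R_0)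
  next
    case 2
    then show ?thesis by (simp add: W_simps W_mult W_single ns_simps Pi_scale_left R_0)
  next
    case 3
    then have p: "has_par p a" "has_par q b" by (simp_all add: has_par_def gpar_gpo)
    have "W r f = defect q a b f"
      by (simp add: 3(1) W_simps W_mult W_single ns_simps defect_def gpow_has_par[OF p(1)] Pi_scale_left
          Pi_ns)
    then show ?thesis using defect_R[OF p(2)] by simp
  qed
qed

lemma W_uideal: "x \<in> uideal \<Longrightarrow> W x f \<in> R"
proof (induction rule: uideal.induct)
  case zero
  then show ?case by (simp add: W_simps R_0)
next
  case (step x r p q)
  then show ?case by (simp add: W_simps W_mult R.add W_R W_urels)
qed

text \<open>\<open>rep_ug\<close> chooses an arbitrary representative; two choices differ by an
  element of \<open>uideal\<close>, which acts with values in \<open>R\<close>.\<close>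

lemma W_rep: "abs_ug x = u \<Longrightarrow> W (rep_ug u) f \<approx> W x f"
proof -
  assume "abs_ug x = u"
  then have "urel (rep_ug u) x"
    by (metis Quotient3_rel_rep Quotient3_ug Quotient3_rep_abs Quotient3_def equivp_reflp equivp_urel)
  then show ?thesis using W_uideal[of "rep_ug u - x" f]
    by (simp add: urel_def eqv_def W_simps)
qed

lemma abs_rep: "abs_ug (rep_ug u) = u"
  by (rule Quotient3_abs_rep[OF Quotient3_ug])

text \<open>Applies \<open>u\<close> to the empty word with coefficient \<open>v\<close>. The choice
  made by \<open>rep_ug\<close> does not matter modulo \<open>R\<close>, and neither do the tensor
  relations (\<open>T_tensor_rels\<close>), so \<open>T\<close> induces a map on the induced module
  with values in words modulo \<open>R\<close>.\<close>

definition T :: "'v tfree \<Rightarrow> (idx list \<Rightarrow>\<^sub>0 'v)" where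
  "T = lext (\<lambda>(u, v) c. ns c (W (rep_ug u) (single [] v)))"

lemma T_single: "T (single (u, v) c) = ns c (W (rep_ug u) (single [] v))"
  unfolding T_def by (subst lext_single) (auto simp: ns_simps)

lemma T_add: "T (p + q) = T p + T q"
  unfolding T_def by (rule lext_add) (auto simp: ns_simps)

lemmas T_simps = T_add additive_diff[of T, OF T_add]

lemma T_fscale: "T (fscale c p) = ns c (T p)"
  by (rule additive_eqI[of "\<lambda>p. T (fscale c p)" "\<lambda>p. ns c (T p)"])
    (auto simp: fs.scale_right_distrib T_simps ns_simps fscale_single T_single)

lemma Pi_nonneg: "a \<in> gsum {0..} \<Longrightarrow> Pi a (single [] v) = single [] (\<rho> (pzero a) v)"
  by (simp add: Pi_single ac_def gsum_nonneg_co ns_simps)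

lemma T_tensor_rels: "r \<in> tensor_rels sc \<rho> \<Longrightarrow> T r \<in> R"
proof -
  assume "r \<in> tensor_rels sc \<rho>"
  then consider u u' v where "r = (u + u') \<otimes> v - u \<otimes> v - u' \<otimes> v"
    | u v v' where "r = u \<otimes> (v + v') - u \<otimes> v - u \<otimes> v'"
    | c u v where "r = (uconst c * u) \<otimes> v - fscale c (u \<otimes> v)"
    | c u v where "r = u \<otimes> sc c v - fscale c (u \<otimes> v)"
    | u a v where "r = (u * iota a) \<otimes> v - u \<otimes> \<rho> a v" "a \<in> gsum {0}"
    | u a v where "r = (u * iota a) \<otimes> v" "a \<in> gsum {0<..}"
    unfolding tensor_rels_def by blast
  then show ?thesis
  proof cases
    case 1
    have "abs_ug (rep_ug u + rep_ug u') = u + u'"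
      by (simp add: abs_rep plus_ug.abs_eq[symmetric])
    from W_rep[OF this] show ?thesis
      by (simp add: 1 T_simps T_single ns_simps eqv_def W_simps algebra_simps)
  next
    case 2
    then show ?thesis by (simp add: T_simps T_single ns_simps single_add W_add_right R_0)
  next
    case 3
    have "abs_ug (fconst c * rep_ug u) = uconst c * u"
      by (simp add: abs_rep times_ug.abs_eq[symmetric] uconst_def)
    from W_rep[OF this] show ?thesis
      by (simp add: 3 T_simps T_single T_fscale ns_simps eqv_def W_mult W_single)
  next
    case 4
    then show ?thesis by (simp add: T_simps T_single T_fscale ns_simps W_ns R_0 flip: ns_single)
  next
    case 5
    have "abs_ug (rep_ug u * fgen a) = u * iota a"
      by (simp add: abs_rep times_ug.abs_eq[symmetric] iota_def)
    moreover have "a \<in> gsum {0..}" using 5(2) gsum_mono[of "{0}" "{0..}"] by auto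
    ultimately show ?thesis
      using W_rep[of "rep_ug u * fgen a" "u * iota a" "single [] v"] 5(2)
      by (simp add: 5(1) T_simps T_single ns_simps eqv_def W_mult W_single Pi_nonneg gsum_0_pzero)
  next
    case 6
    have "abs_ug (rep_ug u * fgen a) = u * iota a"
      by (simp add: abs_rep times_ug.abs_eq[symmetric] iota_def)
    moreover have "a \<in> gsum {0..}" using 6(2) by (rule gsum_pos_nonneg)
    moreover have "\<rho> 0 v = 0" using rho_add[of 0 0 v] pzero_gsum[of 0] gsum_0_pzero
      by (simp add: gsum_def gdegs_def)
    moreover have "W x 0 = 0" for x using W_ns[of x 0 0] by (simp add: ns_simps)
    ultimately show ?thesis
      using W_rep[of "rep_ug u * fgen a" "u * iota a" "single [] v"] 6(2)
      by (simp add: 6(1) T_simps T_single ns_simps eqv_def W_mult W_single Pi_nonneg gsum_pos_pzero)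
  qed
qed

abbreviation rels :: "'v tfree set" where
  "rels \<equiv> module.span fscale (tensor_rels sc \<rho>)"

lemma T_rels: "p \<in> rels \<Longrightarrow> T p \<in> R"
  by (induction rule: fs.span_induct_alt)
    (auto simp: T_simps T_fscale R_0 intro!: R.add R.ns T_tensor_rels)

text \<open>Modulo \<open>R\<close> the map \<open>T\<close> turns the two kinds of summands into
  words of length one and zero, where elements of \<open>R\<close> have no coefficient. Degree zero
  is included because positive elements send degree one vectors there, and their vanishing must be
  detected too.\<close>

lemma degree_le_1_independent:
  assumes "(\<Sum>i\<in>UNIV. eta i \<otimes> v i) + 1 \<otimes> v0 \<in> rels"
  shows "v i = 0" "v0 = 0"
proof -
  have "T (eta i \<otimes> v) \<approx> single [i] v" for i v
    using W_rep[of "fgen (xg i)" "eta i" "single [] v"]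
    by (simp add: T_single eta_def iota_def ns_simps W_single Pi_xg Lx_single)
  then have e: "T (eta i \<otimes> v) - single [i] v \<in> R" for i v
    by (simp add: eqv_def)
  have "abs_ug (fconst 1) = 1"
    using one_ug.abs_eq by (metis single_one zero_list_def)
  from W_rep[OF this, of "single [] v0"]
  have "T (1 \<otimes> v0) - single [] v0 \<in> R"
    by (simp add: T_single ns_simps W_single eqv_def)
  with e have "(\<Sum>i\<in>UNIV. T (eta i \<otimes> v i) - single [i] (v i)) + (T (1 \<otimes> v0) - single [] v0) \<in> R"
    by (intro R.add R_sum) auto
  moreover have "(\<Sum>i\<in>UNIV. T (eta i \<otimes> v i)) + T (1 \<otimes> v0) \<in> R"
  proof -
    have "T (\<Sum>i\<in>A. eta i \<otimes> v i) = (\<Sum>i\<in>A. T (eta i \<otimes> v i))" for A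
      by (induction A rule: infinite_finite_induct) (simp_all add: T_simps)
    then show ?thesis using T_rels[OF assms] by (simp add: T_simps)
  qed
  ultimately have "((\<Sum>i\<in>UNIV. T (eta i \<otimes> v i)) + T (1 \<otimes> v0))
     - ((\<Sum>i\<in>UNIV. T (eta i \<otimes> v i) - single [i] (v i)) + (T (1 \<otimes> v0) - single [] v0)) \<in> R"
    by (intro R_diff)
  then have r: "(\<Sum>i\<in>UNIV. single [i] (v i)) + single [] v0 \<in> R"
    by (simp add: sum_subtractf add.commute)
  show "v0 = 0" using R_lookup[OF r, of "[]"] by (simp add: lookup_add lookup_sum lookup_single when_def)
  show "v i = 0" using R_lookup[OF r, of "[i]"]
    by (simp add: lookup_add lookup_sum lookup_single when_def)
qed

end

lemma kbr_xi_apply: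
  "kbr f (xi i) U = smult (- rs U {i}) (if i \<in> U then pderiv (f (U - {i})) else f (insert i U))"
proof -
  have r: "i \<notin> V \<Longrightarrow> rs (insert i V) {i} = rs V {i}" for V by (simp add: rs_insert_left)
  show ?thesis
  proof (induction f rule: k14_induct)
    case (kp p S)
    consider "i \<in> S" "i \<in> U" | "i \<in> S" "i \<notin> U" "insert i U = S" | "i \<in> S" "i \<notin> U" "insert i U \<noteq> S"
      | "i \<notin> S" "i \<notin> U" | "i \<notin> S" "i \<in> U" "U - {i} = S" | "i \<notin> S" "i \<in> U" "U - {i} \<noteq> S"
      by blast
    then show ?case
    proof cases
      case 1
      then have "U \<noteq> S - {i}" "U - {i} \<noteq> S" by auto
      then show ?thesis using 1 by (simp add: kbr_kp_xi) (simp add: kp_def)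
    next
      case 2
      then have "U = S - {i}" "rs S {i} = rs U {i}" using r[of U] by auto
      then show ?thesis using 2 by (simp add: kbr_kp_xi) (simp add: kp_def insert_absorb)
    next
      case 3
      then have "U \<noteq> S - {i}" by auto
      then show ?thesis using 3 by (simp add: kbr_kp_xi) (simp add: kp_def)
    next
      case 4
      then have "U \<noteq> insert i S" "insert i U \<noteq> S" by auto
      then show ?thesis using 4 by (simp add: kbr_kp_xi) (simp add: kp_def)
    next
      case 5
      then have "U = insert i S" by auto
      then show ?thesis using 5 r[of S] by (simp add: kbr_kp_xi) (simp add: kp_def)
    next
      case 6
      then have "U \<noteq> insert i S" by auto
      then show ?thesis using 6 by (simp add: kbr_kp_xi) (simp add: kp_def)
    qed
  next
    case (add f g)
    then show ?case
      unfolding kbr_add_left unfolding plus_fun_apply by (simp add: pderiv_add smult_add_right)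
  qed
qed

lemma psi_xi: "psi f (xi i) = rs (- {i}) {i} * co (- {i}) f"
proof (induction f rule: k14_induct)
  case (kp p S)
  have "card (- {i}) = 3" using card_Compl_idx[of "{i}"] by simp
  then show ?case by (auto simp: xi_eq_kp psi_kp co_kp)
next
  case (add f g)
  then show ?case by (simp only: psi_linear co_linear distrib_left)
qed

section \<open>Computation rules in U(\<gg>)\<close>

lemma uconst_commute: "uconst c * u = u * uconst c"
proof -
  have "fconst c * x = x * fconst c" for x :: falg
    by (rule additive_eqI) (simp_all add: distrib_left distrib_right mult_single plus_list_def mult.commute)
  then have "abs_ug (fconst c * rep_ug u) = abs_ug (rep_ug u * fconst c)" by simp
  then show ?thesis
    by (simp add: uconst_def times_ug.abs_eq[symmetric] Quotient3_abs_rep[OF Quotient3_ug])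
qed

lemma urel_abs: "x - y \<in> uideal \<Longrightarrow> abs_ug x = abs_ug y"
  by (metis ug.abs_eq_iff urel_def)

lemma urels_uideal: "r \<in> urels \<Longrightarrow> r \<in> uideal"
  using uideal.step[OF uideal.zero, of r 1 1] by simp

lemma urelsI:
  "fgen (a + b) - fgen a - fgen b \<in> urels" "fgen (gscale c a) - fconst c * fgen a \<in> urels"
  "p \<in> {0, 1} \<Longrightarrow> q \<in> {0, 1} \<Longrightarrow> a \<in> gpar p \<Longrightarrow> b \<in> gpar q \<Longrightarrow>
     fgen a * fgen b - fconst ((-1) ^ (p * q)) * (fgen b * fgen a) - fgen (gbr a b) \<in> urels"
  unfolding urels_def by blast+

lemma iota_add: "iota (a + b) = iota a + iota b"
proof -
  have "abs_ug (fgen (a + b)) = abs_ug (fgen a + fgen b)"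
    using urelsI(1)[of a b] by (intro urel_abs urels_uideal) (simp add: diff_diff_eq)
  then show ?thesis by (simp add: iota_def plus_ug.abs_eq)
qed

lemma iota_scale: "iota (gscale c a) = uconst c * iota a"
proof -
  have "abs_ug (fgen (gscale c a)) = abs_ug (fconst c * fgen a)"
    by (intro urel_abs urels_uideal urelsI)
  then show ?thesis by (simp add: iota_def uconst_def times_ug.abs_eq)
qed

lemma uconst_1: "uconst 1 = 1" and uconst_minus_1: "uconst (- 1) = - 1"
proof -
  have *: "fconst 1 = 1" "fconst (- 1) = - 1"
    by (simp_all add: single_uminus flip: zero_list_def)
  then show "uconst 1 = 1" "uconst (- 1) = - 1"
    by (simp_all add: uconst_def one_ug.abs_eq uminus_ug.abs_eq)
qed

lemma iota_br:
  assumes "p \<in> {0, 1}" "q \<in> {0, 1}" "a \<in> gpar p" "b \<in> gpar q"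
  shows "iota a * iota b = uconst ((-1) ^ (p * q)) * (iota b * iota a) + iota (gbr a b)"
proof -
  have "abs_ug (fgen a * fgen b) = abs_ug (fconst ((-1) ^ (p * q)) * (fgen b * fgen a) + fgen (gbr a b))"
    using urelsI(3)[OF assms] by (intro urel_abs urels_uideal) (simp only: diff_diff_eq)
  then show ?thesis by (simp add: iota_def uconst_def times_ug.abs_eq plus_ug.abs_eq)
qed

text \<open>The relations of U(\<gg>) are given for homogeneous elements, so \<open>a\<close> is
  split into its even and odd part; \<open>gpo\<close> collects the two signs in one
  formula.\<close>

lemma iota_eta: "iota a * eta i = eta i * iota (gpo a) + iota (gbr a (xg i))"
proof -
  define ev od where "ev = ((\<lambda>S. if even (card S) then fst a S else 0), snd a)"
    and "od = ((\<lambda>S. if odd (card S) then fst a S else 0), 0 :: complex)"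
  have a: "a = ev + od" by (auto simp: ev_def od_def prod_eq_iff fun_eq_iff)
  have par: "ev \<in> gpar 0" "od \<in> gpar 1"
    by (auto simp: gpar_def ev_def od_def odd_iff_mod_2_eq_one even_iff_mod_2_eq_zero split: if_splits)
  have x: "xg i \<in> gpar 1" by (auto simp: gpar_def xi_eq_kp kp_def)
  have g: "gpo ev = gscale 1 ev" "gpo od = gscale (- 1) od"
    using gpar_gpo[OF par(1)] gpar_gpo[OF par(2)] by simp_all
  have "iota ev * eta i = eta i * iota (gpo ev) + iota (gbr ev (xg i))"
    using iota_br[OF _ _ par(1) x] by (simp add: eta_def uconst_1 g iota_scale)
  moreover have "iota od * eta i = eta i * iota (gpo od) + iota (gbr od (xg i))"
    using iota_br[OF _ _ par(2) x] by (simp add: eta_def uconst_minus_1 g iota_scale)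
  ultimately show ?thesis
    unfolding a by (simp only: iota_add gpo_add gbr_add_left distrib_left distrib_right add_ac)
qed

lemma lact_eq: "lact u p = lext (\<lambda>k c. single (u * fst k, snd k) c) p"
  by (simp add: lact_def lext_def)

lemma lact_add: "lact u (p + q) = lact u p + lact u q"
  unfolding lact_eq by (rule lext_add) (simp add: single_add)

lemmas lact_simps = lact_add additive_diff[of "lact u" for u, OF lact_add]

lemma lact_single: "lact u (single (u', v) c) = single (u * u', v) c"
  unfolding lact_eq by (subst lext_single) auto

lemma lact_fscale: "lact u (fscale c p) = fscale c (lact u p)"
  by (rule additive_eqI[of "\<lambda>p. lact u (fscale c p)" "\<lambda>p. fscale c (lact u p)"])
    (auto simp: fs.scale_right_distrib lact_simps fscale_single lact_single)

section \<open>Congruence modulo the tensor relations\<close>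

context g0_mod
begin

lemma rels_add: "p \<in> rels \<Longrightarrow> q \<in> rels \<Longrightarrow> p + q \<in> rels" by (rule fs.span_add)
lemma rels_diff: "p \<in> rels \<Longrightarrow> q \<in> rels \<Longrightarrow> p - q \<in> rels" by (rule fs.span_diff)

lemma icls_eq: "icls sc \<rho> p = icls sc \<rho> q \<longleftrightarrow> p - q \<in> rels"
proof
  assume "icls sc \<rho> p = icls sc \<rho> q"
  moreover have "p \<in> icls sc \<rho> p" by (simp add: icls_def fs.span_zero)
  ultimately show "p - q \<in> rels" by (simp add: icls_def)
next
  assume *: "p - q \<in> rels"
  show "icls sc \<rho> p = icls sc \<rho> q"
  proof (intro set_eqI)
    fix r
    show "r \<in> icls sc \<rho> p \<longleftrightarrow> r \<in> icls sc \<rho> q"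
      unfolding icls_def using rels_add[OF _ *, of "r - p"] rels_diff[OF _ *, of "r - q"] by auto
  qed
qed

lemma lact_tensor_rels: "r \<in> tensor_rels sc \<rho> \<Longrightarrow> lact w r \<in> tensor_rels sc \<rho>"
proof -
  assume "r \<in> tensor_rels sc \<rho>"
  then consider u u' v where "r = (u + u') \<otimes> v - u \<otimes> v - u' \<otimes> v"
    | u v v' where "r = u \<otimes> (v + v') - u \<otimes> v - u \<otimes> v'"
    | c u v where "r = (uconst c * u) \<otimes> v - fscale c (u \<otimes> v)"
    | c u v where "r = u \<otimes> sc c v - fscale c (u \<otimes> v)"
    | u a v where "r = (u * iota a) \<otimes> v - u \<otimes> \<rho> a v" "a \<in> gsum {0}"
    | u a v where "r = (u * iota a) \<otimes> v" "a \<in> gsum {0<..}"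
    unfolding tensor_rels_def by blast
  then show ?thesis
  proof cases
    case (1 u u' v)
    have "lact w r = (w * u + w * u') \<otimes> v - (w * u) \<otimes> v - (w * u') \<otimes> v"
      by (simp add: 1 lact_simps lact_single distrib_left)
    then show ?thesis unfolding tensor_rels_def by blast
  next
    case (2 u v v')
    have "lact w r = (w * u) \<otimes> (v + v') - (w * u) \<otimes> v - (w * u) \<otimes> v'"
      by (simp add: 2 lact_simps lact_single)
    then show ?thesis unfolding tensor_rels_def by blast
  next
    case (3 c u v)
    have "w * (uconst c * u) = uconst c * (w * u)"
      by (metis mult.assoc uconst_commute)
    then have "lact w r = (uconst c * (w * u)) \<otimes> v - fscale c ((w * u) \<otimes> v)"
      by (simp add: 3 lact_simps lact_single lact_fscale)
    then show ?thesis unfolding tensor_rels_def by blast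
  next
    case (4 c u v)
    have "lact w r = (w * u) \<otimes> sc c v - fscale c ((w * u) \<otimes> v)"
      by (simp add: 4 lact_simps lact_single lact_fscale)
    then show ?thesis unfolding tensor_rels_def by blast
  next
    case (5 u a v)
    have "lact w r = ((w * u) * iota a) \<otimes> v - (w * u) \<otimes> \<rho> a v"
      by (simp add: 5(1) lact_simps lact_single mult.assoc)
    then show ?thesis using 5(2) unfolding tensor_rels_def by blast
  next
    case (6 u a v)
    have "lact w r = ((w * u) * iota a) \<otimes> v"
      by (simp add: 6(1) lact_simps lact_single mult.assoc)
    then show ?thesis using 6(2) unfolding tensor_rels_def by blast
  qed
qed

lemma lact_rels: "p \<in> rels \<Longrightarrow> lact u p \<in> rels"
proof (induction rule: fs.span_induct_alt)
  case base
  then show ?case by (simp add: lact_simps fs.span_zero)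
next
  case (step c x y)
  have "fscale c (lact u x) + lact u y \<in> rels"
    by (rule rels_add[OF fs.span_scale[OF fs.span_base[OF lact_tensor_rels[OF step(1)]]] step(2)])
  then show ?case by (simp add: lact_simps lact_fscale)
qed

text \<open>Left multiplication preserves the relations, so all representatives in the union
  defining \<open>ind_act\<close> yield the same coset.\<close>

lemma ind_act_icls: "ind_act sc \<rho> u (icls sc \<rho> p) = icls sc \<rho> (lact u p)"
proof -
  have "icls sc \<rho> (lact u q) = icls sc \<rho> (lact u p)" if "q \<in> icls sc \<rho> p" for q
  proof -
    have "q - p \<in> rels" using that by (simp add: icls_def)
    from lact_rels[OF this] show ?thesis by (simp add: icls_eq lact_simps)
  qed
  moreover have "p \<in> icls sc \<rho> p" by (simp add: icls_def fs.span_zero)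
  ultimately show ?thesis unfolding ind_act_def by blast
qed

definition ceq :: "'v tfree \<Rightarrow> 'v tfree \<Rightarrow> bool" (infix "\<doteq>" 50) where
  "p \<doteq> q \<longleftrightarrow> p - q \<in> rels"

lemma ceq_refl [simp]: "p \<doteq> p" by (simp add: ceq_def fs.span_zero)

lemma ceq_sym: "p \<doteq> q \<Longrightarrow> q \<doteq> p" using fs.span_neg[of "p - q"] by (simp add: ceq_def)

lemma ceq_trans [trans]: "p \<doteq> q \<Longrightarrow> q \<doteq> r \<Longrightarrow> p \<doteq> r"
  using rels_add[of "p - q" "q - r"] by (simp add: ceq_def)

lemma ceq_add: "p \<doteq> q \<Longrightarrow> p' \<doteq> q' \<Longrightarrow> p + p' \<doteq> q + q'"
  using rels_add[of "p - q" "p' - q'"] by (simp add: ceq_def algebra_simps)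

lemma ceq_diff: "p \<doteq> q \<Longrightarrow> p' \<doteq> q' \<Longrightarrow> p - p' \<doteq> q - q'"
  using rels_diff[of "p - q" "p' - q'"] by (simp add: ceq_def algebra_simps)

lemma ceq_fscale: "p \<doteq> q \<Longrightarrow> fscale c p \<doteq> fscale c q"
  using fs.span_scale[of "p - q" _ c] by (simp add: ceq_def fs.scale_right_diff_distrib)

lemma ceq_sum: "(\<And>i. i \<in> A \<Longrightarrow> p i \<doteq> q i) \<Longrightarrow> (\<Sum>i\<in>A. p i) \<doteq> (\<Sum>i\<in>A. q i)"
  by (induction A rule: infinite_finite_induct) (auto intro: ceq_add)

lemma icls_ceq: "icls sc \<rho> p = icls sc \<rho> q \<longleftrightarrow> p \<doteq> q"
  by (simp add: icls_eq ceq_def)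

lemma tens_simps: "(u + u') \<otimes> v \<doteq> u \<otimes> v + u' \<otimes> v" "u \<otimes> (v + v') \<doteq> u \<otimes> v + u \<otimes> v'"
  "(uconst c * u) \<otimes> v \<doteq> fscale c (u \<otimes> v)" "u \<otimes> sc c v \<doteq> fscale c (u \<otimes> v)"
  "a \<in> gsum {0} \<Longrightarrow> (u * iota a) \<otimes> v \<doteq> u \<otimes> \<rho> a v"
  "a \<in> gsum {0<..} \<Longrightarrow> (u * iota a) \<otimes> v \<doteq> 0"
  unfolding ceq_def
  by (rule fs.span_base; unfold tensor_rels_def diff_diff_eq[symmetric] diff_zero; blast)+

lemma tens_0: "u \<otimes> (0 :: 'v) \<doteq> 0" "(0 :: ug) \<otimes> v \<doteq> 0"
  using tens_simps(2)[of u 0 0] tens_simps(1)[of 0 0 v] fs.span_neg[of "- (u \<otimes> (0::'v))"] fs.span_neg[of "- (0 \<otimes> v)"]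
  by (simp_all add: ceq_def)

lemma tens_sum: "u \<otimes> (\<Sum>i\<in>A. h i) \<doteq> (\<Sum>i\<in>A. u \<otimes> h i)"
proof (induction A rule: infinite_finite_induct)
  case (insert x F)
  then show ?case using ceq_trans[OF tens_simps(2) ceq_add[OF ceq_refl insert(3)]] by simp
qed (simp_all add: tens_0)

end

section \<open>The degree one component of the induced module\<close>

lemma gbr_xi_gsum:
  assumes a: "a \<in> gsum D" and D: "\<And>d. d + 1 \<in> D \<Longrightarrow> d \<in> D'"
  shows "gbr a (xg i) \<in> gsum D'"
proof -
  have *: "coeff (fst a S) m \<noteq> 0 \<Longrightarrow> 2 * int m + int (card S) - 2 \<in> D" for S m
    using a by (auto simp: gsum_def gdegs_def)
  have "2 * int m + int (card U) - 2 \<in> D'" if "coeff (fst (gbr a (xg i)) U) m \<noteq> 0" for U m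
  proof (cases "i \<in> U")
    case True
    then have "card U = Suc (card (U - {i}))" by (metis card_Suc_Diff1 finite)
    moreover from True that have "coeff (fst a (U - {i})) (Suc m) \<noteq> 0"
      by (auto simp: gbr_def kbr_xi_apply coeff_pderiv)
    ultimately show ?thesis using *[of "U - {i}" "Suc m"] by (intro D) (simp add: algebra_simps)
  next
    case False
    with that have "coeff (fst a (insert i U)) m \<noteq> 0" by (auto simp: gbr_def kbr_xi_apply)
    then show ?thesis using *[of "insert i U" m] False by (intro D) (simp add: algebra_simps)
  qed
  moreover have "0 \<in> D'" if "snd (gbr a (xg i)) \<noteq> 0"
  proof -
    have "coeff (fst a (- {i})) 0 \<noteq> 0" using that by (auto simp: gbr_def psi_xi co_def)
    then show ?thesis using *[of "- {i}" 0] card_Compl_idx[of "{i}"] by (intro D) simp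
  qed
  ultimately show ?thesis by (auto simp: gsum_def gdegs_def)
qed

lemma gpo_gsum: "a \<in> gsum D \<Longrightarrow> gpo a \<in> gsum D"
  by (auto simp: gsum_def gdegs_def gpo_def parity_op_def)

lemma xg_gsum: "xg i \<in> gsum {- 1}"
  by (auto simp: gsum_def gdegs_def xi_eq_kp kp_def coeff_1 split: if_splits)

lemma iota_0: "iota 0 = 0"
  using iota_add[of 0 0] by simp

lemma pzero_rest: "b \<in> gsum {0..} \<Longrightarrow> b - pzero b \<in> gsum {0<..}"
proof -
  assume b: "b \<in> gsum {0..}"
  have *: "2 * int m + int (card S) - 2 \<ge> 0" if "coeff (fst b S) m \<noteq> 0" for S m
    using b that by (force simp: gsum_def gdegs_def)
  have "2 * int m + int (card S) - 2 > 0" if ne: "coeff (fst (b - pzero b) S) m \<noteq> 0" for S m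
  proof (rule ccontr)
    assume "\<not> ?thesis"
    moreover have "coeff (fst b S) m \<noteq> 0 \<or> 2 * int m + int (card S) - 2 = 0"
      using ne by (auto simp: pzero_def coeff_pCons split: if_splits nat.splits)
    ultimately have "2 * int m + int (card S) - 2 = 0" using *[of S m] by linarith
    then have "card S = 2 \<and> m = 0 \<or> card S = 0 \<and> m = 1" by presburger
    then show False using ne by (auto simp: pzero_def)
  qed
  then show ?thesis by (auto simp: gsum_def gdegs_def) (auto simp: pzero_def)
qed

lemma gsum_m1_decomp: "b \<in> gsum {- 1} \<Longrightarrow> b = (\<Sum>j\<in>UNIV. gscale (co {j} (fst b)) (xg j))"
proof -
  assume b: "b \<in> gsum {- 1}"
  have *: "2 * int m + int (card S) - 2 = - 1" if "coeff (fst b S) m \<noteq> 0" for S m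
    using b that by (force simp: gsum_def gdegs_def)
  have s: "snd b = 0" using b by (auto simp: gsum_def gdegs_def split: if_splits)
  have "coeff (fst (pplus b) S) m = 0" for S m
  proof (rule ccontr)
    assume ne: "coeff (fst (pplus b) S) m \<noteq> 0"
    have "coeff (fst b S) m \<noteq> 0" "card S \<le> 1 \<Longrightarrow> m \<noteq> 0"
      using ne by (auto simp: pplus_def coeff_pCons split: if_splits nat.splits)
    with *[of S m] show False by (cases "card S \<le> 1") auto
  qed
  then have "pplus b = 0" using s by (auto simp: prod_eq_iff fun_eq_iff poly_eq_iff) (simp add: pplus_def)
  moreover have "co {} (fst b) = 0" using *[of "{}" 0] by (auto simp: co_def)
  ultimately show ?thesis using pplus_decomp[of b] by (simp add: gscale_simps)
qed

lemma gpo_gsum_0: "a \<in> gsum {0} \<Longrightarrow> gpo a = a"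
proof -
  assume a: "a \<in> gsum {0}"
  have "smult ((-1) ^ card S) (fst a S) = fst a S" for S
  proof (rule poly_eqI)
    fix m
    have "even (card S)" if "coeff (fst a S) m \<noteq> 0"
    proof -
      have "2 * int m + int (card S) - 2 = 0"
        using a that by (force simp: gsum_def gdegs_def)
      then show ?thesis by presburger
    qed
    then show "coeff (smult ((-1) ^ card S) (fst a S)) m = coeff (fst a S) m"
      by (cases "coeff (fst a S) m = 0") auto
  qed
  then show ?thesis by (simp add: gpo_def parity_op_def prod_eq_iff)
qed

text \<open>Every letter has degree at most -1, so the length of a word is bounded by minus its
  total degree; total degree -1 leaves a single letter.\<close>

lemma neg_words_1: "neg_words 1 = {iota a | a. a \<in> gsum {- 1}}"
proof (intro equalityI subsetI)
  fix u assume "u \<in> neg_words 1"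
  then obtain as js where u: "u = prod_list (map iota as)"
    "list_all2 (\<lambda>a j. j < 0 \<and> a \<in> gsum {j}) as js" "sum_list js = - 1"
    by (auto simp: neg_words_def)
  have le: "sum_list js \<le> - int (length js)" if "list_all2 (\<lambda>a j. j < 0 \<and> a \<in> gsum {j}) as js"
    for as :: "gvec list" and js
    using that by (induction rule: list_all2_induct) auto
  from u(2) show "u \<in> {iota a | a. a \<in> gsum {- 1}}"
  proof (cases js)
    case Nil
    then show ?thesis using u(3) by simp
  next
    case (Cons j js')
    then obtain a as' where as: "as = a # as'" "j < 0" "a \<in> gsum {j}"
      "list_all2 (\<lambda>a j. j < 0 \<and> a \<in> gsum {j}) as' js'"
      using u(2) by (auto simp: list_all2_Cons2)
    then have "js' = []" using le[of as' js'] u(3) Cons by (cases js') auto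
    then have "u = iota a" "a \<in> gsum {- 1}" using Cons as u by auto
    then show ?thesis by blast
  qed
next
  fix u assume "u \<in> {iota a | a. a \<in> gsum {- 1}}"
  then obtain a where a: "u = iota a" "a \<in> gsum {- 1}" by blast
  then show "u \<in> neg_words 1"
    unfolding neg_words_def by (intro CollectI exI[of _ "[a]"] exI[of _ "[- 1]"]) simp
qed

lemma fscale_sum: "fscale c (\<Sum>i\<in>A. p i) = (\<Sum>i\<in>A. fscale c (p i))"
  by (rule fs.scale_sum_right)

context g0_mod
begin

lemma tens_iota_nonneg: "b \<in> gsum {0..} \<Longrightarrow> iota b \<otimes> v \<doteq> 1 \<otimes> \<rho> (pzero b) v"
proof -
  assume b: "b \<in> gsum {0..}"
  have "iota b = 1 * iota (pzero b) + 1 * iota (b - pzero b)"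
    by (simp flip: iota_add)
  then have "iota b \<otimes> v \<doteq> (1 * iota (pzero b)) \<otimes> v + (1 * iota (b - pzero b)) \<otimes> v"
    by (simp only: tens_simps(1))
  also have "\<dots> \<doteq> 1 \<otimes> \<rho> (pzero b) v + 0"
    by (intro ceq_add tens_simps pzero_gsum pzero_rest b)
  finally show ?thesis by simp
qed

lemma tens_iota_m1: "b \<in> gsum {- 1} \<Longrightarrow> iota b \<otimes> v \<doteq> (\<Sum>j\<in>UNIV. eta j \<otimes> sc (co {j} (fst b)) v)"
proof -
  assume b: "b \<in> gsum {- 1}"
  have "iota (\<Sum>j\<in>A. gscale (h j) (xg j)) \<otimes> v \<doteq> (\<Sum>j\<in>A. eta j \<otimes> sc (h j) v)" for A and h :: "idx \<Rightarrow> complex"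
  proof (induction A rule: infinite_finite_induct)
    case (insert x F)
    have "iota (\<Sum>j\<in>insert x F. gscale (h j) (xg j)) = uconst (h x) * eta x + iota (\<Sum>j\<in>F. gscale (h j) (xg j))"
      unfolding sum.insert[OF insert(1,2)] by (simp add: iota_add iota_scale eta_def)
    then have "iota (\<Sum>j\<in>insert x F. gscale (h j) (xg j)) \<otimes> v \<doteq>
       (uconst (h x) * eta x) \<otimes> v + iota (\<Sum>j\<in>F. gscale (h j) (xg j)) \<otimes> v"
      by (simp only: tens_simps(1))
    also have "\<dots> \<doteq> eta x \<otimes> sc (h x) v + (\<Sum>j\<in>F. eta j \<otimes> sc (h j) v)"
      by (intro ceq_add insert(3) ceq_trans[OF tens_simps(3) ceq_sym[OF tens_simps(4)]])
    finally show ?case unfolding sum.insert[OF insert(1,2)] .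
  qed (simp_all add: iota_0 tens_0)
  from this[of "\<lambda>j. co {j} (fst b)" UNIV] gsum_m1_decomp[OF b] show ?thesis by simp
qed

definition hat :: "(idx \<Rightarrow> 'v) \<Rightarrow> 'v tfree" where
  "hat v = (\<Sum>i\<in>UNIV. eta i \<otimes> v i)"

lemma hat_add: "hat v + hat w \<doteq> hat (\<lambda>i. v i + w i)"
  unfolding hat_def sum.distrib[symmetric] by (intro ceq_sum ceq_sym[OF tens_simps(2)])

lemma hat_scale: "fscale c (hat v) \<doteq> hat (\<lambda>i. sc c (v i))"
  unfolding hat_def fscale_sum by (intro ceq_sum ceq_sym[OF tens_simps(4)])

lemma hat_eq_0_iff: "hat v \<doteq> 0 \<longleftrightarrow> (\<forall>i. v i = 0)"
proof
  assume "hat v \<doteq> 0"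
  from ceq_add[OF this tens_0(1)[of 1]]
  have "(\<Sum>i\<in>UNIV. eta i \<otimes> v i) + 1 \<otimes> 0 \<in> rels" by (simp add: hat_def ceq_def)
  then show "\<forall>i. v i = 0" using degree_le_1_independent by blast
next
  assume "\<forall>i. v i = 0"
  then have "hat v \<doteq> (\<Sum>i\<in>(UNIV :: idx set). 0)" unfolding hat_def by (intro ceq_sum) (simp add: tens_0)
  then show "hat v \<doteq> 0" by simp
qed

lemma tens_1_eq_0_iff: "1 \<otimes> v \<doteq> 0 \<longleftrightarrow> v = 0"
proof
  assume *: "1 \<otimes> v \<doteq> 0"
  have "(\<Sum>i\<in>(UNIV :: idx set). eta i \<otimes> (0 :: 'v)) \<doteq> (\<Sum>i\<in>(UNIV :: idx set). 0)"
    by (intro ceq_sum tens_0)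
  from ceq_add[OF this *] have "(\<Sum>i\<in>UNIV. eta i \<otimes> ((\<lambda>_. 0) i)) + 1 \<otimes> v \<in> rels" by (simp add: ceq_def)
  then show "v = 0" by (rule degree_le_1_independent(2))
qed (simp add: tens_0)

lemma lact_hat_eq: "lact (iota a) (hat v) \<doteq>
   (\<Sum>i\<in>UNIV. (eta i * iota (gpo a)) \<otimes> v i) + (\<Sum>i\<in>UNIV. iota (gbr a (xg i)) \<otimes> v i)"
proof -
  have "lact (iota a) (\<Sum>i\<in>A. eta i \<otimes> v i) = (\<Sum>i\<in>A. (iota a * eta i) \<otimes> v i)" for A
    by (induction A rule: infinite_finite_induct) (simp_all add: lact_simps lact_single)
  then have "lact (iota a) (hat v) = (\<Sum>i\<in>UNIV. (eta i * iota (gpo a) + iota (gbr a (xg i))) \<otimes> v i)"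
    by (simp add: hat_def iota_eta)
  then show ?thesis unfolding sum.distrib[symmetric] by (simp add: ceq_sum tens_simps)
qed

text \<open>Moving \<open>a\<close> past a generator leaves two terms: the one with
  \<open>gpo a\<close> next to F vanishes as \<open>gpo a\<close> is still positive, and the bracket
  has nonnegative degree, so only its degree zero component acts.\<close>

lemma lact_hat_pos:
  assumes a: "a \<in> gsum {0<..}"
  shows "lact (iota a) (hat v) \<doteq> 1 \<otimes> (\<Sum>i\<in>UNIV. \<rho> (pzero (gbr a (xg i))) (v i))"
proof -
  have "lact (iota a) (hat v) \<doteq> (\<Sum>i\<in>(UNIV :: idx set). 0) + (\<Sum>i\<in>UNIV. 1 \<otimes> \<rho> (pzero (gbr a (xg i))) (v i))"
    by (rule ceq_trans[OF lact_hat_eq])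
      (intro ceq_add ceq_sum tens_simps tens_iota_nonneg gbr_xi_gsum[OF a] gpo_gsum a, auto)
  also have "\<dots> \<doteq> 1 \<otimes> (\<Sum>i\<in>UNIV. \<rho> (pzero (gbr a (xg i))) (v i))"
    using ceq_sym[OF tens_sum] by simp
  finally show ?thesis .
qed

text \<open>The tensor product rule: \<open>a\<close> acts on F through \<open>\<rho>\<close> and on
  the generators by its adjoint matrix, as the bracket of \<open>a\<close> with a generator has
  degree -1.\<close>

lemma lact_hat_0:
  assumes a: "a \<in> gsum {0}"
  shows "lact (iota a) (hat v) \<doteq>
    hat (\<lambda>j. \<rho> a (v j) + (\<Sum>i\<in>UNIV. sc (co {j} (fst (gbr a (xg i)))) (v i)))"
proof -
  have "lact (iota a) (hat v) \<doteq> (\<Sum>j\<in>UNIV. eta j \<otimes> \<rho> a (v j)) +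
      (\<Sum>i\<in>UNIV. \<Sum>j\<in>UNIV. eta j \<otimes> sc (co {j} (fst (gbr a (xg i)))) (v i))"
    by (rule ceq_trans[OF lact_hat_eq])
      (intro ceq_add ceq_sum tens_simps tens_iota_m1 gbr_xi_gsum[OF a], auto simp: gpo_gsum_0[OF a] tens_simps a)
  also have "(\<Sum>i\<in>UNIV. \<Sum>j\<in>UNIV. eta j \<otimes> sc (co {j} (fst (gbr a (xg i)))) (v i))
    = (\<Sum>j\<in>UNIV. \<Sum>i\<in>UNIV. eta j \<otimes> sc (co {j} (fst (gbr a (xg i)))) (v i))"
    by (rule sum.swap)
  also have "(\<Sum>j\<in>UNIV. eta j \<otimes> \<rho> a (v j)) + \<dots> \<doteq>
     hat (\<lambda>j. \<rho> a (v j)) + hat (\<lambda>j. \<Sum>i\<in>UNIV. sc (co {j} (fst (gbr a (xg i)))) (v i))"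
    unfolding hat_def by (intro ceq_add ceq_refl ceq_sum ceq_sym[OF tens_sum])
  also have "\<dots> \<doteq> hat (\<lambda>j. \<rho> a (v j) + (\<Sum>i\<in>UNIV. sc (co {j} (fst (gbr a (xg i)))) (v i)))"
    by (rule hat_add)
  finally show ?thesis .
qed

lemma ceq_0_cong: "p \<doteq> q \<Longrightarrow> p \<doteq> 0 \<longleftrightarrow> q \<doteq> 0"
  using ceq_trans ceq_sym by blast

lemma ind_act_pos_iff: "a \<in> gsum {0<..} \<Longrightarrow> ind_act sc \<rho> (iota a) (icls sc \<rho> (hat v)) = icls sc \<rho> 0 \<longleftrightarrow>
    (\<Sum>i\<in>UNIV. \<rho> (pzero (gbr a (xg i))) (v i)) = 0"
  by (simp only: ind_act_icls icls_ceq ceq_0_cong[OF lact_hat_pos] tens_1_eq_0_iff)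

lemma ind_act_0_iff: "a \<in> gsum {0} \<Longrightarrow> ind_act sc \<rho> (iota a) (icls sc \<rho> (hat v)) = icls sc \<rho> 0 \<longleftrightarrow>
    (\<forall>j. \<rho> a (v j) + (\<Sum>i\<in>UNIV. sc (co {j} (fst (gbr a (xg i)))) (v i)) = 0)"
  by (simp only: ind_act_icls icls_ceq ceq_0_cong[OF lact_hat_0] hat_eq_0_iff)

lemma Ind_deg_1_iff: "M \<in> Ind_deg sc \<rho> 1 \<longleftrightarrow> (\<exists>v. M = icls sc \<rho> (hat v))"
proof
  assume "M \<in> Ind_deg sc \<rho> 1"
  then obtain p where M: "M = icls sc \<rho> p" and p: "p \<in> module.span fscale {u \<otimes> v | u v. u \<in> neg_words 1}"
    by (auto simp: Ind_deg_def)
  from p have "\<exists>v. p \<doteq> hat v"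
  proof (induction rule: fs.span_induct_alt)
    case base
    have "0 \<doteq> hat (\<lambda>_. 0)" by (rule ceq_sym) (simp add: hat_eq_0_iff)
    then show ?case by blast
  next
    case (step c x y)
    obtain b v where x: "x = iota b \<otimes> v" "b \<in> gsum {- 1}"
      using step(1) neg_words_1 by auto
    then have "x \<doteq> hat (\<lambda>j. sc (co {j} (fst b)) v)" unfolding hat_def x(1) by (intro tens_iota_m1)
    from ceq_trans[OF ceq_fscale[OF this] hat_scale]
    obtain w where w: "fscale c x \<doteq> hat w" by blast
    from step(2) obtain w' where "y \<doteq> hat w'" by blast
    from ceq_trans[OF ceq_add[OF w this] hat_add] show ?case by blast
  qed
  then show "\<exists>v. M = icls sc \<rho> (hat v)" using M icls_ceq by blast
next
  assume "\<exists>v. M = icls sc \<rho> (hat v)"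
  then obtain v where "M = icls sc \<rho> (hat v)" by blast
  moreover have "hat v \<in> module.span fscale {u \<otimes> v | u v. u \<in> neg_words 1}"
    unfolding hat_def eta_def neg_words_1 by (intro fs.span_sum fs.span_base) (use xg_gsum in blast)
  ultimately show "M \<in> Ind_deg sc \<rho> 1" by (auto simp: Ind_deg_def)
qed

text \<open>Functionals turn identities in \<open>F\<close> into identities of complex numbers, where
  \<open>algebra_simps\<close> applies.\<close>

lemma functional_eqI:
  assumes "\<And>\<phi>. (\<And>u v. \<phi> (u + v) = \<phi> u + \<phi> v) \<Longrightarrow> (\<And>c v. \<phi> (sc c v) = c * \<phi> v) \<Longrightarrow> \<phi> x = (\<phi> y :: complex)"
  shows "x = y"
proof (rule ccontr)
  assume "x \<noteq> y"
  interpret c: vector_space "(*) :: complex \<Rightarrow> complex \<Rightarrow> complex"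
    by standard (simp_all add: algebra_simps)
  interpret vp: vector_space_pair sc "(*) :: complex \<Rightarrow> complex \<Rightarrow> complex" ..
  have "independent {x - y}" using \<open>x \<noteq> y\<close> by (simp add: dependent_single)
  from vp.linear_independent_extend[OF this, of "\<lambda>_. 1"]
  obtain g where g: "Vector_Spaces.linear sc (*) g" "g (x - y) = 1" by auto
  then interpret g: Vector_Spaces.linear sc "(*)" g by simp
  have "g x = g y" by (intro assms g.add g.scale)
  then show False using g(2) g.diff[of x y] by simp
qed

end

section \<open>The subalgebra of degree zero\<close>

text \<open>Symmetric in its arguments: the basis monomial with increasing indices rather than the
  product of xi_i and xi_j, which would change sign.\<close>

definition Xg :: "idx \<Rightarrow> idx \<Rightarrow> gvec" where
  "Xg i j = emb (kp 1 {i, j})"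

lemma xi2_eq: "pos i < pos j \<Longrightarrow> xi2 i j = kp 1 {i, j}"
proof -
  assume "pos i < pos j"
  then have "i \<noteq> j" "rs {i} {j} = 1" by (auto simp: reorder_sign_prod sg_def)
  then show ?thesis by (simp add: xi_eq_kp kmult_kp insert_commute one_pCons)
qed

lemma g_expand:
  "g_h_x = gscale (- \<i>) (Xg I1 I2) + gscale \<i> (Xg I3 I4)"
  "g_h_y = gscale (- \<i>) (Xg I1 I2) + gscale (- \<i>) (Xg I3 I4)"
  "g_e_x = gscale (- 1/2) (Xg I1 I3) + gscale (- 1/2) (Xg I2 I4) + gscale (- \<i>/2) (Xg I1 I4) + gscale (\<i>/2) (Xg I2 I3)"
  "g_f_x = gscale (1/2) (Xg I1 I3) + gscale (1/2) (Xg I2 I4) + gscale (- \<i>/2) (Xg I1 I4) + gscale (\<i>/2) (Xg I2 I3)"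
  "g_e_y = gscale (- 1/2) (Xg I1 I3) + gscale (1/2) (Xg I2 I4) + gscale (\<i>/2) (Xg I1 I4) + gscale (\<i>/2) (Xg I2 I3)"
  "g_f_y = gscale (1/2) (Xg I1 I3) + gscale (- 1/2) (Xg I2 I4) + gscale (\<i>/2) (Xg I1 I4) + gscale (\<i>/2) (Xg I2 I3)"
  by (simp_all add: g_h_x_def g_h_y_def g_e_x_def g_f_x_def g_e_y_def g_f_y_def xi2_eq Xg_def gscale_def
      kscale_def fun_eq_iff smult_add_right smult_diff_right)

lemma gsum_add: "a \<in> gsum D \<Longrightarrow> b \<in> gsum D \<Longrightarrow> a + b \<in> gsum D"
proof -
  assume ab: "a \<in> gsum D" "b \<in> gsum D"
  have "2 * int m + int (card S) - 2 \<in> D" if "coeff (fst (a + b) S) m \<noteq> 0" for S m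
  proof -
    have "coeff (fst a S) m \<noteq> 0 \<or> coeff (fst b S) m \<noteq> 0" using that by auto
    then show ?thesis using ab unfolding gsum_def gdegs_def by blast
  qed
  moreover have "0 \<in> D" if "snd (a + b) \<noteq> 0"
  proof -
    have "snd a \<noteq> 0 \<or> snd b \<noteq> 0" using that by auto
    then show ?thesis using ab by (auto simp: gsum_def gdegs_def split: if_splits)
  qed
  ultimately show ?thesis unfolding gsum_def gdegs_def by auto
qed

lemma gsum_scale: "a \<in> gsum D \<Longrightarrow> gscale c a \<in> gsum D"
  by (auto simp: gsum_def gdegs_def gscale_def kscale_def split: if_splits)

lemma Xg_gsum: "i \<noteq> j \<Longrightarrow> Xg i j \<in> gsum {0}"
  by (auto simp: Xg_def gsum_def gdegs_def kp_def coeff_1 split: if_splits)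

lemma g_gsum: "g_h_x \<in> gsum {0}" "g_h_y \<in> gsum {0}" "g_e_x \<in> gsum {0}" "g_f_x \<in> gsum {0}"
  "g_e_y \<in> gsum {0}" "g_f_y \<in> gsum {0}" "g_t \<in> gsum {0}" "g_C \<in> gsum {0}"
proof -
  show "g_h_x \<in> gsum {0}" "g_h_y \<in> gsum {0}" "g_e_x \<in> gsum {0}" "g_f_x \<in> gsum {0}"
    "g_e_y \<in> gsum {0}" "g_f_y \<in> gsum {0}"
    unfolding g_expand by (intro gsum_add gsum_scale Xg_gsum; simp)+
  show "g_t \<in> gsum {0}" by (auto simp: g_t_def gsum_def gdegs_def kmon_def split: if_splits)
  show "g_C \<in> gsum {0}" by (auto simp: g_C_def gsum_def gdegs_def)
qed

lemma Compl_idx: "- {I1} = {I2, I3, I4}" "- {I2} = {I1, I3, I4}" "- {I3} = {I1, I2, I4}" "- {I4} = {I1, I2, I3}"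
  using idx.exhaust by auto

lemma psi_pairs: "card S = 2 \<Longrightarrow> psi (kp p S) (kp q T) = 0"
  by (simp add: psi_kp)

lemma Xg_br_0: "i \<noteq> j \<Longrightarrow> gbr (Xg i j) (Xg i j) = 0"
  "i \<noteq> j \<Longrightarrow> k \<noteq> l \<Longrightarrow> {i, j} \<inter> {k, l} = {} \<Longrightarrow> gbr (Xg i j) (Xg k l) = 0"
  by (simp_all add: Xg_def gbr_def psi_pairs kbr_kp_zero[of i _ _ j] kbr_kp_disjoint zero_prod_def)

lemma Xg_swap: "Xg j i = Xg i j"
  by (simp add: Xg_def insert_commute)

lemma Xg_br_1:
  assumes "i \<noteq> j" "i \<noteq> k" "j \<noteq> k"
  shows "gbr (Xg i j) (Xg i k) = gscale (- rs {i, j} {i, k}) (Xg j k)"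
    "gbr (Xg i j) (Xg k i) = gscale (- rs {i, j} {i, k}) (Xg j k)"
    "gbr (Xg j i) (Xg i k) = gscale (- rs {i, j} {i, k}) (Xg j k)"
    "gbr (Xg j i) (Xg k i) = gscale (- rs {i, j} {i, k}) (Xg j k)"
proof -
  have "{i, j} \<inter> {i, k} = {i}" "({i, j} - {i}) \<union> ({i, k} - {i}) = {j, k}" using assms by auto
  then show "gbr (Xg i j) (Xg i k) = gscale (- rs {i, j} {i, k}) (Xg j k)"
    using assms by (simp add: Xg_def gbr_def psi_pairs kbr_kp_single[of _ _ i] gscale_def kscale_kp flip: kp_minus)
  then show "gbr (Xg i j) (Xg k i) = gscale (- rs {i, j} {i, k}) (Xg j k)"
    "gbr (Xg j i) (Xg i k) = gscale (- rs {i, j} {i, k}) (Xg j k)"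
    "gbr (Xg j i) (Xg k i) = gscale (- rs {i, j} {i, k}) (Xg j k)"
    by (simp_all only: Xg_swap[of j i] Xg_swap[of k i])
qed

lemma Xg_br:
  "gbr (Xg I1 I2) (Xg I1 I2) = 0"
  "gbr (Xg I1 I2) (Xg I3 I4) = 0"
  "gbr (Xg I1 I3) (Xg I1 I3) = 0"
  "gbr (Xg I1 I3) (Xg I2 I4) = 0"
  "gbr (Xg I1 I4) (Xg I1 I4) = 0"
  "gbr (Xg I1 I4) (Xg I2 I3) = 0"
  "gbr (Xg I2 I3) (Xg I1 I4) = 0"
  "gbr (Xg I2 I3) (Xg I2 I3) = 0"
  "gbr (Xg I2 I4) (Xg I1 I3) = 0"
  "gbr (Xg I2 I4) (Xg I2 I4) = 0"
  "gbr (Xg I3 I4) (Xg I1 I2) = 0"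
  "gbr (Xg I3 I4) (Xg I3 I4) = 0"
  by (rule Xg_br_0; simp)+

lemma Xg_br':
  "gbr (Xg I1 I2) (Xg I1 I3) = Xg I2 I3"
  "gbr (Xg I1 I2) (Xg I1 I4) = Xg I2 I4"
  "gbr (Xg I1 I2) (Xg I2 I3) = gscale (- 1) (Xg I1 I3)"
  "gbr (Xg I1 I2) (Xg I2 I4) = gscale (- 1) (Xg I1 I4)"
  "gbr (Xg I1 I3) (Xg I1 I2) = gscale (- 1) (Xg I2 I3)"
  "gbr (Xg I1 I3) (Xg I1 I4) = Xg I3 I4"
  "gbr (Xg I1 I3) (Xg I2 I3) = Xg I1 I2"
  "gbr (Xg I1 I3) (Xg I3 I4) = gscale (- 1) (Xg I1 I4)"
  "gbr (Xg I1 I4) (Xg I1 I2) = gscale (- 1) (Xg I2 I4)"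
  "gbr (Xg I1 I4) (Xg I1 I3) = gscale (- 1) (Xg I3 I4)"
  "gbr (Xg I1 I4) (Xg I2 I4) = Xg I1 I2"
  "gbr (Xg I1 I4) (Xg I3 I4) = Xg I1 I3"
  "gbr (Xg I2 I3) (Xg I1 I2) = Xg I1 I3"
  "gbr (Xg I2 I3) (Xg I1 I3) = gscale (- 1) (Xg I1 I2)"
  "gbr (Xg I2 I3) (Xg I2 I4) = Xg I3 I4"
  "gbr (Xg I2 I3) (Xg I3 I4) = gscale (- 1) (Xg I2 I4)"
  "gbr (Xg I2 I4) (Xg I1 I2) = Xg I1 I4"
  "gbr (Xg I2 I4) (Xg I1 I4) = gscale (- 1) (Xg I1 I2)"
  "gbr (Xg I2 I4) (Xg I2 I3) = gscale (- 1) (Xg I3 I4)"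
  "gbr (Xg I2 I4) (Xg I3 I4) = Xg I2 I3"
  "gbr (Xg I3 I4) (Xg I1 I3) = Xg I1 I4"
  "gbr (Xg I3 I4) (Xg I1 I4) = gscale (- 1) (Xg I1 I3)"
  "gbr (Xg I3 I4) (Xg I2 I3) = Xg I2 I4"
  "gbr (Xg I3 I4) (Xg I2 I4) = gscale (- 1) (Xg I2 I3)"
  by (simp_all add: Xg_br_1 reorder_sign_prod sg_def gscale_simps(1)) (simp_all add: Xg_swap)?

lemma g_t_br: "gbr g_t g = 0" if "g \<in> {g_h_x, g_h_y, g_e_x, g_f_x, g_e_y, g_f_y, g_t, g_C}"
proof -
  have "gbr g_t (Xg i j) = 0" if "i \<noteq> j" for i j
    using that by (simp add: g_t_def Xg_def gbr_def kmon_eq_kp kbr_kp_disjoint psi_kp zero_prod_def)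
  moreover have "gbr g_t g_t = 0" "gbr g_t g_C = 0"
    by (simp_all add: g_t_def g_C_def gbr_def kmon_eq_kp kbr_kp_disjoint psi_kp psi_linear zero_prod_def mult.commute)
  ultimately show ?thesis using that
    unfolding g_expand by (elim insertE emptyE; simp only: gbr_add_right gbr_scale_right) (simp_all add: gscale_simps(7))
qed

lemma g_C_br: "gbr g_C a = 0"
  by (simp add: g_C_def gbr_def psi_linear zero_prod_def flip: zero_fun_def)

lemma pairs_cases:
  assumes "card (S :: idx set) = 2"
  shows "S = {I1, I2} \<or> S = {I1, I3} \<or> S = {I1, I4} \<or> S = {I2, I3} \<or> S = {I2, I4} \<or> S = {I3, I4}"
proof -
  obtain a b where "S = {a, b}" "a \<noteq> b" using assms by (auto simp: card_2_iff)
  then show ?thesis by (cases a; cases b) auto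
qed

lemma gsum_0_expand:
  assumes "x \<in> gsum {0}"
  shows "x = gscale (coeff (fst x {}) 1) g_t + gscale (snd x) g_C
    + gscale (co {I1,I2} (fst x)) (Xg I1 I2) + gscale (co {I1,I3} (fst x)) (Xg I1 I3)
    + gscale (co {I1,I4} (fst x)) (Xg I1 I4) + gscale (co {I2,I3} (fst x)) (Xg I2 I3)
    + gscale (co {I2,I4} (fst x)) (Xg I2 I4) + gscale (co {I3,I4} (fst x)) (Xg I3 I4)" (is "x = ?y")
proof -
  have x: "fst x S = (if card S = 2 then [:co S (fst x):] else if S = {} then monom (coeff (fst x {}) 1) 1 else 0)" for S
  proof -
    have "fst (pzero x) S = (if card S = 2 then [:co S (fst x):] else if S = {} then monom (coeff (fst x {}) 1) 1 else 0)"
      by (simp add: pzero_def co_def)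
    then show ?thesis unfolding gsum_0_pzero[OF assms] .
  qed
  define t where "t = coeff (fst x {}) 1"
  have "fst x S = fst ?y S" for S
  proof -
    consider "card S = 2" | "S = {}" | "card S \<noteq> 2" "S \<noteq> {}" by blast
    then show ?thesis
    proof cases
      case 1
      then have fx: "fst x S = [:co S (fst x):]" using x[of S] by simp
      from pairs_cases[OF 1] show ?thesis unfolding t_def[symmetric] using fx
        by (elim disjE; simp add: Xg_def g_t_def g_C_def gscale_def kscale_def kmon_def kp_def doubleton_eq_iff)
    next
      case 2
      then have "fst x {} = monom t 1" using x[of S] by (simp add: t_def)
      then show ?thesis unfolding t_def[symmetric] 2
        by (simp add: Xg_def g_t_def g_C_def gscale_def kscale_def kmon_def kp_def smult_monom)
    next
      case 3
      then have "fst x S = 0" "S \<noteq> {i, j}" if "i \<noteq> j" for i j using x[of S] that by auto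
      from this(1)[of I1 I2] this(2) 3 show ?thesis unfolding t_def[symmetric]
        by (simp add: Xg_def g_t_def g_C_def gscale_def kscale_def kmon_def kp_def)
    qed
  qed
  then have "fst x = fst ?y" by (rule ext)
  moreover have "snd x = snd ?y" by (simp add: gscale_def Xg_def g_t_def g_C_def)
  ultimately show ?thesis by (rule prod_eqI)
qed

text \<open>The eight coordinates belong to t, C and the six xi_ij; identities in degree zero
  thereby become complex arithmetic.\<close>

lemma gsum_0_eqI:
  assumes "x \<in> gsum {0}" "y \<in> gsum {0}" "coeff (fst x {}) 1 = coeff (fst y {}) 1" "snd x = snd y"
    "co {I1, I2} (fst x) = co {I1, I2} (fst y)" "co {I1, I3} (fst x) = co {I1, I3} (fst y)"
    "co {I1, I4} (fst x) = co {I1, I4} (fst y)" "co {I2, I3} (fst x) = co {I2, I3} (fst y)"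
    "co {I2, I4} (fst x) = co {I2, I4} (fst y)" "co {I3, I4} (fst x) = co {I3, I4} (fst y)"
  shows "x = y"
  using gsum_0_expand[OF assms(1)] gsum_0_expand[OF assms(2)] assms(3-) by simp

lemma gbr_gsum_0: "a \<in> gsum {0} \<Longrightarrow> b \<in> gsum {0} \<Longrightarrow> gbr a b \<in> gsum {0}"
  using pplus_pzero_gbr(2)[of a b] pzero_gsum[of "gbr (pplus a) (pplus b)"] by (simp add: gsum_0_pzero)

lemma coords:
  "coeff (fst (a + b) {}) 1 = coeff (fst a {}) 1 + coeff (fst b {}) 1"
  "coeff (fst (gscale c a) {}) 1 = c * coeff (fst a {}) 1"
  "co S (fst (a + b)) = co S (fst a) + co S (fst b)" "co S (fst (gscale c a)) = c * co S (fst a)"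
  "snd (a + b) = snd a + snd b" "snd (gscale c a) = c * snd a"
  "coeff (fst (0 :: gvec) {}) 1 = 0" "co S (fst (0 :: gvec)) = 0" "snd (0 :: gvec) = 0"
  "coeff (fst (Xg i j) {}) 1 = 0" "co S (fst (Xg i j)) = (if S = {i, j} then 1 else 0)" "snd (Xg i j) = 0"
  by (simp_all add: gscale_def kscale_def co_def Xg_def kp_def)

lemma zero_gsum: "0 \<in> gsum D"
  by (simp add: gsum_def gdegs_def)

lemma g_br:
  "gbr g_e_x g_f_x = g_h_x" "gbr g_h_x g_e_x = gscale 2 g_e_x" "gbr g_h_x g_f_x = gscale (- 2) g_f_x"
  "gbr g_e_y g_f_y = g_h_y" "gbr g_h_y g_e_y = gscale 2 g_e_y" "gbr g_h_y g_f_y = gscale (- 2) g_f_y"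
  "gbr g_e_x g_e_y = 0" "gbr g_e_x g_f_y = 0" "gbr g_e_x g_h_y = 0"
  "gbr g_f_x g_e_y = 0" "gbr g_f_x g_f_y = 0" "gbr g_f_x g_h_y = 0"
  "gbr g_h_x g_e_y = 0" "gbr g_h_x g_f_y = 0" "gbr g_h_x g_h_y = 0"
  by (rule gsum_0_eqI, intro gbr_gsum_0 gsum_scale g_gsum zero_gsum, intro gbr_gsum_0 gsum_scale g_gsum zero_gsum;
      simp only: g_expand gbr_add_left gbr_add_right gbr_scale_left gbr_scale_right Xg_br Xg_br' coords;
      simp add: doubleton_eq_iff)+

lemma Xg_expand:
  "Xg I1 I2 = gscale (\<i>/2) g_h_x + gscale (\<i>/2) g_h_y"
  "Xg I3 I4 = gscale (- \<i>/2) g_h_x + gscale (\<i>/2) g_h_y"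
  "Xg I2 I3 = gscale (- \<i>/2) g_e_x + gscale (- \<i>/2) g_f_x + gscale (- \<i>/2) g_e_y + gscale (- \<i>/2) g_f_y"
  "Xg I1 I4 = gscale (\<i>/2) g_e_x + gscale (\<i>/2) g_f_x + gscale (- \<i>/2) g_e_y + gscale (- \<i>/2) g_f_y"
  "Xg I1 I3 = gscale (- 1/2) g_e_x + gscale (1/2) g_f_x + gscale (- 1/2) g_e_y + gscale (1/2) g_f_y"
  "Xg I2 I4 = gscale (- 1/2) g_e_x + gscale (1/2) g_f_x + gscale (1/2) g_e_y + gscale (- 1/2) g_f_y"
  by (rule gsum_0_eqI, rule Xg_gsum, simp, intro gsum_add gsum_scale g_gsum; simp only: g_expand coords;
      simp add: doubleton_eq_iff)+

section \<open>Singular vectors of degree one\<close>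

lemma co_kbr_xi: "co U (kbr f (xi i)) = - rs U {i} * (if i \<in> U then coeff (f (U - {i})) 1 else co (insert i U) f)"
  by (simp add: co_def kbr_xi_apply coeff_pderiv)

text \<open>Only the coefficients of \<open>a\<close> at t xi_j and at the cubic monomials occur,
  which are the coordinates of its degree one component. Annihilation of a degree one vector by the
  positive part is thus a condition on elements of degree one.\<close>

lemma xi_coords:
  "coeff (fst (gbr a (xg I1)) {}) 1 = - coeff (fst a {I1}) 1"
  "snd (gbr a (xg I1)) = - co {I2, I3, I4} (fst a)"
  "co {I1, I2} (fst (gbr a (xg I1))) = coeff (fst a {I2}) 1"
  "co {I1, I3} (fst (gbr a (xg I1))) = coeff (fst a {I3}) 1"
  "co {I1, I4} (fst (gbr a (xg I1))) = coeff (fst a {I4}) 1"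
  "co {I2, I3} (fst (gbr a (xg I1))) = - co {I1, I2, I3} (fst a)"
  "co {I2, I4} (fst (gbr a (xg I1))) = - co {I1, I2, I4} (fst a)"
  "co {I3, I4} (fst (gbr a (xg I1))) = - co {I1, I3, I4} (fst a)"
  "coeff (fst (gbr a (xg I2)) {}) 1 = - coeff (fst a {I2}) 1"
  "snd (gbr a (xg I2)) = co {I1, I3, I4} (fst a)"
  "co {I1, I2} (fst (gbr a (xg I2))) = - coeff (fst a {I1}) 1"
  "co {I1, I3} (fst (gbr a (xg I2))) = co {I1, I2, I3} (fst a)"
  "co {I1, I4} (fst (gbr a (xg I2))) = co {I1, I2, I4} (fst a)"
  "co {I2, I3} (fst (gbr a (xg I2))) = coeff (fst a {I3}) 1"
  "co {I2, I4} (fst (gbr a (xg I2))) = coeff (fst a {I4}) 1"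
  "co {I3, I4} (fst (gbr a (xg I2))) = - co {I2, I3, I4} (fst a)"
  "coeff (fst (gbr a (xg I3)) {}) 1 = - coeff (fst a {I3}) 1"
  "snd (gbr a (xg I3)) = - co {I1, I2, I4} (fst a)"
  "co {I1, I2} (fst (gbr a (xg I3))) = - co {I1, I2, I3} (fst a)"
  "co {I1, I3} (fst (gbr a (xg I3))) = - coeff (fst a {I1}) 1"
  "co {I1, I4} (fst (gbr a (xg I3))) = co {I1, I3, I4} (fst a)"
  "co {I2, I3} (fst (gbr a (xg I3))) = - coeff (fst a {I2}) 1"
  "co {I2, I4} (fst (gbr a (xg I3))) = co {I2, I3, I4} (fst a)"
  "co {I3, I4} (fst (gbr a (xg I3))) = coeff (fst a {I4}) 1"
  "coeff (fst (gbr a (xg I4)) {}) 1 = - coeff (fst a {I4}) 1"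
  "snd (gbr a (xg I4)) = co {I1, I2, I3} (fst a)"
  "co {I1, I2} (fst (gbr a (xg I4))) = - co {I1, I2, I4} (fst a)"
  "co {I1, I3} (fst (gbr a (xg I4))) = - co {I1, I3, I4} (fst a)"
  "co {I1, I4} (fst (gbr a (xg I4))) = - coeff (fst a {I1}) 1"
  "co {I2, I3} (fst (gbr a (xg I4))) = - co {I2, I3, I4} (fst a)"
  "co {I2, I4} (fst (gbr a (xg I4))) = - coeff (fst a {I2}) 1"
  "co {I3, I4} (fst (gbr a (xg I4))) = - coeff (fst a {I3}) 1"
  by (simp_all add: gbr_def psi_xi co_kbr_xi Compl_idx reorder_sign_prod sg_def insert_commute insert_Diff_if)
    (simp_all add: kbr_xi_apply coeff_pderiv)

lemma co_singleton_gbr_xi: "co {j} (fst (gbr a (xg i))) =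
    - rs {j} {i} * (if i = j then coeff (fst a {}) 1 else co {i, j} (fst a))"
  by (auto simp: gbr_def co_kbr_xi)

lemma pzero_coords: "coeff (fst (pzero a) {}) 1 = coeff (fst a {}) 1" "snd (pzero a) = snd a"
  "k \<noteq> l \<Longrightarrow> co {k, l} (fst (pzero a)) = co {k, l} (fst a)"
  by (simp_all add: pzero_def co_def)

section \<open>Reduction to equations in F\<close>

locale g0_scalar = g0_mod sc \<rho>
  for sc :: "complex \<Rightarrow> 'v::ab_group_add \<Rightarrow> 'v" and \<rho> :: "gvec \<Rightarrow> 'v \<Rightarrow> 'v" +
  fixes \<mu>t \<mu>C :: complex
  assumes rho_t: "\<rho> g_t v = sc \<mu>t v" and rho_C: "\<rho> g_C v = sc \<mu>C v"
begin

abbreviation "eX \<equiv> \<rho> g_e_x"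
abbreviation "fX \<equiv> \<rho> g_f_x"
abbreviation "hX \<equiv> \<rho> g_h_x"
abbreviation "eY \<equiv> \<rho> g_e_y"
abbreviation "fY \<equiv> \<rho> g_f_y"
abbreviation "hY \<equiv> \<rho> g_h_y"

text \<open>The coefficients come from \<open>Xg_expand\<close>, which inverts the base change
  defining the two triples; t and C contribute scalars.\<close>

lemma rho_expand:
  assumes x: "x \<in> gsum {0}"
  shows "\<rho> x v = sc (coeff (fst x {}) 1 * \<mu>t + snd x * \<mu>C) v
    + sc (\<i>/2 * (co {I1,I2} (fst x) - co {I3,I4} (fst x))) (hX v)
    + sc (\<i>/2 * (co {I1,I2} (fst x) + co {I3,I4} (fst x))) (hY v)
    + sc (1/2 * (\<i> * co {I1,I4} (fst x) - \<i> * co {I2,I3} (fst x) - co {I1,I3} (fst x) - co {I2,I4} (fst x))) (eX v)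
    + sc (1/2 * (\<i> * co {I1,I4} (fst x) - \<i> * co {I2,I3} (fst x) + co {I1,I3} (fst x) + co {I2,I4} (fst x))) (fX v)
    + sc (1/2 * (- \<i> * co {I1,I4} (fst x) - \<i> * co {I2,I3} (fst x) - co {I1,I3} (fst x) + co {I2,I4} (fst x))) (eY v)
    + sc (1/2 * (- \<i> * co {I1,I4} (fst x) - \<i> * co {I2,I3} (fst x) + co {I1,I3} (fst x) - co {I2,I4} (fst x))) (fY v)" (is "_ = ?r")
proof -
  have Xg_g: "Xg I1 I2 \<in> gsum {0}" "Xg I1 I3 \<in> gsum {0}" "Xg I1 I4 \<in> gsum {0}" "Xg I2 I3 \<in> gsum {0}"
    "Xg I2 I4 \<in> gsum {0}" "Xg I3 I4 \<in> gsum {0}"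
    by (simp_all add: Xg_gsum)
  note add = rho_add gsum_add gsum_scale Xg_g g_gsum
  have X: "\<rho> (Xg I1 I2) v = sc (\<i>/2) (hX v) + sc (\<i>/2) (hY v)"
    "\<rho> (Xg I3 I4) v = sc (- \<i>/2) (hX v) + sc (\<i>/2) (hY v)"
    "\<rho> (Xg I2 I3) v = sc (- \<i>/2) (eX v) + sc (- \<i>/2) (fX v) + sc (- \<i>/2) (eY v) + sc (- \<i>/2) (fY v)"
    "\<rho> (Xg I1 I4) v = sc (\<i>/2) (eX v) + sc (\<i>/2) (fX v) + sc (- \<i>/2) (eY v) + sc (- \<i>/2) (fY v)"
    "\<rho> (Xg I1 I3) v = sc (- 1/2) (eX v) + sc (1/2) (fX v) + sc (- 1/2) (eY v) + sc (1/2) (fY v)"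
    "\<rho> (Xg I2 I4) v = sc (- 1/2) (eX v) + sc (1/2) (fX v) + sc (1/2) (eY v) + sc (- 1/2) (fY v)"
    unfolding Xg_expand by (simp_all only: add rho_scale)
  have e: "\<rho> x v = sc (coeff (fst x {}) 1) (\<rho> g_t v) + sc (snd x) (\<rho> g_C v)
    + sc (co {I1,I2} (fst x)) (\<rho> (Xg I1 I2) v) + sc (co {I1,I3} (fst x)) (\<rho> (Xg I1 I3) v)
    + sc (co {I1,I4} (fst x)) (\<rho> (Xg I1 I4) v) + sc (co {I2,I3} (fst x)) (\<rho> (Xg I2 I3) v)
    + sc (co {I2,I4} (fst x)) (\<rho> (Xg I2 I4) v) + sc (co {I3,I4} (fst x)) (\<rho> (Xg I3 I4) v)" (is "_ = ?s")
  proof -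
    have "\<rho> (gscale (coeff (fst x {}) 1) g_t + gscale (snd x) g_C
      + gscale (co {I1,I2} (fst x)) (Xg I1 I2) + gscale (co {I1,I3} (fst x)) (Xg I1 I3)
      + gscale (co {I1,I4} (fst x)) (Xg I1 I4) + gscale (co {I2,I3} (fst x)) (Xg I2 I3)
      + gscale (co {I2,I4} (fst x)) (Xg I2 I4) + gscale (co {I3,I4} (fst x)) (Xg I3 I4)) v = ?s"
      by (simp only: add rho_scale)
    with arg_cong[OF gsum_0_expand[OF x], of "\<lambda>y. \<rho> y v"] show ?thesis by (rule trans)
  qed
  show ?thesis
  proof (rule functional_eqI)
    fix \<phi> :: "'v \<Rightarrow> complex" assume \<phi>: "\<And>u v. \<phi> (u + v) = \<phi> u + \<phi> v" "\<And>c v. \<phi> (sc c v) = c * \<phi> v"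
    show "\<phi> (\<rho> x v) = \<phi> ?r"
      unfolding e X by (simp only: \<phi> rho_t rho_C) (simp add: algebra_simps add_divide_distrib diff_divide_distrib)
  qed
qed

text \<open>The components of \<open>w\<^sub>1\<^sub>1 \<otimes> A + w\<^sub>2\<^sub>2 \<otimes> B + w\<^sub>1\<^sub>2 \<otimes> C + w\<^sub>2\<^sub>1 \<otimes> D\<close> with respect to the \<open>\<eta>\<^sub>i\<close>.\<close>

definition wvec :: "'v \<Rightarrow> 'v \<Rightarrow> 'v \<Rightarrow> 'v \<Rightarrow> idx \<Rightarrow> 'v" where
  "wvec A B C D i = (case i of I1 \<Rightarrow> sc \<i> (A - B) | I2 \<Rightarrow> A + B | I3 \<Rightarrow> sc \<i> (C + D) | I4 \<Rightarrow> D - C)"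

lemma phi_diff:
  fixes \<phi> :: "'v \<Rightarrow> complex"
  assumes "\<And>u v. \<phi> (u + v) = \<phi> u + \<phi> v"
  shows "\<phi> (u - v) = \<phi> u - (\<phi> v :: complex)" "\<phi> 0 = 0"
  using additive_diff[of \<phi>] assms by blast+

lemma rho_diff: "a \<in> gsum {0} \<Longrightarrow> \<rho> a (u - v) = \<rho> a u - \<rho> a v"
  and rho_0: "a \<in> gsum {0} \<Longrightarrow> \<rho> a 0 = 0"
  using additive_diff[of "\<rho> a"] rho_linear(1) by blast+

text \<open>The p's and q's are coordinates of the degree one component of \<open>a\<close>, for the
  t xi_j and the cubic monomials respectively, in a basis matching the w's. In the differences p - q
  and sums p + q the two copies of sl_2 separate: each difference multiplies an equation with
  x-operators and \<mu>t - \<mu>C, each sum one with y-operators and \<mu>t + \<mu>C.\<close>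

lemma singular_sum:
  fixes a :: gvec and A B C D :: 'v
  defines "p11 \<equiv> coeff (fst a {I2}) 1 / 2 - \<i> * coeff (fst a {I1}) 1 / 2"
    and "p22 \<equiv> coeff (fst a {I2}) 1 / 2 + \<i> * coeff (fst a {I1}) 1 / 2"
    and "p12 \<equiv> - \<i> * coeff (fst a {I3}) 1 / 2 - coeff (fst a {I4}) 1 / 2"
    and "p21 \<equiv> - \<i> * coeff (fst a {I3}) 1 / 2 + coeff (fst a {I4}) 1 / 2"
    and "q11 \<equiv> - co {I1,I3,I4} (fst a) / 2 - \<i> * co {I2,I3,I4} (fst a) / 2"
    and "q22 \<equiv> - co {I1,I3,I4} (fst a) / 2 + \<i> * co {I2,I3,I4} (fst a) / 2"
    and "q12 \<equiv> - \<i> * co {I1,I2,I4} (fst a) / 2 + co {I1,I2,I3} (fst a) / 2"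
    and "q21 \<equiv> - \<i> * co {I1,I2,I4} (fst a) / 2 - co {I1,I2,I3} (fst a) / 2"
  shows "(\<Sum>i\<in>UNIV. \<rho> (pzero (gbr a (xg i))) (wvec A B C D i)) =
      sc (- (p22 - q22)) (sc (\<mu>t - \<mu>C) A + hX A + sc 2 (fX D))
    + sc (- (p22 + q22)) (sc (\<mu>t + \<mu>C) A + hY A + sc 2 (fY C))
    + sc (- (p11 - q11)) (sc (\<mu>t - \<mu>C) B - hX B + sc 2 (eX C))
    + sc (- (p11 + q11)) (sc (\<mu>t + \<mu>C) B - hY B + sc 2 (eY D))
    + sc (p12 - q12) (sc (\<mu>t - \<mu>C) D - hX D + sc 2 (eX A))
    + sc (p12 + q12) (sc (\<mu>t + \<mu>C) D + hY D + sc 2 (fY B))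
    + sc (p21 - q21) (sc (\<mu>t - \<mu>C) C + hX C + sc 2 (fX B))
    + sc (p21 + q21) (sc (\<mu>t + \<mu>C) C - hY C + sc 2 (eY A))" (is "?l = ?r")
proof (rule functional_eqI)
  fix \<phi> :: "'v \<Rightarrow> complex" assume \<phi>: "\<And>u v. \<phi> (u + v) = \<phi> u + \<phi> v" "\<And>c v. \<phi> (sc c v) = c * \<phi> v"
  note \<phi>' = \<phi> phi_diff(1)[of \<phi>, OF \<phi>(1)]
  note lin = rho_linear[OF g_gsum(1)] rho_linear[OF g_gsum(2)] rho_linear[OF g_gsum(3)] rho_linear[OF g_gsum(4)]
    rho_linear[OF g_gsum(5)] rho_linear[OF g_gsum(6)]
    rho_diff[OF g_gsum(1)] rho_diff[OF g_gsum(2)] rho_diff[OF g_gsum(3)] rho_diff[OF g_gsum(4)]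
    rho_diff[OF g_gsum(5)] rho_diff[OF g_gsum(6)]
  have i: "\<i> * (\<i> * z) = - z" for z by (simp flip: mult.assoc)
  show "\<phi> ?l = \<phi> ?r"
    by (simp only: UNIV_idx sum.insert finite.intros insert_iff empty_iff idx.distinct simp_thms sum.empty
        \<phi>' rho_expand[OF pzero_gsum] pzero_coords xi_coords wvec_def idx.case lin phi_diff(2)[of \<phi>, OF \<phi>(1)] not_False_eq_True)
      (simp add: p11_def p22_def p12_def p21_def q11_def q22_def q12_def q21_def algebra_simps i
        add_divide_distrib diff_divide_distrib)
qed

lemma sums_xi: "(\<Sum>i\<in>UNIV. h i) = h I1 + h I2 + h I3 + (h I4 :: 'v)"
  by (simp add: UNIV_idx add.assoc)

lemma eX_matrix:
  "co {j} (fst (gbr g_e_x (xg i))) = (case (j, i) of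
     (I1, I3) \<Rightarrow> 1/2 | (I1, I4) \<Rightarrow> \<i>/2 | (I2, I3) \<Rightarrow> - \<i>/2 | (I2, I4) \<Rightarrow> 1/2
   | (I3, I1) \<Rightarrow> - 1/2 | (I3, I2) \<Rightarrow> \<i>/2 | (I4, I1) \<Rightarrow> - \<i>/2 | (I4, I2) \<Rightarrow> - 1/2 | _ \<Rightarrow> 0)"
  "co {j} (fst (gbr g_e_y (xg i))) = (case (j, i) of
     (I1, I3) \<Rightarrow> 1/2 | (I1, I4) \<Rightarrow> - \<i>/2 | (I2, I3) \<Rightarrow> - \<i>/2 | (I2, I4) \<Rightarrow> - 1/2
   | (I3, I1) \<Rightarrow> - 1/2 | (I3, I2) \<Rightarrow> \<i>/2 | (I4, I1) \<Rightarrow> \<i>/2 | (I4, I2) \<Rightarrow> 1/2 | _ \<Rightarrow> 0)"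
  unfolding co_singleton_gbr_xi g_expand coords
  by (cases j; cases i; simp add: doubleton_eq_iff reorder_sign_prod sg_def)+

end

context g0_scalar
begin

lemmas lin = rho_linear[OF g_gsum(1)] rho_linear[OF g_gsum(2)] rho_linear[OF g_gsum(3)] rho_linear[OF g_gsum(4)]
    rho_linear[OF g_gsum(5)] rho_linear[OF g_gsum(6)]
    rho_diff[OF g_gsum(1)] rho_diff[OF g_gsum(2)] rho_diff[OF g_gsum(3)] rho_diff[OF g_gsum(4)]
    rho_diff[OF g_gsum(5)] rho_diff[OF g_gsum(6)]
    rho_0[OF g_gsum(1)] rho_0[OF g_gsum(2)] rho_0[OF g_gsum(3)] rho_0[OF g_gsum(4)]
    rho_0[OF g_gsum(5)] rho_0[OF g_gsum(6)]

lemma lin_minus: "hX (- v) = - hX v" "hY (- v) = - hY v" "eX (- v) = - eX v" "fX (- v) = - fX v"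
  "eY (- v) = - eY v" "fY (- v) = - fY v"
  using lin(13-18)[of 0 v] lin(19-24) by simp_all

lemma rho_commute:
  "eX (fX v) = fX (eX v) + hX v" "hX (eX v) = eX (hX v) + sc 2 (eX v)" "hX (fX v) = fX (hX v) - sc 2 (fX v)"
  "eY (fY v) = fY (eY v) + hY v" "hY (eY v) = eY (hY v) + sc 2 (eY v)" "hY (fY v) = fY (hY v) - sc 2 (fY v)"
  "eY (eX v) = eX (eY v)" "fY (eX v) = eX (fY v)" "hY (eX v) = eX (hY v)"
  "eY (fX v) = fX (eY v)" "fY (fX v) = fX (fY v)" "hY (fX v) = fX (hY v)"
  "eY (hX v) = hX (eY v)" "fY (hX v) = hX (fY v)" "hY (hX v) = hX (hY v)"
proof -
  have z: "\<rho> 0 v = 0" using rho_add[of 0 0 v] zero_gsum by simp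
  note b = rho_br[OF g_gsum(3,4)] rho_br[OF g_gsum(1,3)] rho_br[OF g_gsum(1,4)]
    rho_br[OF g_gsum(5,6)] rho_br[OF g_gsum(2,5)] rho_br[OF g_gsum(2,6)]
    rho_br[OF g_gsum(3,5)] rho_br[OF g_gsum(3,6)] rho_br[OF g_gsum(3,2)]
    rho_br[OF g_gsum(4,5)] rho_br[OF g_gsum(4,6)] rho_br[OF g_gsum(4,2)]
    rho_br[OF g_gsum(1,5)] rho_br[OF g_gsum(1,6)] rho_br[OF g_gsum(1,2)]
  note b' = b[of v, unfolded g_br rho_scale[OF g_gsum(3)] rho_scale[OF g_gsum(4)] rho_scale[OF g_gsum(5)]
      rho_scale[OF g_gsum(6)] z]
  show "eX (fX v) = fX (eX v) + hX v" "hX (eX v) = eX (hX v) + sc 2 (eX v)" "hX (fX v) = fX (hX v) - sc 2 (fX v)"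
    "eY (fY v) = fY (eY v) + hY v" "hY (eY v) = eY (hY v) + sc 2 (eY v)" "hY (fY v) = fY (hY v) - sc 2 (fY v)"
    using b'(1-6) by (simp_all add: algebra_simps)
  show "eY (eX v) = eX (eY v)" "fY (eX v) = eX (fY v)" "hY (eX v) = eX (hY v)"
    "eY (fX v) = fX (eY v)" "fY (fX v) = fX (fY v)" "hY (fX v) = fX (hY v)"
    "eY (hX v) = hX (eY v)" "fY (hX v) = hX (fY v)" "hY (hX v) = hX (hY v)"
    using b'(7-15) by simp_all
qed

lemma wvec_surj: "\<exists>A B C D. v = wvec A B C D"
proof -
  have i: "\<i> * (\<i> * z) = - z" for z by (simp flip: mult.assoc)
  have "v i = wvec (sc (1/2) (v I2) - sc (\<i>/2) (v I1)) (sc (1/2) (v I2) + sc (\<i>/2) (v I1))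
     (sc (- 1/2) (v I4) - sc (\<i>/2) (v I3)) (sc (1/2) (v I4) - sc (\<i>/2) (v I3)) i" (is "_ = ?r i") for i
  proof (rule functional_eqI)
    fix \<phi> :: "'v \<Rightarrow> complex" assume \<phi>: "\<And>u v. \<phi> (u + v) = \<phi> u + \<phi> v" "\<And>c v. \<phi> (sc c v) = c * \<phi> v"
    show "\<phi> (v i) = \<phi> (?r i)"
      by (cases i; simp only: wvec_def idx.case \<phi> phi_diff[of \<phi>, OF \<phi>(1)]; simp add: algebra_simps)
  qed
  then show ?thesis by blast
qed

lemma double_eq_0: "v + v = 0 \<Longrightarrow> v = (0 :: 'v)"
proof -
  assume "v + v = 0"
  moreover have "v + v = sc 2 v" using scale_left_distrib[of 1 1 v] by simp
  ultimately show ?thesis by simp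
qed

lemma wvec_eq_0: "(\<forall>i. wvec A B C D i = 0) \<longleftrightarrow> A = 0 \<and> B = 0 \<and> C = 0 \<and> D = 0"
proof
  assume *: "\<forall>i. wvec A B C D i = 0"
  have h: "A = B" "A + B = 0" "C + D = 0" "D = C"
    using spec[OF *, of I1] spec[OF *, of I2] spec[OF *, of I3] spec[OF *, of I4]
    by (simp_all add: wvec_def)
  have "B = 0" by (rule double_eq_0) (use h(2) in \<open>unfold h(1)\<close>)
  moreover have "C = 0" by (rule double_eq_0) (use h(3) in \<open>unfold h(4)\<close>)
  ultimately show "A = 0 \<and> B = 0 \<and> C = 0 \<and> D = 0" using h(1,4) by simp
qed (auto simp: wvec_def split: idx.split)

text \<open>On generators e_x sends w_21 to w_11 and w_22 to w_12, while e_y sends w_12 to w_11 and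
  w_22 to w_21; the other images vanish. So w_11 is the highest weight vector, and its coefficient
  determines the others.\<close>

lemma act_e:
  "\<rho> g_e_x (wvec A B C D j) + (\<Sum>i\<in>UNIV. sc (co {j} (fst (gbr g_e_x (xg i)))) (wvec A B C D i))
    = wvec (eX A + D) (eX B) (eX C + B) (eX D) j" (is "?l = ?r")
  "\<rho> g_e_y (wvec A B C D j) + (\<Sum>i\<in>UNIV. sc (co {j} (fst (gbr g_e_y (xg i)))) (wvec A B C D i))
    = wvec (eY A + C) (eY B) (eY C) (eY D + B) j" (is "?l' = ?r'")
proof -
  have i: "\<i> * (\<i> * z) = - z" for z by (simp flip: mult.assoc)
  have *: "\<phi> ?l = \<phi> ?r" "\<phi> ?l' = \<phi> ?r'"
    if \<phi>: "\<And>u v. \<phi> (u + v) = \<phi> u + \<phi> v" "\<And>c v. \<phi> (sc c v) = c * \<phi> v" for \<phi> :: "'v \<Rightarrow> complex"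
    unfolding sums_xi eX_matrix
    by (cases j; simp only: prod.case idx.case wvec_def lin \<phi> phi_diff[of \<phi>, OF \<phi>(1)];
        simp add: algebra_simps i add_divide_distrib diff_divide_distrib)+
  show "?l = ?r" "?l' = ?r'"
    by (rule functional_eqI, rule *(1); simp) (rule functional_eqI, rule *(2); simp)
qed

lemma e_killed_iff:
  "ind_act sc \<rho> (iota g_e_x) (icls sc \<rho> (hat (wvec A B C D))) = icls sc \<rho> 0 \<and>
   ind_act sc \<rho> (iota g_e_y) (icls sc \<rho> (hat (wvec A B C D))) = icls sc \<rho> 0 \<longleftrightarrow>
   D = - eX A \<and> C = - eY A \<and> B = eX (eY A) \<and> eX (eX A) = 0 \<and> eY (eY A) = 0"
proof -
  have neg: "u + v = 0 \<longleftrightarrow> u = - (v :: 'v)" for u v by (rule eq_neg_iff_add_eq_0[symmetric])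
  have c1: "D = - eX A \<and> C = - eY A \<and> B = eX (eY A) \<and> eX (eX A) = 0 \<and> eY (eY A) = 0"
    if "eX A + D = 0" "eX B = 0" "eX C + B = 0" "eX D = 0" "eY A + C = 0" "eY B = 0" "eY C = 0" "eY D + B = 0"
  proof -
    have "D = - eX A" "C = - eY A" using that(1,5) by (simp_all add: neg minus_equation_iff)
    then show ?thesis using that by (simp add: lin_minus neg)
  qed
  have c2: "eX A + D = 0" "eX B = 0" "eX C + B = 0" "eX D = 0" "eY A + C = 0" "eY B = 0" "eY C = 0" "eY D + B = 0"
    if "D = - eX A" "C = - eY A" "B = eX (eY A)" "eX (eX A) = 0" "eY (eY A) = 0"
    using that rho_commute(7)[of "eX A"] rho_commute(7)[of A] rho_commute(7)[of "eY A"]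
    by (simp_all add: lin_minus lin)
  show ?thesis
    unfolding ind_act_0_iff[OF g_gsum(3)] ind_act_0_iff[OF g_gsum(5)] act_e wvec_eq_0
    apply (rule iffI; elim conjE)
     apply (rule c1; assumption)
    apply (intro conjI; rule c2; assumption)
    done
qed

definition cand :: "'v \<Rightarrow> 'v tfree set" where
  "cand A = icls sc \<rho> (hat (wvec A (eX (eY A)) (- eY A) (- eX A)))"

text \<open>Two elements of \<open>\<gg>\<^sub>1\<close> of this form single out the two equations for \<open>A\<close> among those of
  \<open>singular_sum\<close>.\<close>

definition sing_elt :: "complex \<Rightarrow> complex \<Rightarrow> complex \<Rightarrow> complex \<Rightarrow> gvec" where
  "sing_elt a1 a2 b1 b2 = emb (kp (monom a1 1) {I1} + kp (monom a2 1) {I2} + kp (monom b1 0) {I2, I3, I4} + kp (monom b2 0) {I1, I3, I4})"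

lemma sing_elt_gsum: "sing_elt a1 a2 b1 b2 \<in> gsum {0<..}"
proof -
  have "emb (kp (monom a1 1) {I1}) \<in> gsum {0<..}" "emb (kp (monom a2 1) {I2}) \<in> gsum {0<..}"
    by (auto simp: gsum_def gdegs_def kp_def split: if_splits)
  moreover have "emb (kp (monom b1 0) {I2, I3, I4}) \<in> gsum {0<..}" "emb (kp (monom b2 0) {I1, I3, I4}) \<in> gsum {0<..}"
    by (auto simp: gsum_def gdegs_def kp_def coeff_pCons split: if_splits nat.splits)
  ultimately have "emb (kp (monom a1 1) {I1}) + emb (kp (monom a2 1) {I2}) + emb (kp (monom b1 0) {I2, I3, I4})
     + emb (kp (monom b2 0) {I1, I3, I4}) \<in> gsum {0<..}" by (intro gsum_add)
  then show ?thesis by (simp add: sing_elt_def)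
qed

lemma sing_elt_coords:
  "coeff (fst (sing_elt a1 a2 b1 b2) {I1}) 1 = a1" (is ?A) "coeff (fst (sing_elt a1 a2 b1 b2) {I2}) 1 = a2" (is ?B)
  "coeff (fst (sing_elt a1 a2 b1 b2) {I3}) 1 = 0" (is ?C) "coeff (fst (sing_elt a1 a2 b1 b2) {I4}) 1 = 0" (is ?D)
  "co {I2, I3, I4} (fst (sing_elt a1 a2 b1 b2)) = b1" (is ?E) "co {I1, I3, I4} (fst (sing_elt a1 a2 b1 b2)) = b2" (is ?F)
  "co {I1, I2, I4} (fst (sing_elt a1 a2 b1 b2)) = 0" (is ?G) "co {I1, I2, I3} (fst (sing_elt a1 a2 b1 b2)) = 0" (is ?H)
proof -
  have ne: "{I1, I2, I4} \<noteq> {I2, I3, I4}" "{I1, I2, I4} \<noteq> {I1, I3, I4}" "{I1, I2, I3} \<noteq> {I2, I3, I4}"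
    "{I1, I2, I3} \<noteq> {I1, I3, I4}" "{I2, I3, I4} \<noteq> {I1, I3, I4}" "{I1, I3, I4} \<noteq> {I2, I3, I4}"
    "{I1} \<noteq> {I1, I3, I4}" "{I1} \<noteq> {I2, I3, I4}" "{I2} \<noteq> {I1, I3, I4}" "{I2} \<noteq> {I2, I3, I4}"
    "{I3} \<noteq> {I1, I3, I4}" "{I3} \<noteq> {I2, I3, I4}" "{I4} \<noteq> {I1, I3, I4}" "{I4} \<noteq> {I2, I3, I4}"
    "{I2, I3, I4} \<noteq> {I1}" "{I2, I3, I4} \<noteq> {I2}" "{I1, I3, I4} \<noteq> {I1}" "{I1, I3, I4} \<noteq> {I2}"
    "{I1, I2, I4} \<noteq> {I1}" "{I1, I2, I4} \<noteq> {I2}" "{I1, I2, I3} \<noteq> {I1}" "{I1, I2, I3} \<noteq> {I2}"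
    by auto
  show ?A ?B ?C ?D ?E ?F ?G ?H
    by (simp_all add: sing_elt_def co_def kp_def ne)
qed

text \<open>The eight equations of \<open>singular_sum\<close> reduce to those for the coefficients
  of w_11 because the other six are their images under - e_x and - e_y.\<close>

lemma singular_cand:
  assumes "eX (eX A) = 0" "eY (eY A) = 0"
  shows "singular sc \<rho> (cand A) \<longleftrightarrow>
     sc (\<mu>t - \<mu>C) A + hX A = sc 2 (fX (eX A)) \<and> sc (\<mu>t + \<mu>C) A + hY A = sc 2 (fY (eY A))"
proof
  assume "singular sc \<rho> (cand A)"
  then have *: "(\<Sum>i\<in>UNIV. \<rho> (pzero (gbr a (xg i))) (wvec A (eX (eY A)) (- eY A) (- eX A) i)) = 0"
    if "a \<in> gsum {0<..}" for a
    using that ind_act_pos_iff[OF that] unfolding singular_def cand_def by blast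
  have i: "\<i> * (\<i> * z) = - z" for z by (simp flip: mult.assoc)
  \<comment> \<open>Both elements have \<open>p11 = q11 = 0\<close> and \<open>p22 = 1/2\<close>,
    with all coordinates indexed 12 and 21 zero; \<open>q22\<close> is - 1/2 for the first and 1/2
    for the second. Hence only the coefficient \<open>- (p22 - q22) = - 1\<close>, respectively
    \<open>- (p22 + q22) = - 1\<close>, survives.\<close>
  show "sc (\<mu>t - \<mu>C) A + hX A = sc 2 (fX (eX A)) \<and> sc (\<mu>t + \<mu>C) A + hY A = sc 2 (fY (eY A))"
    using *[OF sing_elt_gsum[of "-\<i>/2" "1/2" "\<i>/2" "1/2"]] *[OF sing_elt_gsum[of "-\<i>/2" "1/2" "- \<i>/2" "- 1/2"]]
    unfolding singular_sum sing_elt_coords by (simp add: lin_minus)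
next
  assume *: "sc (\<mu>t - \<mu>C) A + hX A = sc 2 (fX (eX A)) \<and> sc (\<mu>t + \<mu>C) A + hY A = sc 2 (fY (eY A))"
  let ?B = "eX (eY A)" and ?C = "- eY A" and ?D = "- eX A" and ?s = "\<mu>t - \<mu>C" and ?r = "\<mu>t + \<mu>C"
  have E1: "sc ?s A + hX A + sc 2 (fX ?D) = 0" and E5: "sc ?r A + hY A + sc 2 (fY ?C) = 0"
    using * by (simp_all add: lin_minus)
  \<comment> \<open>Moving e_x inwards produces f_x e_x e_x A, which is zero by assumption; the
    commutators with f_x and h_x reverse the sign of the h_x term.\<close>
  have E2: "sc ?s ?D - hX ?D + sc 2 (eX A) = 0"
  proof -
    have "- eX (sc ?s A + hX A + sc 2 (fX ?D)) = sc ?s ?D - hX ?D + sc 2 (eX A)"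
    proof (rule functional_eqI)
      fix \<phi> :: "'v \<Rightarrow> complex" assume \<phi>: "\<And>u v. \<phi> (u + v) = \<phi> u + \<phi> v" "\<And>c v. \<phi> (sc c v) = c * \<phi> v"
      show "\<phi> (- eX (sc ?s A + hX A + sc 2 (fX ?D))) = \<phi> (sc ?s ?D - hX ?D + sc 2 (eX A))"
        using phi_diff[of \<phi>, OF \<phi>(1)] additive_diff(3)[of \<phi>, OF \<phi>(1)]
        by (simp add: lin lin_minus \<phi> rho_commute assms) (simp add: algebra_simps)?
    qed
    then show ?thesis unfolding E1 by (simp add: lin)
  qed
  have E6: "sc ?r ?C - hY ?C + sc 2 (eY A) = 0"
  proof -
    have "- eY (sc ?r A + hY A + sc 2 (fY ?C)) = sc ?r ?C - hY ?C + sc 2 (eY A)"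
    proof (rule functional_eqI)
      fix \<phi> :: "'v \<Rightarrow> complex" assume \<phi>: "\<And>u v. \<phi> (u + v) = \<phi> u + \<phi> v" "\<And>c v. \<phi> (sc c v) = c * \<phi> v"
      show "\<phi> (- eY (sc ?r A + hY A + sc 2 (fY ?C))) = \<phi> (sc ?r ?C - hY ?C + sc 2 (eY A))"
        using phi_diff[of \<phi>, OF \<phi>(1)] additive_diff(3)[of \<phi>, OF \<phi>(1)]
        by (simp add: lin lin_minus \<phi> rho_commute assms) (simp add: algebra_simps)?
    qed
    then show ?thesis unfolding E5 by (simp add: lin)
  qed
  \<comment> \<open>The remaining four equations come from applying the raising operator of the
    other copy of sl_2, which commutes with every operator in the equation.\<close>
  note sm = lin lin_minus rho_commute(7-15) algebra_simps
  have E3: "sc ?s ?C + hX ?C + sc 2 (fX ?B) = 0"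
    using arg_cong[OF E1, of "\<lambda>v. - eY v"] by (simp add: sm)
  have E4: "sc ?s ?B - hX ?B + sc 2 (eX ?C) = 0"
    using arg_cong[OF E2, of "\<lambda>v. - eY v"] by (simp add: sm)
  have E7: "sc ?r ?D + hY ?D + sc 2 (fY ?B) = 0"
    using arg_cong[OF E5, of "\<lambda>v. - eX v"] by (simp add: sm)
  have E8: "sc ?r ?B - hY ?B + sc 2 (eY ?D) = 0"
    using arg_cong[OF E6, of "\<lambda>v. - eX v"] by (simp add: sm)
  have "ind_act sc \<rho> (iota a) (cand A) = icls sc \<rho> 0" if "a \<in> gsum {0<..}" for a
    unfolding cand_def ind_act_pos_iff[OF that] singular_sum E1 E2 E3 E4 E5 E6 E7 E8 by simp
  then show "singular sc \<rho> (cand A)" by (auto simp: singular_def cand_def Ind_def)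
qed

theorem hw_singular_degree_1_iff:
  "nontrivial sc \<rho> M \<and> highest_weight_singular sc \<rho> M \<and> M \<in> Ind_deg sc \<rho> 1 \<longleftrightarrow>
    (\<exists>A. A \<noteq> 0 \<and> M = cand A \<and> eX (eX A) = 0 \<and> eY (eY A) = 0 \<and>
     sc (\<mu>t - \<mu>C) A + hX A = sc 2 (fX (eX A)) \<and> sc (\<mu>t + \<mu>C) A + hY A = sc 2 (fY (eY A)))"
  (is "?L \<longleftrightarrow> ?R")
proof
  assume L: ?L
  then obtain v where "M = icls sc \<rho> (hat v)" using Ind_deg_1_iff by blast
  moreover obtain A B C D where "v = wvec A B C D" using wvec_surj by blast
  ultimately have M: "M = icls sc \<rho> (hat (wvec A B C D))" by simp
  with L have e: "D = - eX A" "C = - eY A" "B = eX (eY A)" "eX (eX A) = 0" "eY (eY A) = 0"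
    using e_killed_iff[of A B C D] by (auto simp: highest_weight_singular_def)
  then have M': "M = cand A" using M by (simp add: cand_def)
  moreover have "A \<noteq> 0"
  proof
    assume "A = 0"
    then have "\<forall>i. wvec A B C D i = 0" using e by (simp add: wvec_eq_0 lin)
    then have "M = icls sc \<rho> 0" unfolding M icls_ceq hat_eq_0_iff .
    then show False using L by (simp add: nontrivial_def)
  qed
  ultimately show ?R using e L singular_cand[of A] by (auto simp: highest_weight_singular_def)
next
  assume ?R
  then obtain A where A: "A \<noteq> 0" "M = cand A" "eX (eX A) = 0" "eY (eY A) = 0"
     "sc (\<mu>t - \<mu>C) A + hX A = sc 2 (fX (eX A)) \<and> sc (\<mu>t + \<mu>C) A + hY A = sc 2 (fY (eY A))" by blast
  then have "singular sc \<rho> M" using singular_cand by blast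
  moreover have "ind_act sc \<rho> (iota g_e_x) M = icls sc \<rho> 0 \<and> ind_act sc \<rho> (iota g_e_y) M = icls sc \<rho> 0"
    unfolding A(2) cand_def e_killed_iff using A by simp
  moreover have d: "M \<in> Ind_deg sc \<rho> 1" unfolding Ind_deg_1_iff A(2) cand_def by blast
  moreover have "M \<noteq> icls sc \<rho> 0"
    unfolding A(2) cand_def icls_ceq hat_eq_0_iff wvec_eq_0 using A(1) by simp
  ultimately show ?L by (auto simp: nontrivial_def highest_weight_singular_def)
qed

end

section \<open>The polynomial model\<close>

definition kk :: "nat \<Rightarrow> nat \<Rightarrow> nat \<Rightarrow> nat \<Rightarrow> (pvar \<Rightarrow>\<^sub>0 nat)" where
  "kk i j k l = single X1 i + single X2 j + single Y1 k + single Y2 l"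

abbreviation xm :: "nat \<Rightarrow> nat \<Rightarrow> nat \<Rightarrow> nat \<Rightarrow> complex \<Rightarrow> xypoly" where
  "xm i j k l c \<equiv> single (kk i j k l) c"

lemma lookup_kk: "lookup (kk i j k l) x = (case x of X1 \<Rightarrow> i | X2 \<Rightarrow> j | Y1 \<Rightarrow> k | Y2 \<Rightarrow> l)"
  by (cases x) (simp_all add: kk_def lookup_add lookup_single)

lemma kk_exhaust: obtains i j k l where "e = kk i j k l"
proof
  show "e = kk (lookup e X1) (lookup e X2) (lookup e Y1) (lookup e Y2)"
    by (rule poly_mapping_eqI) (simp add: lookup_kk split: pvar.split)
qed

lemma kk_inject: "kk i j k l = kk i' j' k' l' \<longleftrightarrow> i = i' \<and> j = j' \<and> k = k' \<and> l = l'"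
  using lookup_kk[of i j k l] lookup_kk[of i' j' k' l'] by (metis pvar.case)

lemma kk_shift:
  "single X1 1 + kk i j k l = kk (Suc i) j k l" "single X2 1 + kk i j k l = kk i (Suc j) k l"
  "single Y1 1 + kk i j k l = kk i j (Suc k) l" "single Y2 1 + kk i j k l = kk i j k (Suc l)"
  "kk i j k l - single X1 1 = kk (i - 1) j k l" "kk i j k l - single X2 1 = kk i (j - 1) k l"
  "kk i j k l - single Y1 1 = kk i j (k - 1) l" "kk i j k l - single Y2 1 = kk i j k (l - 1)"
  by (rule poly_mapping_eqI; simp add: lookup_kk lookup_add lookup_minus lookup_single split: pvar.split)+

lemma pv_mult_xm:
  "pv X1 * xm i j k l c = xm (Suc i) j k l c" "pv X2 * xm i j k l c = xm i (Suc j) k l c"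
  "pv Y1 * xm i j k l c = xm i j (Suc k) l c" "pv Y2 * xm i j k l c = xm i j k (Suc l) c"
  by (simp_all only: pv_def mult_single kk_shift mult_1)

lemma pd_eq: "pd x p = lext (\<lambda>k c. single (k - single x 1) (of_nat (lookup k x) * c)) p"
  by (simp add: pd_def lext_def)

lemma pd_add: "pd x (p + q) = pd x p + pd x q"
  unfolding pd_eq by (rule lext_add) (simp add: distrib_left single_add)

lemma pd_xm:
  "pd X1 (xm i j k l c) = xm (i - 1) j k l (of_nat i * c)" "pd X2 (xm i j k l c) = xm i (j - 1) k l (of_nat j * c)"
  "pd Y1 (xm i j k l c) = xm i j (k - 1) l (of_nat k * c)" "pd Y2 (xm i j k l c) = xm i j k (l - 1) (of_nat l * c)"
  unfolding pd_eq by (subst lext_single; simp only: kk_shift lookup_kk pvar.case mult_zero_right single_zero)+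

lemma xy_induct [case_names xm add]:
  assumes "\<And>i j k l c. P (xm i j k l c)" "\<And>p q. P p \<Longrightarrow> P q \<Longrightarrow> P (p + q)"
  shows "P (p :: xypoly)"
proof (induction p rule: pm_induct)
  case (single e c)
  then show ?case using assms(1) by (metis kk_exhaust)
qed (rule assms)

lemma bihom_iff: "p \<in> bihom m n \<longleftrightarrow> (\<forall>i j k l. lookup p (kk i j k l) \<noteq> 0 \<longrightarrow> i + j = m \<and> k + l = n)"
proof
  assume "p \<in> bihom m n"
  then show "\<forall>i j k l. lookup p (kk i j k l) \<noteq> 0 \<longrightarrow> i + j = m \<and> k + l = n"
    by (fastforce simp: bihom_def in_keys_iff lookup_kk dest: bspec[of _ _ "kk i j k l" for i j k l])
next
  assume *: "\<forall>i j k l. lookup p (kk i j k l) \<noteq> 0 \<longrightarrow> i + j = m \<and> k + l = n"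
  show "p \<in> bihom m n" unfolding bihom_def
  proof (intro CollectI ballI)
    fix e assume e: "e \<in> keys p"
    obtain i j k l where "e = kk i j k l" by (rule kk_exhaust)
    then show "lookup e X1 + lookup e X2 = m \<and> lookup e Y1 + lookup e Y2 = n"
      using * e by (simp add: lookup_kk in_keys_iff)
  qed
qed

lemma bihom_xm: "c = 0 \<or> i + j = m \<and> k + l = n \<Longrightarrow> xm i j k l c \<in> bihom m n"
  by (auto simp: bihom_iff lookup_single when_def kk_inject split: if_splits)

lemma bihom_add: "p \<in> bihom m n \<Longrightarrow> q \<in> bihom m n \<Longrightarrow> p + q \<in> bihom m n"
  unfolding bihom_iff lookup_add by (metis add_cancel_right_left)

lemma bihom_fscale: "p \<in> bihom m n \<Longrightarrow> fscale c p \<in> bihom m n"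
  by (auto simp: bihom_iff)

lemma bihom_diff: "p \<in> bihom m n \<Longrightarrow> q \<in> bihom m n \<Longrightarrow> p - q \<in> bihom m n"
  unfolding bihom_iff lookup_minus by (metis diff_zero)

lemma bihom_0: "0 \<in> bihom m n"
  by (simp add: bihom_iff)

lemma pm_sum_single: "p = (\<Sum>w\<in>keys p. single w (lookup p w))"
  by (rule poly_mapping_eqI)
    (simp add: lookup_sum lookup_single when_def in_keys_iff)

text \<open>Partial sums over subsets of the support remain bihomogeneous, so the induction never
  leaves \<open>bihom m n\<close>.\<close>

lemma bihom_induct [consumes 1, case_names xm add]:
  assumes "p \<in> bihom m n" "\<And>i j k l c. i + j = m \<Longrightarrow> k + l = n \<Longrightarrow> P (xm i j k l c)"
    "\<And>p q. p \<in> bihom m n \<Longrightarrow> q \<in> bihom m n \<Longrightarrow> P p \<Longrightarrow> P q \<Longrightarrow> P (p + q)"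
  shows "P p"
proof -
  have "(\<Sum>w\<in>A. single w (lookup p w)) \<in> bihom m n \<and>
     P (\<Sum>w\<in>A. single w (lookup p w))"
    if "finite A" "A \<subseteq> keys p" for A
    using that
  proof induction
    case empty
    then show ?case using assms(2)[of 0 m 0 n 0] by (simp add: bihom_0)
  next
    case (insert e A)
    obtain i j k l where e: "e = kk i j k l" by (rule kk_exhaust)
    then have ij: "i + j = m" "k + l = n" using insert.prems assms(1) by (auto simp: bihom_iff in_keys_iff)
    then have "xm i j k l (lookup p e) \<in> bihom m n" "P (xm i j k l (lookup p e))"
      using assms(2) by (auto intro: bihom_xm)
    then show ?case using insert assms(3) by (simp add: e bihom_add)
  qed
  from this[of "keys p"] show ?thesis using pm_sum_single[of p] by simp
qed

abbreviation "opE X Y p \<equiv> pv X * pd Y p"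

lemma op_add: "opE X Y (p + q) = opE X Y p + opE X Y q"
  by (simp add: pd_add distrib_left)

lemma op_xm:
  "opE X1 X2 (xm i j k l c) = xm (Suc i) (j - 1) k l (of_nat j * c)"
  "opE X2 X1 (xm i j k l c) = xm (i - 1) (Suc j) k l (of_nat i * c)"
  "opE Y1 Y2 (xm i j k l c) = xm i j (Suc k) (l - 1) (of_nat l * c)"
  "opE Y2 Y1 (xm i j k l c) = xm i j (k - 1) (Suc l) (of_nat k * c)"
  "opE X1 X1 (xm i j k l c) = xm i j k l (of_nat i * c)"
  "opE X2 X2 (xm i j k l c) = xm i j k l (of_nat j * c)"
  "opE Y1 Y1 (xm i j k l c) = xm i j k l (of_nat k * c)"
  "opE Y2 Y2 (xm i j k l c) = xm i j k l (of_nat l * c)"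
  by (simp_all add: pd_xm pv_mult_xm) (cases i; simp; fail | cases j; simp; fail | cases k; simp; fail | cases l; simp; fail)+

lemma op_bihom: "p \<in> bihom m n \<Longrightarrow> opE X1 X2 p \<in> bihom m n" "p \<in> bihom m n \<Longrightarrow> opE X2 X1 p \<in> bihom m n"
  "p \<in> bihom m n \<Longrightarrow> opE Y1 Y2 p \<in> bihom m n" "p \<in> bihom m n \<Longrightarrow> opE Y2 Y1 p \<in> bihom m n"
  "p \<in> bihom m n \<Longrightarrow> opE X1 X1 p \<in> bihom m n" "p \<in> bihom m n \<Longrightarrow> opE X2 X2 p \<in> bihom m n"
  "p \<in> bihom m n \<Longrightarrow> opE Y1 Y1 p \<in> bihom m n" "p \<in> bihom m n \<Longrightarrow> opE Y2 Y2 p \<in> bihom m n"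
  by (induction rule: bihom_induct; (simp only: op_add bihom_add)?; simp only: op_xm; rule bihom_xm; auto)+

lemma lookup_diagonal:
  fixes F :: "xypoly \<Rightarrow> xypoly"
  assumes "\<And>p q. F (p + q) = F p + F q" "\<And>i j k l c. F (xm i j k l c) = xm i j k l (h i j k l * c)"
  shows "lookup (F p) (kk i j k l) = h i j k l * lookup p (kk i j k l)"
  by (induction p rule: xy_induct)
    (auto simp: assms lookup_single lookup_add when_def kk_inject distrib_left)

lemma lookup_H:
  "lookup (opE X1 X1 p - opE X2 X2 p) (kk i j k l) = (of_nat i - of_nat j) * lookup p (kk i j k l)"
  "lookup (opE Y1 Y1 p - opE Y2 Y2 p) (kk i j k l) = (of_nat k - of_nat l) * lookup p (kk i j k l)"
  by (rule lookup_diagonal; simp only: op_add op_xm single_diff[symmetric] left_diff_distrib add_diff_add)+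

lemma lookup_FE:
  "lookup (opE X2 X1 (opE X1 X2 p)) (kk i j k l) = (of_nat j * (of_nat i + 1)) * lookup p (kk i j k l)" (is ?X)
  "lookup (opE Y2 Y1 (opE Y1 Y2 p)) (kk i j k l) = (of_nat l * (of_nat k + 1)) * lookup p (kk i j k l)" (is ?Y)
proof -
  have "opE X2 X1 (opE X1 X2 (xm i j k l c)) = xm i j k l ((of_nat j * (of_nat i + 1)) * c)" for i j k l c
    unfolding op_xm by (cases j) (simp_all add: algebra_simps)
  then show ?X
    by (intro lookup_diagonal) (simp_all only: op_add)
  have "opE Y2 Y1 (opE Y1 Y2 (xm i j k l c)) = xm i j k l ((of_nat l * (of_nat k + 1)) * c)" for i j k l c
    unfolding op_xm by (cases l) (simp_all add: algebra_simps)
  then show ?Y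
    by (intro lookup_diagonal) (simp_all only: op_add)
qed

text \<open>Distinct monomials have no common image, so nothing cancels. As the factor is nonzero,
  e_x e_x p = 0 excludes every exponent of x_2 above 1, and likewise for y_2.\<close>

lemma lookup_EE:
  "lookup (opE X1 X2 (opE X1 X2 p)) (kk (Suc (Suc i)) j k l) =
     of_nat (Suc (Suc j)) * of_nat (Suc j) * lookup p (kk i (Suc (Suc j)) k l)" (is ?X)
  "lookup (opE Y1 Y2 (opE Y1 Y2 p)) (kk i j (Suc (Suc k)) l) =
     of_nat (Suc (Suc l)) * of_nat (Suc l) * lookup p (kk i j k (Suc (Suc l)))" (is ?Y)
proof -
  show ?X
  proof (induction p rule: xy_induct)
    case (xm i' j' k' l' c)
    consider "j' = 0" | "j' = 1" | j'' where "j' = Suc (Suc j'')" by (metis One_nat_def not0_implies_Suc)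
    then show ?case unfolding op_xm by cases (auto simp: lookup_single when_def kk_inject)
  next
    case (add p q)
    then show ?case by (simp only: op_add lookup_add distrib_left)
  qed
  show ?Y
  proof (induction p rule: xy_induct)
    case (xm i' j' k' l' c)
    consider "l' = 0" | "l' = 1" | l'' where "l' = Suc (Suc l'')" by (metis One_nat_def not0_implies_Suc)
    then show ?case unfolding op_xm by cases (auto simp: lookup_single when_def kk_inject)
  next
    case (add p q)
    then show ?case by (simp only: op_add lookup_add distrib_left)
  qed
qed

lemma pv_power: "pv x ^ r = single (single x r) 1"
proof (induction r)
  case 0
  then show ?case by simp
next
  case (Suc r)
  then show ?case by (simp add: pv_def mult_single single_add[symmetric])
qed

lemma monomials:
  "pv X1 ^ i * pv Y1 ^ k = xm i 0 k 0 1" "pv X1 ^ i * pv X2 * pv Y1 ^ k = xm i 1 k 0 1"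
  "pv X1 ^ i * pv Y1 ^ k * pv Y2 = xm i 0 k 1 1" "pv X1 ^ i * pv X2 * pv Y1 ^ k * pv Y2 = xm i 1 k 1 1"
  unfolding pv_power by (simp_all add: pv_def mult_single kk_def add_ac)

text \<open>The equations of \<open>hw_singular_degree_1_iff\<close> act diagonally on monomials, and a natural number
  cannot equal both \<open>- \<tau>\<close> and \<open>\<tau> - 2\<close>, so only one monomial survives.\<close>

lemma diagonal_solutions:
  assumes p: "p \<in> bihom m n" "p \<noteq> 0"
    and x: "opE X1 X2 (opE X1 X2 p) = 0" "fscale \<tau> p + (opE X1 X1 p - opE X2 X2 p) = fscale 2 (opE X2 X1 (opE X1 X2 p))"
    and y: "opE Y1 Y2 (opE Y1 Y2 p) = 0" "fscale \<sigma> p + (opE Y1 Y1 p - opE Y2 Y2 p) = fscale 2 (opE Y2 Y1 (opE Y1 Y2 p))"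
  obtains c j l where "c \<noteq> 0" "p = xm (m - j) j (n - l) l c"
    "j = 0 \<and> \<tau> = - of_nat m \<or> j = 1 \<and> m > 0 \<and> \<tau> = of_nat m + 2"
    "l = 0 \<and> \<sigma> = - of_nat n \<or> l = 1 \<and> n > 0 \<and> \<sigma> = of_nat n + 2"
proof -
  \<comment> \<open>Here \<open>i\<close> and \<open>j\<close> are the exponents of the two
    variables. For \<open>j = 0\<close> the diagonal equation gives \<open>t = - r\<close>; for
    \<open>j = 1\<close> it gives \<open>t = 2 (i + 1) - (i - 1) = i + 3\<close>, which is
    \<open>r + 2\<close> as \<open>r = i + 1\<close>.\<close>
  have aux: "j = 0 \<and> t = - of_nat r \<or> j = 1 \<and> r > 0 \<and> t = of_nat r + 2"
    if "i + j = r" "j \<le> 1" "t + (of_nat i - of_nat j) = 2 * (of_nat j * (of_nat i + 1))" for i j r and t :: complex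
  proof (cases j)
    case 0
    then show ?thesis using that by (auto simp: eq_neg_iff_add_eq_0)
  next
    case (Suc j')
    then have j: "j = 1" "r = Suc i" using that by auto
    have "t = 2 * (of_nat i + 1) - (of_nat i - 1)" using that(3) unfolding j by (simp add: eq_diff_eq)
    then show ?thesis using j by simp
  qed
  have key: "i + j = m \<and> k + l = n \<and> (j = 0 \<and> \<tau> = - of_nat m \<or> j = 1 \<and> m > 0 \<and> \<tau> = of_nat m + 2)
     \<and> (l = 0 \<and> \<sigma> = - of_nat n \<or> l = 1 \<and> n > 0 \<and> \<sigma> = of_nat n + 2)"
    if ne: "lookup p (kk i j k l) \<noteq> 0" for i j k l
  proof -
    have s: "i + j = m" "k + l = n" using p(1) ne by (auto simp: bihom_iff)
    have "j \<le> 1"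
    proof (rule ccontr)
      assume "\<not> j \<le> 1"
      then obtain j' where "j = Suc (Suc j')" by (metis One_nat_def le_SucI le_zero_eq not0_implies_Suc not_less_eq_eq order_refl)
      then show False using lookup_EE(1)[of p i j' k l] ne unfolding x(1) by (simp del: of_nat_Suc)
    qed
    moreover have "l \<le> 1"
    proof (rule ccontr)
      assume "\<not> l \<le> 1"
      then obtain l' where "l = Suc (Suc l')" by (metis One_nat_def le_SucI le_zero_eq not0_implies_Suc not_less_eq_eq order_refl)
      then show False using lookup_EE(2)[of p i j k l'] ne unfolding y(1) by (simp del: of_nat_Suc)
    qed
    moreover have "\<tau> + (of_nat i - of_nat j) = 2 * (of_nat j * (of_nat i + 1))"
    proof -
      have "(\<tau> + (of_nat i - of_nat j)) * lookup p (kk i j k l)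
         = (2 * (of_nat j * (of_nat i + 1))) * lookup p (kk i j k l)"
        using arg_cong[OF x(2), of "\<lambda>q. lookup q (kk i j k l)"]
        by (simp only: lookup_add lookup_fscale lookup_H lookup_FE distrib_right mult.assoc)
      then show ?thesis using ne by (simp only: mult_right_cancel not_False_eq_True simp_thms)
    qed
    moreover have "\<sigma> + (of_nat k - of_nat l) = 2 * (of_nat l * (of_nat k + 1))"
    proof -
      have "(\<sigma> + (of_nat k - of_nat l)) * lookup p (kk i j k l)
         = (2 * (of_nat l * (of_nat k + 1))) * lookup p (kk i j k l)"
        using arg_cong[OF y(2), of "\<lambda>q. lookup q (kk i j k l)"]
        by (simp only: lookup_add lookup_fscale lookup_H lookup_FE distrib_right mult.assoc)
      then show ?thesis using ne by (simp only: mult_right_cancel not_False_eq_True simp_thms)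
    qed
    ultimately show ?thesis using aux[OF s(1)] aux[OF s(2)] s by blast
  qed
  have no: "- (of_nat r :: complex) \<noteq> of_nat r + 2" for r
  proof
    assume "- (of_nat r :: complex) = of_nat r + 2"
    then have "of_nat (r + r + 2) = (0 :: complex)" by (simp add: algebra_simps minus_equation_iff neg_eq_iff_add_eq_0)
    then show False unfolding of_nat_eq_0_iff by simp
  qed
  obtain e where "lookup p e \<noteq> 0" using p(2) by (metis lookup_zero poly_mapping_eqI)
  then obtain i j k l where ne: "lookup p (kk i j k l) \<noteq> 0" using kk_exhaust by metis
  have "p = xm (m - j) j (n - l) l (lookup p (kk i j k l))"
  proof (rule poly_mapping_eqI)
    fix e
    obtain i' j' k' l' where e: "e = kk i' j' k' l'" by (rule kk_exhaust)
    show "lookup p e = lookup (xm (m - j) j (n - l) l (lookup p (kk i j k l))) e"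
    proof (cases "lookup p e = 0")
      case True
      then show ?thesis using key[OF ne] by (auto simp: lookup_single when_def)
    next
      case False
      note key' = key[OF False[unfolded e]]
      have "j' = j" using key[OF ne] key' no[of m] by metis
      moreover have "l' = l" using key[OF ne] key' no[of n] by metis
      ultimately have "e = kk i j k l" "kk (m - j) j (n - l) l = kk i j k l"
        using conjunct1[OF key[OF ne]] conjunct1[OF key'] conjunct1[OF conjunct2[OF key[OF ne]]]
          conjunct1[OF conjunct2[OF key']] e by auto
      then show ?thesis by (simp add: lookup_single)
    qed
  qed
  then show ?thesis by (rule that[OF ne]) (use key[OF ne] in blast)+
qed

section \<open>Candidates written with the w's\<close>

context g0_scalar
begin

lemma wvec_add: "wvec A B C D i + wvec A' B' C' D' i = wvec (A + A') (B + B') (C + C') (D + D') i"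
  by (cases i) (simp_all add: wvec_def scale_right_distrib scale_right_diff_distrib)

lemma wvec_scale: "sc c (wvec A B C D i) = wvec (sc c A) (sc c B) (sc c C) (sc c D) i"
  by (cases i) (simp_all add: wvec_def scale_right_distrib scale_right_diff_distrib mult.commute)

lemma w_add: "p \<doteq> hat (wvec A B C D) \<Longrightarrow> q \<doteq> hat (wvec A' B' C' D') \<Longrightarrow>
    p + q \<doteq> hat (wvec (A + A') (B + B') (C + C') (D + D'))"
  using ceq_trans[OF ceq_add[of p "hat (wvec A B C D)" q "hat (wvec A' B' C' D')"] hat_add]
  by (simp add: wvec_add)

lemma w_scale: "p \<doteq> hat (wvec A B C D) \<Longrightarrow> fscale c p \<doteq> hat (wvec (sc c A) (sc c B) (sc c C) (sc c D))"
  using ceq_trans[OF ceq_fscale[of p "hat (wvec A B C D)" c] hat_scale] by (simp add: wvec_scale)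

lemma w_diff: "p \<doteq> hat (wvec A B C D) \<Longrightarrow> q \<doteq> hat (wvec A' B' C' D') \<Longrightarrow>
    p - q \<doteq> hat (wvec (A - A') (B - B') (C - C') (D - D'))"
  using w_add[of p A B C D "fscale (- 1) q" "- A'" "- B'" "- C'" "- D'"] w_scale[of q A' B' C' D' "- 1"] by simp

lemma tens_diff: "(u - u') \<otimes> v \<doteq> u \<otimes> v - u' \<otimes> v" "(- u) \<otimes> v \<doteq> - (u \<otimes> v)"
proof -
  show *: "(u - u') \<otimes> v \<doteq> u \<otimes> v - u' \<otimes> v" for u u'
    using ceq_sym[OF tens_simps(1)[of "u - u'" u' v]] by (simp add: ceq_def algebra_simps)
  show "(- u) \<otimes> v \<doteq> - (u \<otimes> v)"
    using ceq_trans[OF *[of 0 u] ceq_diff[OF tens_0(2) ceq_refl]] by simp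
qed

lemma hat_explicit: "hat v = eta I1 \<otimes> v I1 + eta I2 \<otimes> v I2 + eta I3 \<otimes> v I3 + eta I4 \<otimes> v I4"
  by (simp add: hat_def UNIV_idx add.assoc)

lemma uconst_tens: "(uconst c * u) \<otimes> v \<doteq> u \<otimes> sc c v"
  by (rule ceq_trans[OF tens_simps(3) ceq_sym[OF tens_simps(4)]])

lemma tens_minus_right: "u \<otimes> (- v) \<doteq> - (u \<otimes> v)"
  using tens_simps(4)[of u "- 1" v] by simp

lemma w_hat:
  "w11 \<otimes> v \<doteq> hat (wvec v 0 0 0)" "w22 \<otimes> v \<doteq> hat (wvec 0 v 0 0)"
  "w12 \<otimes> v \<doteq> hat (wvec 0 0 v 0)" "w21 \<otimes> v \<doteq> hat (wvec 0 0 0 v)"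
proof -
  have z: "eta i \<otimes> (0::'v) \<doteq> 0" for i by (rule tens_0)
  have 1: "w11 \<otimes> v \<doteq> eta I2 \<otimes> v + eta I1 \<otimes> sc \<i> v"
    unfolding w11_def by (rule ceq_trans[OF tens_simps(1) ceq_add[OF ceq_refl uconst_tens]])
  have 2: "w22 \<otimes> v \<doteq> eta I2 \<otimes> v - eta I1 \<otimes> sc \<i> v"
    unfolding w22_def by (rule ceq_trans[OF tens_diff(1) ceq_diff[OF ceq_refl uconst_tens]])
  have 3: "w12 \<otimes> v \<doteq> - (eta I4 \<otimes> v) + eta I3 \<otimes> sc \<i> v"
    unfolding w12_def by (rule ceq_trans[OF tens_simps(1) ceq_add[OF tens_diff(2) uconst_tens]])
  have 4: "w21 \<otimes> v \<doteq> eta I4 \<otimes> v + eta I3 \<otimes> sc \<i> v"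
    unfolding w21_def by (rule ceq_trans[OF tens_simps(1) ceq_add[OF ceq_refl uconst_tens]])
  have h: "hat u \<doteq> p" if "eta I1 \<otimes> u I1 \<doteq> p1" "eta I2 \<otimes> u I2 \<doteq> p2" "eta I3 \<otimes> u I3 \<doteq> p3" "eta I4 \<otimes> u I4 \<doteq> p4"
    "p1 + p2 + p3 + p4 = p" for u p p1 p2 p3 p4
    unfolding hat_explicit that(5)[symmetric] by (intro ceq_add that)
  show "w11 \<otimes> v \<doteq> hat (wvec v 0 0 0)"
    by (rule ceq_trans[OF 1 ceq_sym[OF h[of _ "eta I1 \<otimes> sc \<i> v" "eta I2 \<otimes> v" 0 0]]]) (simp_all add: wvec_def z)
  show "w22 \<otimes> v \<doteq> hat (wvec 0 v 0 0)"
    by (rule ceq_trans[OF 2 ceq_sym[OF h[of _ "- (eta I1 \<otimes> sc \<i> v)" "eta I2 \<otimes> v" 0 0]]])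
      (simp_all add: wvec_def z tens_minus_right)
  show "w12 \<otimes> v \<doteq> hat (wvec 0 0 v 0)"
    by (rule ceq_trans[OF 3 ceq_sym[OF h[of _ 0 0 "eta I3 \<otimes> sc \<i> v" "- (eta I4 \<otimes> v)"]]])
      (simp_all add: wvec_def z tens_minus_right)
  show "w21 \<otimes> v \<doteq> hat (wvec 0 0 0 v)"
    by (rule ceq_trans[OF 4 ceq_sym[OF h[of _ 0 0 "eta I3 \<otimes> sc \<i> v" "eta I4 \<otimes> v"]]])
      (simp_all add: wvec_def z)
qed

text \<open>In the second and fourth form \<open>A\<close> is minus a multiple of \<open>a\<close>
  because w_11 occurs there with coefficient -1.\<close>

lemma cand_forms:
  "eX A = 0 \<Longrightarrow> eY A = 0 \<Longrightarrow> A = sc c a \<Longrightarrow> cand A = icls sc \<rho> (fscale c (w11 \<otimes> a))"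
  "eX A = - sc c d \<Longrightarrow> eY A = 0 \<Longrightarrow> A = - sc c a \<Longrightarrow> cand A = icls sc \<rho> (fscale c (w21 \<otimes> d - w11 \<otimes> a))"
  "eX A = sc c d \<Longrightarrow> eY A = sc c b \<Longrightarrow> eX (eY A) = sc c e \<Longrightarrow> A = sc c a \<Longrightarrow>
     cand A = icls sc \<rho> (fscale c (w22 \<otimes> e - w12 \<otimes> b - w21 \<otimes> d + w11 \<otimes> a))"
  "eX A = 0 \<Longrightarrow> eY A = - sc c b \<Longrightarrow> A = - sc c a \<Longrightarrow> cand A = icls sc \<rho> (fscale c (w12 \<otimes> b - w11 \<otimes> a))"
proof -
  show "cand A = icls sc \<rho> (fscale c (w11 \<otimes> a))" if *: "eX A = 0" "eY A = 0" "A = sc c a"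
  proof -
    have "cand A = icls sc \<rho> (hat (wvec A 0 0 0))" unfolding cand_def *(1,2) by (simp add: lin)
    then show ?thesis using ceq_sym[OF w_scale[OF w_hat(1), of c a]] unfolding *(3) by (simp add: icls_ceq)
  qed
  show "cand A = icls sc \<rho> (fscale c (w21 \<otimes> d - w11 \<otimes> a))" if *: "eX A = - sc c d" "eY A = 0" "A = - sc c a"
  proof -
    have "cand A = icls sc \<rho> (hat (wvec A 0 0 (sc c d)))" unfolding cand_def *(1,2) by (simp add: lin)
    then show ?thesis using ceq_sym[OF w_scale[OF w_diff[OF w_hat(4,1)], of c d a]] unfolding *(3) by (simp add: icls_ceq)
  qed
  show "cand A = icls sc \<rho> (fscale c (w22 \<otimes> e - w12 \<otimes> b - w21 \<otimes> d + w11 \<otimes> a))"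
    if *: "eX A = sc c d" "eY A = sc c b" "eX (eY A) = sc c e" "A = sc c a"
  proof -
    have "cand A = icls sc \<rho> (hat (wvec A (sc c e) (- sc c b) (- sc c d)))" unfolding cand_def *(3) unfolding *(1,2) ..
    then show ?thesis
      using ceq_sym[OF w_scale[OF w_add[OF w_diff[OF w_diff[OF w_hat(2,3)] w_hat(4)] w_hat(1)], of c e b d a]]
      unfolding *(4) by (simp add: icls_ceq)
  qed
  show "cand A = icls sc \<rho> (fscale c (w12 \<otimes> b - w11 \<otimes> a))" if *: "eX A = 0" "eY A = - sc c b" "A = - sc c a"
  proof -
    have "eX (eY A) = 0" using rho_commute(7)[of A] by (simp add: *(1) lin)
    then have "cand A = icls sc \<rho> (hat (wvec A 0 (sc c b) 0))" unfolding cand_def by (simp add: *(1,2))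
    then show ?thesis using ceq_sym[OF w_scale[OF w_diff[OF w_hat(3,1)], of c b a]] unfolding *(3) by (simp add: icls_ceq)
  qed
qed

end

section \<open>Transfer of the equations to polynomials\<close>

locale realized = g0_mod sc \<rho>
  for sc :: "complex \<Rightarrow> 'v::ab_group_add \<Rightarrow> 'v" and \<rho> :: "gvec \<Rightarrow> 'v \<Rightarrow> 'v" +
  fixes m n :: nat and \<mu>t \<mu>C :: complex and \<Phi> :: "xypoly \<Rightarrow> 'v"
  assumes realization: "realization sc \<rho> m n \<mu>t \<mu>C \<Phi>"
begin

lemma Phi_bij: "bij_betw \<Phi> (bihom m n) UNIV"
  and Phi_add: "p \<in> bihom m n \<Longrightarrow> q \<in> bihom m n \<Longrightarrow> \<Phi> (p + q) = \<Phi> p + \<Phi> q"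
  and Phi_scale: "p \<in> bihom m n \<Longrightarrow> \<Phi> (fscale c p) = sc c (\<Phi> p)"
  using realization by (simp_all add: realization_def)

lemma Phi_ops: "p \<in> bihom m n \<Longrightarrow> \<rho> g_e_x (\<Phi> p) = \<Phi> (opE X1 X2 p)" "p \<in> bihom m n \<Longrightarrow> \<rho> g_f_x (\<Phi> p) = \<Phi> (opE X2 X1 p)"
  "p \<in> bihom m n \<Longrightarrow> \<rho> g_h_x (\<Phi> p) = \<Phi> (opE X1 X1 p - opE X2 X2 p)"
  "p \<in> bihom m n \<Longrightarrow> \<rho> g_e_y (\<Phi> p) = \<Phi> (opE Y1 Y2 p)" "p \<in> bihom m n \<Longrightarrow> \<rho> g_f_y (\<Phi> p) = \<Phi> (opE Y2 Y1 p)"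
  "p \<in> bihom m n \<Longrightarrow> \<rho> g_h_y (\<Phi> p) = \<Phi> (opE Y1 Y1 p - opE Y2 Y2 p)"
  "p \<in> bihom m n \<Longrightarrow> \<rho> g_t (\<Phi> p) = \<Phi> (fscale \<mu>t p)" "p \<in> bihom m n \<Longrightarrow> \<rho> g_C (\<Phi> p) = \<Phi> (fscale \<mu>C p)"
  using realization by (simp_all add: realization_def)

lemma Phi_surj: obtains p where "p \<in> bihom m n" "v = \<Phi> p"
  using Phi_bij by (metis UNIV_I bij_betw_iff_bijections)

lemma Phi_inj: "p \<in> bihom m n \<Longrightarrow> q \<in> bihom m n \<Longrightarrow> \<Phi> p = \<Phi> q \<longleftrightarrow> p = q"
  using Phi_bij by (auto simp: bij_betw_def inj_on_eq_iff)

sublocale g0_scalar sc \<rho> \<mu>t \<mu>C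
proof
  fix v
  obtain p where "p \<in> bihom m n" "v = \<Phi> p" by (rule Phi_surj)
  then show "\<rho> g_t v = sc \<mu>t v" "\<rho> g_C v = sc \<mu>C v" by (simp_all add: Phi_ops Phi_scale)
qed

lemma Phi_0: "\<Phi> 0 = 0"
  using Phi_scale[OF bihom_0, of 0] by simp

lemma equations_iff:
  assumes p: "p \<in> bihom m n"
  shows "eX (eX (\<Phi> p)) = 0 \<longleftrightarrow> opE X1 X2 (opE X1 X2 p) = 0"
    "eY (eY (\<Phi> p)) = 0 \<longleftrightarrow> opE Y1 Y2 (opE Y1 Y2 p) = 0"
    "sc \<tau> (\<Phi> p) + hX (\<Phi> p) = sc 2 (fX (eX (\<Phi> p))) \<longleftrightarrow>
       fscale \<tau> p + (opE X1 X1 p - opE X2 X2 p) = fscale 2 (opE X2 X1 (opE X1 X2 p))"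
    "sc \<tau> (\<Phi> p) + hY (\<Phi> p) = sc 2 (fY (eY (\<Phi> p))) \<longleftrightarrow>
       fscale \<tau> p + (opE Y1 Y1 p - opE Y2 Y2 p) = fscale 2 (opE Y2 Y1 (opE Y1 Y2 p))"
  using p
  by (simp_all only: Phi_ops op_bihom bihom_diff Phi_0[symmetric] bihom_0 Phi_inj Phi_scale[symmetric] Phi_add[symmetric]
      bihom_fscale bihom_add)

lemma hw_singular_monomial_iff:
  "nontrivial sc \<rho> M \<and> highest_weight_singular sc \<rho> M \<and> M \<in> Ind_deg sc \<rho> 1 \<longleftrightarrow>
   (\<exists>c j l. c \<noteq> 0 \<and> M = cand (\<Phi> (xm (m - j) j (n - l) l c)) \<and>
     (j = 0 \<and> \<mu>t - \<mu>C = - of_nat m \<or> j = 1 \<and> m > 0 \<and> \<mu>t - \<mu>C = of_nat m + 2) \<and>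
     (l = 0 \<and> \<mu>t + \<mu>C = - of_nat n \<or> l = 1 \<and> n > 0 \<and> \<mu>t + \<mu>C = of_nat n + 2))"
  (is "?L \<longleftrightarrow> ?R")
proof
  assume ?L
  then obtain A where A: "A \<noteq> 0" "M = cand A" "eX (eX A) = 0" "eY (eY A) = 0"
     "sc (\<mu>t - \<mu>C) A + hX A = sc 2 (fX (eX A))" "sc (\<mu>t + \<mu>C) A + hY A = sc 2 (fY (eY A))"
    unfolding hw_singular_degree_1_iff by blast
  obtain p where p: "p \<in> bihom m n" "A = \<Phi> p" by (rule Phi_surj)
  have "p \<noteq> 0" using A(1) p by (auto simp: Phi_0)
  from diagonal_solutions[OF p(1) this A(3)[unfolded p(2) equations_iff[OF p(1)]]
      A(5)[unfolded p(2) equations_iff[OF p(1)]] A(4)[unfolded p(2) equations_iff[OF p(1)]]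
      A(6)[unfolded p(2) equations_iff[OF p(1)]]]
  obtain c j l where "c \<noteq> 0" "p = xm (m - j) j (n - l) l c"
    "j = 0 \<and> \<mu>t - \<mu>C = - of_nat m \<or> j = 1 \<and> m > 0 \<and> \<mu>t - \<mu>C = of_nat m + 2"
    "l = 0 \<and> \<mu>t + \<mu>C = - of_nat n \<or> l = 1 \<and> n > 0 \<and> \<mu>t + \<mu>C = of_nat n + 2" .
  then show ?R unfolding A(2) p(2) by blast
next
  assume ?R
  then obtain c j l where c: "c \<noteq> 0" "M = cand (\<Phi> (xm (m - j) j (n - l) l c))"
    and j: "j = 0 \<and> \<mu>t - \<mu>C = - of_nat m \<or> j = 1 \<and> m > 0 \<and> \<mu>t - \<mu>C = of_nat m + 2"
    and l: "l = 0 \<and> \<mu>t + \<mu>C = - of_nat n \<or> l = 1 \<and> n > 0 \<and> \<mu>t + \<mu>C = of_nat n + 2" by blast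
  let ?p = "xm (m - j) j (n - l) l c"
  have p: "?p \<in> bihom m n" using j l by (intro bihom_xm) auto
  have "?p \<noteq> 0" using c(1) by (metis lookup_single_eq lookup_zero)
  then have "\<Phi> ?p \<noteq> 0" using Phi_inj[OF p bihom_0] by (simp add: Phi_0)
  moreover have "opE X1 X2 (opE X1 X2 ?p) = 0" "opE Y1 Y2 (opE Y1 Y2 ?p) = 0"
    unfolding op_xm using j l by auto
  moreover define \<tau> \<sigma> where "\<tau> = \<mu>t - \<mu>C" and "\<sigma> = \<mu>t + \<mu>C"
  moreover have "fscale \<tau> ?p + (opE X1 X1 ?p - opE X2 X2 ?p) = fscale 2 (opE X2 X1 (opE X1 X2 ?p))"
    using j[folded \<tau>_def] unfolding op_xm fscale_single single_add[symmetric] single_diff[symmetric]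
    by (auto simp: algebra_simps of_nat_diff gr0_conv_Suc)
  moreover have "fscale \<sigma> ?p + (opE Y1 Y1 ?p - opE Y2 Y2 ?p) = fscale 2 (opE Y2 Y1 (opE Y1 Y2 ?p))"
    using l[folded \<sigma>_def] unfolding op_xm fscale_single single_add[symmetric] single_diff[symmetric]
    by (auto simp: algebra_simps of_nat_diff gr0_conv_Suc)
  ultimately show ?L unfolding hw_singular_degree_1_iff using equations_iff[OF p] c(2) by blast
qed

lemma Phi_xm: "i + j = m \<Longrightarrow> k + l = n \<Longrightarrow> \<Phi> (xm i j k l c) = sc c (\<Phi> (xm i j k l 1))"
  using Phi_scale[OF bihom_xm[of 1 i j m k l n], of c] by (simp add: fscale_single)

lemma cand_monomials:
  "cand (\<Phi> (xm m 0 n 0 c)) = icls sc \<rho> (fscale c (w11 \<otimes> \<Phi> (xm m 0 n 0 1)))"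
  "m > 0 \<Longrightarrow> cand (\<Phi> (xm (m - 1) 1 n 0 c)) = icls sc \<rho> (fscale (- c)
      (w21 \<otimes> \<Phi> (xm m 0 n 0 1) - w11 \<otimes> \<Phi> (xm (m - 1) 1 n 0 1)))"
  "m > 0 \<Longrightarrow> n > 0 \<Longrightarrow> cand (\<Phi> (xm (m - 1) 1 (n - 1) 1 c)) = icls sc \<rho> (fscale c
      (w22 \<otimes> \<Phi> (xm m 0 n 0 1) - w12 \<otimes> \<Phi> (xm (m - 1) 1 n 0 1)
       - w21 \<otimes> \<Phi> (xm m 0 (n - 1) 1 1) + w11 \<otimes> \<Phi> (xm (m - 1) 1 (n - 1) 1 1)))"
  "n > 0 \<Longrightarrow> cand (\<Phi> (xm m 0 (n - 1) 1 c)) = icls sc \<rho> (fscale (- c)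
      (w12 \<otimes> \<Phi> (xm m 0 n 0 1) - w11 \<otimes> \<Phi> (xm m 0 (n - 1) 1 1)))"
proof -
  have e: "i + j = m \<Longrightarrow> k + l = n \<Longrightarrow> eX (\<Phi> (xm i j k l d)) = \<Phi> (xm (Suc i) (j - 1) k l (of_nat j * d))"
    "i + j = m \<Longrightarrow> k + l = n \<Longrightarrow> eY (\<Phi> (xm i j k l d)) = \<Phi> (xm i j (Suc k) (l - 1) (of_nat l * d))"
    for i j k l d by (simp_all add: Phi_ops bihom_xm op_xm)
  show "cand (\<Phi> (xm m 0 n 0 c)) = icls sc \<rho> (fscale c (w11 \<otimes> \<Phi> (xm m 0 n 0 1)))"
    by (rule cand_forms(1)) (simp_all add: e lin Phi_0 Phi_xm[of m 0 n 0 c])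
  show "m > 0 \<Longrightarrow> cand (\<Phi> (xm (m - 1) 1 n 0 c)) = icls sc \<rho> (fscale (- c)
      (w21 \<otimes> \<Phi> (xm m 0 n 0 1) - w11 \<otimes> \<Phi> (xm (m - 1) 1 n 0 1)))"
    by (rule cand_forms(2)) (simp_all add: e lin Phi_0 Phi_xm[of _ _ _ _ c])
  show "m > 0 \<Longrightarrow> n > 0 \<Longrightarrow> cand (\<Phi> (xm (m - 1) 1 (n - 1) 1 c)) = icls sc \<rho> (fscale c
      (w22 \<otimes> \<Phi> (xm m 0 n 0 1) - w12 \<otimes> \<Phi> (xm (m - 1) 1 n 0 1)
       - w21 \<otimes> \<Phi> (xm m 0 (n - 1) 1 1) + w11 \<otimes> \<Phi> (xm (m - 1) 1 (n - 1) 1 1)))"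
    by (rule cand_forms(3)) (simp_all add: e lin Phi_0 Phi_xm[of _ _ _ _ c])
  show "n > 0 \<Longrightarrow> cand (\<Phi> (xm m 0 (n - 1) 1 c)) = icls sc \<rho> (fscale (- c)
      (w12 \<otimes> \<Phi> (xm m 0 n 0 1) - w11 \<otimes> \<Phi> (xm m 0 (n - 1) 1 1)))"
    by (rule cand_forms(4)) (simp_all add: e lin Phi_0 Phi_xm[of _ _ _ _ c])
qed

end

section \<open>Existence of the polynomial model\<close>

lemma g_t_central: "a \<in> gsum {0} \<Longrightarrow> gbr g_t a = 0"
proof -
  assume a: "a \<in> gsum {0}"
  have b: "gbr g_t g_h_x = 0" "gbr g_t g_h_y = 0" "gbr g_t g_e_x = 0" "gbr g_t g_f_x = 0" "gbr g_t g_e_y = 0"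
    "gbr g_t g_f_y = 0" "gbr g_t g_t = 0" "gbr g_t g_C = 0"
    by (rule g_t_br; simp)+
  show ?thesis
    by (subst gsum_0_expand[OF a])
      (simp only: gbr_add_right gbr_scale_right Xg_expand b gscale_simps(7) add_0)
qed

text \<open>The lemma on eigenvectors in this context is stated for families in which zero vectors
  are allowed. It thus serves both for the independence of lowered vectors in
  \<open>nilpotent\<close> and for the injectivity of the model in \<open>hw_model\<close>.\<close>

context vector_space
begin

lemma eigenvectors_sum_zero:
  fixes H :: "'b \<Rightarrow> 'b" and x :: "'c \<Rightarrow> 'b"
  assumes H: "\<And>u v. H (u + v) = H u + H v" "\<And>c v. H (scale c v) = scale c (H v)"
    and "finite I" "inj_on lam I" "\<And>i. i \<in> I \<Longrightarrow> H (x i) = scale (lam i) (x i)" "(\<Sum>i\<in>I. x i) = 0" "i \<in> I"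
  shows "x i = 0"
  using assms(3-)
proof (induction I arbitrary: x i rule: finite_induct)
  case (insert k I)
  have Hs: "H (\<Sum>i\<in>A. y i) = (\<Sum>i\<in>A. H (y i))" for A and y :: "'c \<Rightarrow> 'b"
    using H(1) additive_diff(2)[of H, OF H(1)] by (induction A rule: infinite_finite_induct) auto
  have *: "x j = 0" if "j \<in> I" for j
  proof -
    \<comment> \<open>Applying \<open>H\<close> minus the eigenvalue of \<open>x k\<close>
      eliminates \<open>x k\<close> and leaves a vanishing sum over the smaller index set.\<close>
    have "(\<Sum>i\<in>I. scale (lam i - lam k) (x i)) = H (\<Sum>i\<in>insert k I. x i) - scale (lam k) (\<Sum>i\<in>insert k I. x i)"
      using insert.hyps insert.prems(2)
      by (simp add: Hs H scale_sum_right scale_right_distrib scale_left_diff_distrib sum_subtractf)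
    also have "\<dots> = 0" using insert.prems(3) additive_diff(2)[of H, OF H(1)] by simp
    finally have "scale (lam j - lam k) (x j) = 0"
      using insert.prems(1,2) that insert.hyps
      by (intro insert.IH[of "\<lambda>i. scale (lam i - lam k) (x i)"]) (auto simp: H(2) mult.commute)
    moreover have "lam j \<noteq> lam k" using insert.prems(1) insert.hyps that by (auto simp: inj_on_def)
    ultimately show ?thesis by simp
  qed
  moreover have "x k = 0" using insert.prems(3) insert.hyps * by simp
  ultimately show ?case using insert.prems(4) by auto
qed simp

end

context g0_scalar
begin

text \<open>Degree zero is spanned by the two triples with t and C, and the latter two act by
  scalars.\<close>

lemma invariant_subspace:
  assumes S: "subspace S" "\<And>v. v \<in> S \<Longrightarrow> hX v \<in> S \<and> hY v \<in> S \<and> eX v \<in> S \<and> fX v \<in> S \<and> eY v \<in> S \<and> fY v \<in> S"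
    and x: "x \<in> gsum {0}"
  shows "\<rho> x ` S \<subseteq> S"
proof
  fix w assume "w \<in> \<rho> x ` S"
  then obtain v where v: "w = \<rho> x v" "v \<in> S" by blast
  show "w \<in> S" unfolding v(1) rho_expand[OF x] using S(2)[OF v(2)] v(2)
    by (auto intro!: subspace_add[OF S(1)] subspace_scale[OF S(1)])
qed

end

section \<open>Highest weight vectors for sl_2\<close>

locale sl2 = vector_space sc for sc :: "complex \<Rightarrow> 'v::ab_group_add \<Rightarrow> 'v" +
  fixes E F H :: "'v \<Rightarrow> 'v"
  assumes linE: "E (u + v) = E u + E v" "E (sc c v) = sc c (E v)"
    and linF: "F (u + v) = F u + F v" "F (sc c v) = sc c (F v)"
    and linH: "H (u + v) = H u + H v" "H (sc c v) = sc c (H v)"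
    and EF: "E (F v) = F (E v) + H v" and HF: "H (F v) = F (H v) - sc 2 (F v)"
begin

lemma F_0: "F 0 = 0" and E_0: "E 0 = 0"
  using additive_diff[of F, OF linF(1)] additive_diff[of E, OF linE(1)] by auto

lemma H_funpow: "H w = sc \<nu> w \<Longrightarrow> H ((F ^^ i) w) = sc (\<nu> - 2 * of_nat i) ((F ^^ i) w)"
proof (induction i)
  case (Suc i)
  then have "H ((F ^^ Suc i) w) = F (sc (\<nu> - 2 * of_nat i) ((F ^^ i) w)) - sc 2 ((F ^^ Suc i) w)"
    by (simp add: HF)
  also have "\<dots> = sc (\<nu> - 2 * of_nat i) ((F ^^ Suc i) w) - sc 2 ((F ^^ Suc i) w)"
    by (simp add: linF)
  also have "\<dots> = sc (\<nu> - 2 * of_nat i - 2) ((F ^^ Suc i) w)"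
    by (simp only: scale_left_diff_distrib)
  finally show ?case by (simp add: algebra_simps)
qed simp

lemma E_funpow:
  assumes "H w = sc \<nu> w" "E w = 0"
  shows "E ((F ^^ Suc i) w) = sc (of_nat (Suc i) * (\<nu> - of_nat i)) ((F ^^ i) w)"
proof (induction i)
  case 0
  then show ?case using assms by (simp add: EF F_0)
next
  case (Suc i)
  have "E ((F ^^ Suc (Suc i)) w) = F (E ((F ^^ Suc i) w)) + H ((F ^^ Suc i) w)"
    by (simp add: EF)
  also have "\<dots> = sc (of_nat (Suc i) * (\<nu> - of_nat i)) ((F ^^ Suc i) w) + sc (\<nu> - 2 * of_nat (Suc i)) ((F ^^ Suc i) w)"
    unfolding Suc.IH H_funpow[OF assms(1)] linF by simp
  also have "\<dots> = sc (of_nat (Suc i) * (\<nu> - of_nat i) + (\<nu> - 2 * of_nat (Suc i))) ((F ^^ Suc i) w)"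
    by (simp only: scale_left_distrib)
  finally show ?case by (simp add: algebra_simps)
qed

text \<open>If a power up to \<open>m\<close> vanished, raising it back by \<open>E_funpow\<close>
  would force a nonzero multiple of the preceding power to vanish.\<close>

lemma F_funpow_nonzero:
  assumes "H w = sc (of_nat m) w" "E w = 0" "w \<noteq> 0" "i \<le> m"
  shows "(F ^^ i) w \<noteq> 0"
  using assms(4)
proof (induction i)
  case 0
  then show ?case using assms(3) by simp
next
  case (Suc i)
  show ?case
  proof
    assume "(F ^^ Suc i) w = 0"
    then have "sc (of_nat (Suc i) * (of_nat m - of_nat i)) ((F ^^ i) w) = 0"
      using E_funpow[OF assms(1,2), of i] by (simp add: E_0)
    then have "of_nat (Suc i) = (0::complex) \<or> of_nat m = (of_nat i :: complex)" using Suc by simp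
    then show False using Suc.prems by (simp only: of_nat_eq_iff of_nat_eq_0_iff) simp
  qed
qed

text \<open>At the first vanishing power \<open>Suc m\<close>, the factor in \<open>E_funpow\<close>
  multiplies a nonzero vector and must itself be zero, which leaves
  \<open>\<nu> = m\<close>.\<close>

lemma highest_weight_natural:
  assumes "H w = sc \<nu> w" "E w = 0" "w \<noteq> 0" "(F ^^ r) w = 0"
  obtains m where "\<nu> = of_nat m" "(F ^^ Suc m) w = 0"
proof -
  define i where "i = (LEAST r. (F ^^ r) w = 0)"
  have i: "(F ^^ i) w = 0" unfolding i_def by (rule LeastI[of _ r]) (rule assms)
  have min: "(F ^^ j) w \<noteq> 0" if "j < i" for j using not_less_Least that unfolding i_def by blast
  obtain m where m: "i = Suc m" using i assms(3) by (cases i) auto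
  have "sc (of_nat (Suc m) * (\<nu> - of_nat m)) ((F ^^ m) w) = 0"
    using E_funpow[OF assms(1,2), of m] i m by (simp add: E_0)
  then have "\<nu> = of_nat m" using min[of m] m by (simp del: of_nat_Suc)
  then show ?thesis using that i m by blast
qed

end

locale hw_module = g0_scalar sc \<rho> \<mu>t \<mu>C
  for sc :: "complex \<Rightarrow> 'v::ab_group_add \<Rightarrow> 'v" and \<rho> :: "gvec \<Rightarrow> 'v \<Rightarrow> 'v" and \<mu>t \<mu>C +
  fixes v0 :: 'v and \<mu>x \<mu>y :: complex
  assumes irr: "irreducible_g0_module sc \<rho>" and fd: "finite_dim sc"
    and v0: "v0 \<noteq> 0" "\<rho> g_e_x v0 = 0" "\<rho> g_e_y v0 = 0" "\<rho> g_h_x v0 = sc \<mu>x v0" "\<rho> g_h_y v0 = sc \<mu>y v0"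
begin

sublocale x: sl2 sc eX fX hX
  by standard (simp_all add: lin rho_commute)

sublocale y: sl2 sc eY fY hY
  by standard (simp_all add: lin rho_commute)

text \<open>Otherwise the vectors obtained by lowering \<open>v0\<close> would be infinitely many
  eigenvectors with distinct eigenvalues, hence independent in a space of finite dimension.\<close>

lemma nilpotent:
  assumes "sl2 sc E F H" "H v0 = sc \<nu> v0"
  shows "\<exists>r. (F ^^ r) v0 = 0"
proof (rule ccontr)
  assume ne: "\<nexists>r. (F ^^ r) v0 = 0"
  interpret s: sl2 sc E F H by fact
  let ?w = "\<lambda>r. (F ^^ r) v0" and ?lam = "\<lambda>r. \<nu> - 2 * of_nat r"
  have eig: "H (?w r) = sc (?lam r) (?w r)" for r by (rule s.H_funpow[OF assms(2)])
  have inj: "inj ?w"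
  proof (rule injI)
    fix r r' assume *: "?w r = ?w r'"
    have "sc (?lam r) (?w r) = H (?w r)" by (simp only: eig)
    also have "\<dots> = sc (?lam r') (?w r)" by (simp only: * eig)
    finally have "sc (?lam r) (?w r) = sc (?lam r') (?w r)" .
    moreover have "?w r \<noteq> 0" using ne by blast
    ultimately have "?lam r = ?lam r'" by (metis scale_cancel_right)
    then show "r = r'" by simp
  qed
  have "independent (range ?w)"
    unfolding independent_explicit_module
  proof (intro allI impI)
    fix t u v assume t: "finite t" "t \<subseteq> range ?w" "(\<Sum>v\<in>t. sc (u v) v) = 0" "v \<in> t"
    have "sc (u v) v = 0"
    proof (rule eigenvectors_sum_zero[of H t "\<lambda>v. ?lam (inv ?w v)" "\<lambda>v. sc (u v) v"])
      show "inj_on (\<lambda>v. ?lam (inv ?w v)) t"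
        using inj_on_inv_into[OF t(2)] by (auto simp: inj_on_def)
      show "H (sc (u v) v) = sc (?lam (inv ?w v)) (sc (u v) v)" if "v \<in> t" for v
        using that t(2) eig by (auto simp: s.linH inv_f_f[OF inj] mult.commute)
    qed (use t s.linH in auto)
    moreover have "v \<noteq> 0" using t(2,4) ne by auto
    ultimately show "u v = 0" by simp
  qed
  moreover obtain B where "finite B" "span B = UNIV" using fd by (auto simp: finite_dim_def)
  ultimately have "finite (range ?w)" using independent_span_bound[of B "range ?w"] by simp
  then show False using finite_imageD[OF _ inj] by simp
qed

lemma funpow_commute:
  assumes "\<And>v. f (g v) = g (f v)"
  shows "f ((g ^^ i) v) = (g ^^ i) (f v)"
  by (induction i) (simp_all add: assms)

lemma fX_funpow_scale: "(fX ^^ i) (sc c v) = sc c ((fX ^^ i) v)" "(fX ^^ i) 0 = 0"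
  by (induction i) (simp_all add: lin)

lemma fY_funpow_scale: "(fY ^^ i) (sc c v) = sc c ((fY ^^ i) v)" "(fY ^^ i) 0 = 0"
  by (induction i) (simp_all add: lin)

text \<open>The model map sends monomials to multiples of f_x^j f_y^l v0. It is injective because
  the weights separate these vectors, and surjective because its image is a nonzero submodule of an
  irreducible module.\<close>

lemma hw_model: "\<exists>m n \<Phi>. \<mu>x = of_nat m \<and> \<mu>y = of_nat n \<and> realization sc \<rho> m n \<mu>t \<mu>C \<Phi>"
proof -
  obtain r where "(fX ^^ r) v0 = 0" using nilpotent[OF x.sl2_axioms v0(4)] by blast
  then obtain m where m: "\<mu>x = of_nat m" "(fX ^^ Suc m) v0 = 0"
    using x.highest_weight_natural[OF v0(4,2,1)] by blast
  obtain r where "(fY ^^ r) v0 = 0" using nilpotent[OF y.sl2_axioms v0(5)] by blast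
  then obtain n where n: "\<mu>y = of_nat n" "(fY ^^ Suc n) v0 = 0"
    using y.highest_weight_natural[OF v0(5,3,1)] by blast
  define U where "U j l = (fX ^^ j) ((fY ^^ l) v0)" for j l
  have w: "eX ((fY ^^ l) v0) = 0" "hX ((fY ^^ l) v0) = sc (of_nat m) ((fY ^^ l) v0)" for l
    using funpow_commute[of eX fY l v0] funpow_commute[of hX fY l v0] v0(2,4)
    by (simp_all add: rho_commute m(1) fY_funpow_scale)
  have U_fX: "fX (U j l) = U (Suc j) l" for j l by (simp add: U_def)
  have U_fY: "fY (U j l) = U j (Suc l)" for j l
    using funpow_commute[of fY fX j "(fY ^^ l) v0"] by (simp add: U_def rho_commute)
  have U_eX0: "eX (U 0 l) = 0" for l by (simp add: U_def w)
  have U_eX: "eX (U (Suc j) l) = sc (of_nat (Suc j) * (of_nat m - of_nat j)) (U j l)" for j l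
    unfolding U_def by (rule x.E_funpow[OF w(2,1)])
  have U_hX: "hX (U j l) = sc (of_nat m - 2 * of_nat j) (U j l)" for j l
    unfolding U_def by (rule x.H_funpow[OF w(2)])
  have U_eY0: "eY (U j 0) = 0" for j
    using funpow_commute[of eY fX j v0] by (simp add: U_def rho_commute v0 fX_funpow_scale)
  have U_eY: "eY (U j (Suc l)) = sc (of_nat (Suc l) * (of_nat n - of_nat l)) (U j l)" for j l
    using funpow_commute[of eY fX j "(fY ^^ Suc l) v0"] y.E_funpow[OF v0(5,3), of l]
    by (simp only: U_def rho_commute n(1) fX_funpow_scale)
  have U_hY: "hY (U j l) = sc (of_nat n - 2 * of_nat l) (U j l)" for j l
    using funpow_commute[of hY fX j "(fY ^^ l) v0"] y.H_funpow[OF v0(5), of l]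
    by (simp only: U_def rho_commute n(1) fX_funpow_scale)
  have U_top: "U (Suc m) l = 0" "U j (Suc n) = 0" for j l
  proof -
    have "(fX ^^ Suc m) ((fY ^^ l) v0) = (fY ^^ l) ((fX ^^ Suc m) v0)"
      using funpow_commute[of "fX ^^ Suc m" fY l v0] funpow_commute[of fY fX "Suc m"] rho_commute(11) by simp
    then show "U (Suc m) l = 0" using m(2) by (simp only: U_def fY_funpow_scale)
    show "U j (Suc n) = 0" using n(2) by (simp only: U_def fX_funpow_scale)
  qed
  have U_ne: "U j l \<noteq> 0" if "j \<le> m" "l \<le> n" for j l
  proof -
    have "(fY ^^ l) v0 \<noteq> 0"
      using y.F_funpow_nonzero[of v0 n l] v0 n(1) that by simp
    then show ?thesis unfolding U_def using x.F_funpow_nonzero[OF w(2,1)] that by simp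
  qed
  \<comment> \<open>The factorials come from the powers of f_x = x_2 d/dx_1, which send x_1^m to
    m!/(m - j)! times x_1^(m-j) x_2^j; with i = m - j this monomial must go to i! times f_x^j v0
    once x_1^m goes to m! v0. The same holds for y.\<close>
  define \<Phi> :: "xypoly \<Rightarrow> 'v" where "\<Phi> = lext (\<lambda>k c. sc (c * fact (lookup k X1) * fact (lookup k Y1))
       (U (lookup k X2) (lookup k Y2)))"
  have \<Phi>_xm: "\<Phi> (xm i j k l c) = sc (c * fact i * fact k) (U j l)" for i j k l c
    unfolding \<Phi>_def by (subst lext_single) (simp_all add: lookup_kk)
  have \<Phi>_add: "\<Phi> (p + q) = \<Phi> p + \<Phi> q" for p q
    unfolding \<Phi>_def by (rule lext_add) (simp add: distrib_right scale_left_distrib)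
  note \<Phi>_simps = \<Phi>_add additive_diff[of \<Phi>, OF \<Phi>_add]
  have \<Phi>_scale: "\<Phi> (fscale c p) = sc c (\<Phi> p)" for c p
    by (induction p rule: xy_induct)
      (simp_all add: \<Phi>_add \<Phi>_xm fscale_single fs.scale_right_distrib scale_right_distrib mult.assoc)
  have int: "eX (\<Phi> p) = \<Phi> (opE X1 X2 p) \<and> fX (\<Phi> p) = \<Phi> (opE X2 X1 p) \<and> hX (\<Phi> p) = \<Phi> (opE X1 X1 p - opE X2 X2 p) \<and>
    eY (\<Phi> p) = \<Phi> (opE Y1 Y2 p) \<and> fY (\<Phi> p) = \<Phi> (opE Y2 Y1 p) \<and> hY (\<Phi> p) = \<Phi> (opE Y1 Y1 p - opE Y2 Y2 p)"
    if "p \<in> bihom m n" for p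
    using that
  proof (induction rule: bihom_induct)
    case (xm i j k l c)
    have mi: "of_nat m = (of_nat i + of_nat j :: complex)" "of_nat n = (of_nat k + of_nat l :: complex)"
      using xm by (simp_all flip: of_nat_add)
    have "eX (\<Phi> (xm i j k l c)) = \<Phi> (opE X1 X2 (xm i j k l c))"
      unfolding op_xm \<Phi>_xm lin by (cases j) (simp_all add: U_eX0 U_eX mi algebra_simps)
    moreover have "eY (\<Phi> (xm i j k l c)) = \<Phi> (opE Y1 Y2 (xm i j k l c))"
      unfolding op_xm \<Phi>_xm lin by (cases l) (simp_all add: U_eY0 U_eY mi algebra_simps)
    \<comment> \<open>For \<open>i = 0\<close> the exponent \<open>j\<close> equals
      \<open>m\<close>, so the left side involves \<open>U (Suc m) l = 0\<close>, in agreement with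
      the factor zero on the right.\<close>
    moreover have "fX (\<Phi> (xm i j k l c)) = \<Phi> (opE X2 X1 (xm i j k l c))"
      unfolding op_xm \<Phi>_xm lin U_fX using xm U_top by (cases i) (simp_all add: algebra_simps)
    moreover have "fY (\<Phi> (xm i j k l c)) = \<Phi> (opE Y2 Y1 (xm i j k l c))"
      unfolding op_xm \<Phi>_xm lin U_fY using xm U_top by (cases k) (simp_all add: algebra_simps)
    moreover have "hX (\<Phi> (xm i j k l c)) = \<Phi> (opE X1 X1 (xm i j k l c) - opE X2 X2 (xm i j k l c))"
      unfolding op_xm \<Phi>_simps \<Phi>_xm lin U_hX mi scale_scale scale_left_diff_distrib[symmetric] by (simp add: algebra_simps)
    moreover have "hY (\<Phi> (xm i j k l c)) = \<Phi> (opE Y1 Y1 (xm i j k l c) - opE Y2 Y2 (xm i j k l c))"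
      unfolding op_xm \<Phi>_simps \<Phi>_xm lin U_hY mi scale_scale scale_left_diff_distrib[symmetric] by (simp add: algebra_simps)
    ultimately show ?case by blast
  next
    case (add p q)
    then show ?case by (simp add: \<Phi>_simps op_add lin)
  qed
  have ker: "p = 0" if p: "p \<in> bihom m n" "\<Phi> p = 0" for p
  proof (rule ccontr)
    assume "p \<noteq> 0"
    then obtain e where e: "e \<in> keys p" by fastforce
    let ?x = "\<lambda>k. sc (lookup p k * fact (lookup k X1) * fact (lookup k Y1))
       (U (lookup k X2) (lookup k Y2))"
    \<comment> \<open>The eigenvalues of \<open>h\<^sub>x + (m + 1) h\<^sub>y\<close> separate the monomials of bidegree \<open>(m, n)\<close>.\<close>
    let ?H = "\<lambda>v. hX v + sc (of_nat (Suc m)) (hY v)"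
    let ?lam = "\<lambda>k. (of_nat m - 2 * of_nat (lookup k X2))
        + of_nat (Suc m) * (of_nat n - 2 * of_nat (lookup k Y2)) :: complex"
    have deg: "lookup k X1 + lookup k X2 = m" "lookup k Y1 + lookup k Y2 = n"
      if "k \<in> keys p" for k
      using p(1) that by (auto simp: bihom_def)
    have "?x e = 0"
    proof (rule eigenvectors_sum_zero[of ?H "keys p" ?lam ?x])
      show "inj_on ?lam (keys p)"
      proof (rule inj_onI)
        fix k k' assume k: "k \<in> keys p" "k' \<in> keys p" "?lam k = ?lam k'"
        let ?j = "lookup k X2" and ?l = "lookup k Y2"
          and ?j' = "lookup k' X2" and ?l' = "lookup k' Y2"
        have "2 * (of_nat ?j + of_nat (Suc m) * of_nat ?l) = (2 * (of_nat ?j' + of_nat (Suc m) * of_nat ?l') :: complex)"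
          using k(3) by (simp add: algebra_simps del: of_nat_Suc)
        then have "of_nat (?j + Suc m * ?l) = (of_nat (?j' + Suc m * ?l') :: complex)"
          by (simp only: of_nat_add of_nat_mult mult_cancel_left) simp
        then have eq: "?j + Suc m * ?l = ?j' + Suc m * ?l'" by (simp only: of_nat_eq_iff)
        have le: "?j < Suc m" "?j' < Suc m" using deg k(1,2) by fastforce+
        \<comment> \<open>The exponent of x_2 is at most \<open>m\<close>, so it is the remainder of
          the common value modulo \<open>m + 1\<close>.\<close>
        have "?j = ?j'" using arg_cong[OF eq, of "\<lambda>z. z mod Suc m"] le by (simp only: mod_mult_self2 mod_less)
        moreover from this have "Suc m * ?l = Suc m * ?l'" using eq by (simp only: add_left_cancel)
        then have "?l = ?l'" by (simp only: nat_mult_eq_cancel1 zero_less_Suc)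
        ultimately have "lookup k z = lookup k' z" for z
          using deg[OF k(1)] deg[OF k(2)] by (cases z) auto
        then show "k = k'" by (rule poly_mapping_eqI)
      qed
      show "?H (?x k) = sc (?lam k) (?x k)" for k
        unfolding lin U_hX U_hY scale_scale scale_left_distrib[symmetric]
        by (simp add: algebra_simps del: of_nat_Suc)
      show "(\<Sum>k\<in>keys p. ?x k) = 0" using p(2) by (simp add: \<Phi>_def lext_def)
    qed (use e in \<open>auto simp: lin scale_right_distrib mult.commute algebra_simps\<close>)
    moreover have "U (lookup e X2) (lookup e Y2) \<noteq> 0"
      using deg[OF e] by (intro U_ne) auto
    ultimately show False using e by (simp add: in_keys_iff)
  qed
  have "\<Phi> ` bihom m n = UNIV"
  proof -
    let ?S = "\<Phi> ` bihom m n"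
    have S: "subspace ?S"
    proof (rule subspaceI)
      show "0 \<in> ?S" using \<Phi>_simps(3) bihom_0 by (metis imageI)
      show "u + v \<in> ?S" if "u \<in> ?S" "v \<in> ?S" for u v
        using that by (auto simp: \<Phi>_add[symmetric] intro!: imageI bihom_add)
      show "sc c u \<in> ?S" if "u \<in> ?S" for c u
        using that by (auto simp: \<Phi>_scale[symmetric] intro!: imageI bihom_fscale)
    qed
    have "hX v \<in> ?S \<and> hY v \<in> ?S \<and> eX v \<in> ?S \<and> fX v \<in> ?S \<and> eY v \<in> ?S \<and> fY v \<in> ?S" if v: "v \<in> ?S" for v
    proof -
      obtain p where p: "v = \<Phi> p" "p \<in> bihom m n" using v by blast
      show ?thesis using int[OF p(2)] p by (auto intro!: imageI op_bihom bihom_diff)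
    qed
    from invariant_subspace[OF S this] have "\<forall>a\<in>gsum {0}. \<rho> a ` ?S \<subseteq> ?S" by blast
    then have "?S = {0} \<or> ?S = UNIV" using irr S unfolding irreducible_g0_module_def by blast
    moreover have "\<Phi> (xm m 0 n 0 1) \<in> ?S" by (intro imageI bihom_xm) simp
    moreover have "\<Phi> (xm m 0 n 0 1) \<noteq> 0" using U_ne[of 0 0] by (simp add: \<Phi>_xm)
    ultimately show ?thesis by auto
  qed
  moreover have "inj_on \<Phi> (bihom m n)"
  proof (rule inj_onI)
    fix p q assume pq: "p \<in> bihom m n" "q \<in> bihom m n" "\<Phi> p = \<Phi> q"
    then have "p - q = 0" by (intro ker bihom_diff) (simp_all add: \<Phi>_simps)
    then show "p = q" by simp
  qed
  ultimately have "realization sc \<rho> m n \<mu>t \<mu>C \<Phi>"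
    using int by (auto simp: realization_def bij_betw_def \<Phi>_add \<Phi>_scale rho_t rho_C)
  then show ?thesis using m(1) n(1) by blast
qed

end

context g0_mod
begin

text \<open>The Schur argument: the eigenspace of a central element is a submodule, and the given
  eigenvector makes it nonzero, so it is everything.\<close>

lemma scalar_of_central:
  assumes irr: "irreducible_g0_module sc \<rho>" and z: "z \<in> gsum {0}" "\<And>a. a \<in> gsum {0} \<Longrightarrow> gbr z a = 0"
    and v: "v \<noteq> 0" "\<rho> z v = sc \<mu> v"
  shows "\<rho> z w = sc \<mu> w"
proof -
  let ?S = "{w. \<rho> z w = sc \<mu> w}"
  have z0: "\<rho> z 0 = 0" using rho_linear(1)[OF z(1), of 0 0] by simp
  have S: "subspace ?S"
    by (rule subspaceI) (simp_all add: rho_linear[OF z(1)] z0 scale_right_distrib mult.commute)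
  have "\<rho> a ` ?S \<subseteq> ?S" if a: "a \<in> gsum {0}" for a
  proof -
    have "\<rho> 0 u = 0" for u using rho_add[of 0 0 u] zero_gsum by simp
    then have "\<rho> z (\<rho> a u) = \<rho> a (\<rho> z u)" for u
      using rho_br[OF z(1) a, of u] z(2)[OF a] by simp
    then show ?thesis by (auto simp: rho_linear[OF a])
  qed
  then have "?S = {0} \<or> ?S = UNIV" using irr S unfolding irreducible_g0_module_def by blast
  then show ?thesis using v by auto
qed

end

theorem realization_exists:
  assumes irr: "irreducible_g0_module sc \<rho>" and fd: "finite_dim sc"
    and hw: "has_highest_weight sc \<rho> (\<mu>x, \<mu>y, \<mu>t, \<mu>C)"
  shows "\<exists>m n \<Phi>. \<mu>x = of_nat m \<and> \<mu>y = of_nat n \<and> realization sc \<rho> m n \<mu>t \<mu>C \<Phi>"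
proof -
  interpret g0_mod sc \<rho> using irr by unfold_locales (simp add: irreducible_g0_module_def)
  obtain v where v: "v \<noteq> 0" "\<rho> g_e_x v = 0" "\<rho> g_e_y v = 0" "\<rho> g_h_x v = sc \<mu>x v" "\<rho> g_h_y v = sc \<mu>y v"
    "\<rho> g_t v = sc \<mu>t v" "\<rho> g_C v = sc \<mu>C v"
    using hw by (auto simp: has_highest_weight_def)
  interpret hw_module sc \<rho> \<mu>t \<mu>C v \<mu>x \<mu>y
    by unfold_locales
      (use irr fd v scalar_of_central[OF irr g_gsum(7) g_t_central v(1,6)]
        scalar_of_central[OF irr g_gsum(8) g_C_br v(1,7)] in auto)
  show ?thesis by (rule hw_model)
qed

section \<open>The four families\<close>

context realized
begin

lemma hw_singular_cases:
  "nontrivial sc \<rho> M \<and> highest_weight_singular sc \<rho> M \<and> M \<in> Ind_deg sc \<rho> 1 \<longleftrightarrow>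
   (\<exists>c. c \<noteq> 0 \<and>
      ( (\<mu>t = - (of_nat m + of_nat n) / 2 \<and> \<mu>C = (of_nat m - of_nat n) / 2 \<and>
         M = icls sc \<rho> (fscale c (w11 \<otimes> \<Phi> (pv X1 ^ m * pv Y1 ^ n))))
      \<or> (m > 0 \<and>
         \<mu>t = 1 + (of_nat m - of_nat n) / 2 \<and> \<mu>C = - 1 - (of_nat m + of_nat n) / 2 \<and>
         M = icls sc \<rho> (fscale c
               (w21 \<otimes> \<Phi> (pv X1 ^ m * pv Y1 ^ n)
                - w11 \<otimes> \<Phi> (pv X1 ^ (m - 1) * pv X2 * pv Y1 ^ n))))
      \<or> (m > 0 \<and> n > 0 \<and>
         \<mu>t = 2 + (of_nat m + of_nat n) / 2 \<and> \<mu>C = (of_nat n - of_nat m) / 2 \<and>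
         M = icls sc \<rho> (fscale c
               (w22 \<otimes> \<Phi> (pv X1 ^ m * pv Y1 ^ n)
                - w12 \<otimes> \<Phi> (pv X1 ^ (m - 1) * pv X2 * pv Y1 ^ n)
                - w21 \<otimes> \<Phi> (pv X1 ^ m * pv Y1 ^ (n - 1) * pv Y2)
                + w11 \<otimes> \<Phi> (pv X1 ^ (m - 1) * pv X2 * pv Y1 ^ (n - 1) * pv Y2))))
      \<or> (n > 0 \<and>
         \<mu>t = 1 + (of_nat n - of_nat m) / 2 \<and> \<mu>C = 1 + (of_nat m + of_nat n) / 2 \<and>
         M = icls sc \<rho> (fscale c
               (w12 \<otimes> \<Phi> (pv X1 ^ m * pv Y1 ^ n)
                - w11 \<otimes> \<Phi> (pv X1 ^ m * pv Y1 ^ (n - 1) * pv Y2))))))"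
proof -
  define a b :: complex where "a = of_nat m" and "b = of_nat n"
  have solve: "\<mu>t - \<mu>C = u \<and> \<mu>t + \<mu>C = v \<longleftrightarrow> \<mu>t = (u + v) / 2 \<and> \<mu>C = (v - u) / 2" for u v
  proof (intro iffI conjI; elim conjE)
    show "\<mu>t = (u + v) / 2" "\<mu>C = (v - u) / 2" if "\<mu>t - \<mu>C = u" "\<mu>t + \<mu>C = v"
      unfolding that[symmetric] by simp_all
    show "\<mu>t - \<mu>C = u" "\<mu>t + \<mu>C = v" if "\<mu>t = (u + v) / 2" "\<mu>C = (v - u) / 2"
      unfolding that by (simp_all add: field_simps)
  qed
  have 1: "\<mu>t - \<mu>C = - a \<and> \<mu>t + \<mu>C = - b \<longleftrightarrow> \<mu>t = - (a + b) / 2 \<and> \<mu>C = (a - b) / 2"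
    "\<mu>t - \<mu>C = a + 2 \<and> \<mu>t + \<mu>C = - b \<longleftrightarrow> \<mu>t = 1 + (a - b) / 2 \<and> \<mu>C = - 1 - (a + b) / 2"
    "\<mu>t - \<mu>C = a + 2 \<and> \<mu>t + \<mu>C = b + 2 \<longleftrightarrow> \<mu>t = 2 + (a + b) / 2 \<and> \<mu>C = (b - a) / 2"
    "\<mu>t - \<mu>C = - a \<and> \<mu>t + \<mu>C = b + 2 \<longleftrightarrow> \<mu>t = 1 + (b - a) / 2 \<and> \<mu>C = 1 + (a + b) / 2"
    unfolding solve by (simp_all add: add_divide_distrib diff_divide_distrib algebra_simps eq_neg_iff_add_eq_0)
  let ?P = "\<lambda>c j l. cand (\<Phi> (xm (m - j) j (n - l) l c))"
  \<comment> \<open>The second and fourth family use \<open>- c\<close> because the monomial is the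
    coefficient of w_11, which has a minus sign in the stated vectors.\<close>
  have "(\<exists>c j l. c \<noteq> 0 \<and> M = ?P c j l \<and>
     (j = 0 \<and> \<mu>t - \<mu>C = - a \<or> j = 1 \<and> m > 0 \<and> \<mu>t - \<mu>C = a + 2) \<and>
     (l = 0 \<and> \<mu>t + \<mu>C = - b \<or> l = 1 \<and> n > 0 \<and> \<mu>t + \<mu>C = b + 2)) \<longleftrightarrow>
    (\<exists>c. c \<noteq> 0 \<and> (((\<mu>t - \<mu>C = - a \<and> \<mu>t + \<mu>C = - b) \<and> M = ?P c 0 0) \<or>
      (m > 0 \<and> (\<mu>t - \<mu>C = a + 2 \<and> \<mu>t + \<mu>C = - b) \<and> M = ?P (- c) 1 0) \<or>
      (m > 0 \<and> n > 0 \<and> (\<mu>t - \<mu>C = a + 2 \<and> \<mu>t + \<mu>C = b + 2) \<and> M = ?P c 1 1) \<or>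
      (n > 0 \<and> (\<mu>t - \<mu>C = - a \<and> \<mu>t + \<mu>C = b + 2) \<and> M = ?P (- c) 0 1)))" (is "?L \<longleftrightarrow> ?R")
  proof
    assume ?L
    then obtain c j l where c: "c \<noteq> 0" "M = ?P c j l"
      "j = 0 \<and> \<mu>t - \<mu>C = - a \<or> j = 1 \<and> m > 0 \<and> \<mu>t - \<mu>C = a + 2"
      "l = 0 \<and> \<mu>t + \<mu>C = - b \<or> l = 1 \<and> n > 0 \<and> \<mu>t + \<mu>C = b + 2" by blast
    from c(3,4) show ?R
    proof (elim disjE conjE)
      show ?R if "j = 0" "l = 0" "\<mu>t - \<mu>C = - a" "\<mu>t + \<mu>C = - b"
        by (rule exI[of _ c]) (use that c(1,2) in simp)
      show ?R if "j = 1" "0 < m" "l = 0" "\<mu>t - \<mu>C = a + 2" "\<mu>t + \<mu>C = - b"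
        by (rule exI[of _ "- c"]) (use that c(1,2) in simp)
      show ?R if "j = 1" "0 < m" "l = 1" "0 < n" "\<mu>t - \<mu>C = a + 2" "\<mu>t + \<mu>C = b + 2"
        by (rule exI[of _ c]) (use that c(1,2) in simp)
      show ?R if "j = 0" "l = 1" "0 < n" "\<mu>t - \<mu>C = - a" "\<mu>t + \<mu>C = b + 2"
        by (rule exI[of _ "- c"]) (use that c(1,2) in simp)
    qed
  next
    assume ?R
    then obtain c where c: "c \<noteq> 0" and d: "((\<mu>t - \<mu>C = - a \<and> \<mu>t + \<mu>C = - b) \<and> M = ?P c 0 0) \<or>
      (m > 0 \<and> (\<mu>t - \<mu>C = a + 2 \<and> \<mu>t + \<mu>C = - b) \<and> M = ?P (- c) 1 0) \<or>
      (m > 0 \<and> n > 0 \<and> (\<mu>t - \<mu>C = a + 2 \<and> \<mu>t + \<mu>C = b + 2) \<and> M = ?P c 1 1) \<or>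
      (n > 0 \<and> (\<mu>t - \<mu>C = - a \<and> \<mu>t + \<mu>C = b + 2) \<and> M = ?P (- c) 0 1)" by blast
    have "- c \<noteq> 0" using c by simp
    with c d show ?L by blast
  qed
  note iff = this
  have P: "?P c 0 0 = icls sc \<rho> (fscale c (w11 \<otimes> \<Phi> (xm m 0 n 0 1)))"
    "m > 0 \<Longrightarrow> ?P (- c) 1 0 = icls sc \<rho> (fscale c
      (w21 \<otimes> \<Phi> (xm m 0 n 0 1) - w11 \<otimes> \<Phi> (xm (m - 1) 1 n 0 1)))"
    "n > 0 \<Longrightarrow> ?P (- c) 0 1 = icls sc \<rho> (fscale c
      (w12 \<otimes> \<Phi> (xm m 0 n 0 1) - w11 \<otimes> \<Phi> (xm m 0 (n - 1) 1 1)))" for c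
    using cand_monomials(1)[of c] cand_monomials(2)[of "- c"] cand_monomials(4)[of "- c"]
    unfolding minus_minus diff_zero by simp_all
  show ?thesis
    unfolding hw_singular_monomial_iff a_def[symmetric] b_def[symmetric] iff
    \<comment> \<open>Longer products are rewritten first, since the shorter left-hand sides occur
      inside them.\<close>
    unfolding 1 monomials(4) unfolding monomials(3) unfolding monomials(2) unfolding monomials(1)
    by (simp only: P cand_monomials(3) conj_assoc cong: conj_cong)
qed

end

text \<open>From left to right the model is supplied by \<open>realization_exists\<close>; from
  right to left any given realization works, since \<open>hw_singular_cases\<close> holds for each
  of them.\<close>

theorem theorem6p6:
  fixes sc :: "complex \<Rightarrow> 'v::ab_group_add \<Rightarrow> 'v"
    and \<rho> :: "gvec \<Rightarrow> 'v \<Rightarrow> 'v"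
    and \<mu> :: "complex \<times> complex \<times> complex \<times> complex"
    and M :: "'v tfree set"
  assumes "irreducible_g0_module sc \<rho>"
    and "finite_dim sc"
    and "has_highest_weight sc \<rho> \<mu>"
    and "M \<in> Ind sc \<rho>"
  shows "nontrivial sc \<rho> M \<and> highest_weight_singular sc \<rho> M \<and> M \<in> Ind_deg sc \<rho> 1 \<longleftrightarrow>
    (\<exists>(m::nat) (n::nat) \<mu>t \<mu>C \<Phi> (c::complex).
      c \<noteq> 0 \<and> \<mu> = (of_nat m, of_nat n, \<mu>t, \<mu>C) \<and> realization sc \<rho> m n \<mu>t \<mu>C \<Phi> \<and>
      ( (\<mu>t = - (of_nat m + of_nat n) / 2 \<and> \<mu>C = (of_nat m - of_nat n) / 2 \<and>
         M = icls sc \<rho> (fscale c (w11 \<otimes> \<Phi> (pv X1 ^ m * pv Y1 ^ n))))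
      \<or> (m > 0 \<and>
         \<mu>t = 1 + (of_nat m - of_nat n) / 2 \<and> \<mu>C = - 1 - (of_nat m + of_nat n) / 2 \<and>
         M = icls sc \<rho> (fscale c
               (w21 \<otimes> \<Phi> (pv X1 ^ m * pv Y1 ^ n)
                - w11 \<otimes> \<Phi> (pv X1 ^ (m - 1) * pv X2 * pv Y1 ^ n))))
      \<or> (m > 0 \<and> n > 0 \<and>
         \<mu>t = 2 + (of_nat m + of_nat n) / 2 \<and> \<mu>C = (of_nat n - of_nat m) / 2 \<and>
         M = icls sc \<rho> (fscale c
               (w22 \<otimes> \<Phi> (pv X1 ^ m * pv Y1 ^ n)
                - w12 \<otimes> \<Phi> (pv X1 ^ (m - 1) * pv X2 * pv Y1 ^ n)
                - w21 \<otimes> \<Phi> (pv X1 ^ m * pv Y1 ^ (n - 1) * pv Y2)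
                + w11 \<otimes> \<Phi> (pv X1 ^ (m - 1) * pv X2 * pv Y1 ^ (n - 1) * pv Y2))))
      \<or> (n > 0 \<and>
         \<mu>t = 1 + (of_nat n - of_nat m) / 2 \<and> \<mu>C = 1 + (of_nat m + of_nat n) / 2 \<and>
         M = icls sc \<rho> (fscale c
               (w12 \<otimes> \<Phi> (pv X1 ^ m * pv Y1 ^ n)
                - w11 \<otimes> \<Phi> (pv X1 ^ m * pv Y1 ^ (n - 1) * pv Y2))))))"
proof -
  obtain \<mu>x \<mu>y \<mu>t \<mu>C where \<mu>: "\<mu> = (\<mu>x, \<mu>y, \<mu>t, \<mu>C)" by (cases \<mu>)
  have g0: "g0_mod sc \<rho>"
    using assms(1) by unfold_locales (simp add: irreducible_g0_module_def)
  have R: "realized sc \<rho> m n \<mu>t \<mu>C \<Phi>" if "realization sc \<rho> m n \<mu>t \<mu>C \<Phi>" for m n \<mu>t \<mu>C \<Phi>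
    using g0 that by (simp add: realized_def realized_axioms_def)
  show ?thesis (is "?L \<longleftrightarrow> ?R")
  proof
    assume L: ?L
    obtain m n \<Phi> where mn: "\<mu>x = of_nat m" "\<mu>y = of_nat n" and r: "realization sc \<rho> m n \<mu>t \<mu>C \<Phi>"
      using realization_exists[OF assms(1,2) assms(3)[unfolded \<mu>]] by blast
    from iffD1[OF realized.hw_singular_cases[OF R[OF r]] L] show ?R
      unfolding \<mu> mn using r
      by (elim exE conjE, intro exI[of _ m] exI[of _ n] exI[of _ \<mu>t] exI[of _ \<mu>C] exI[of _ \<Phi>] exI conjI)
        (assumption | rule refl)+
  next
    assume ?R
    then show ?L
      by (elim exE conjE) (rule iffD2[OF realized.hw_singular_cases[OF R]], assumption, rule exI, rule conjI, assumption+)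
  qed
qed

end
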